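(* Let $V$ be a complex vector space of dimension $4$ and let $t\ge 2$ be an integer. Then, in the representation ring of $SL(V)=SL_4(\mathbb{C})$, $$\begin{aligned}S^t(S^2)={}&S^{2t}+\mathbb{S}_{2,2}\cdot\bigl(S^{t-2}(S^2)+S^{t-6}(S^2)\bigr)-\mathbb{S}_{3,2,1}\cdot\bigl(S^{t-3}(S^2)+S^{t-5}(S^2)\bigr)\\&+(\mathbb{S}_{3,3,2}+\mathbb{S}_{3,1})\cdot S^{t-4}(S^2)-S^{t-8}(S^2).\end{aligned}$$
   Context: $S^m$ denotes the $m$-th symmetric power $S^m(V)$, $S^r(S^s)$ denotes $S^r(S^s(V))$, and $\mathbb{S}_{\lambda}$ denotes the Schur functor of the partition $\lambda$ applied to $V$. The product $\cdot$ denotes the tensor product of representations, and $+$, $-$ denote sum and difference in the representation (Grothendieck) ring. By convention $S^\ell(\ldots)=0$ for $\ell<0$. *)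

theory Defs
  imports "Jordan_Normal_Form.Matrix_Kernel"
begin

section \<open>Rational representations of \<open>SL_4(\<complex>)\<close>\<close>

definition SL4 :: "complex mat set" where
  "SL4 = {g \<in> carrier_mat 4 4. det g = 1}"

text \<open>Polynomial functions in the 16 matrix entries. Since \<open>SL_4\<close> is closed in the space of
  matrices, its regular functions are exactly the restrictions of these.\<close>

inductive_set poly_funs :: "(complex mat \<Rightarrow> complex) set" where
  const: "(\<lambda>_. c) \<in> poly_funs"
| coord: "i < 4 \<Longrightarrow> j < 4 \<Longrightarrow> (\<lambda>g. g $$ (i, j)) \<in> poly_funs"
| add: "p \<in> poly_funs \<Longrightarrow> q \<in> poly_funs \<Longrightarrow> (\<lambda>g. p g + q g) \<in> poly_funs"
| mult: "p \<in> poly_funs \<Longrightarrow> q \<in> poly_funs \<Longrightarrow> (\<lambda>g. p g * q g) \<in> poly_funs"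

definition regular :: "(complex mat \<Rightarrow> complex) \<Rightarrow> bool" where
  "regular f \<longleftrightarrow> (\<exists>p\<in>poly_funs. \<forall>g\<in>SL4. f g = p g)"

definition is_rep :: "nat \<Rightarrow> (complex mat \<Rightarrow> complex mat) \<Rightarrow> bool" where
  "is_rep n \<rho> \<longleftrightarrow>
     (\<forall>g\<in>SL4. \<rho> g \<in> carrier_mat n n) \<and>
     \<rho> (1\<^sub>m 4) = 1\<^sub>m n \<and>
     (\<forall>g\<in>SL4. \<forall>h\<in>SL4. \<rho> (g * h) = \<rho> g * \<rho> h) \<and>
     (\<forall>i<n. \<forall>j<n. regular (\<lambda>g. \<rho> g $$ (i, j)))"

lemma one_in_SL4: "1\<^sub>m 4 \<in> SL4"
  by (simp add: SL4_def)

lemma SL4_mult: "g \<in> SL4 \<Longrightarrow> h \<in> SL4 \<Longrightarrow> g * h \<in> SL4"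
  by (auto simp: SL4_def det_mult[of _ 4])

lemma regular_const: "regular (\<lambda>_. c)"
  unfolding regular_def by (rule bexI[OF _ poly_funs.const[of c]]) simp

lemma regular_coord: "i < 4 \<Longrightarrow> j < 4 \<Longrightarrow> regular (\<lambda>g. g $$ (i, j))"
  unfolding regular_def by (rule bexI[OF _ poly_funs.coord[of i j]]) simp_all

lemma regular_mult: "regular p \<Longrightarrow> regular q \<Longrightarrow> regular (\<lambda>g. p g * q g)"
  proof -
  assume "regular p" "regular q"
  then obtain p' q' where "p' \<in> poly_funs" "q' \<in> poly_funs" "\<forall>g\<in>SL4. p g = p' g \<and> q g = q' g"
    unfolding regular_def by blast
  then show ?thesis
    unfolding regular_def by (intro bexI[OF _ poly_funs.mult[of p' q']]) simp_all
qed

lemma regular_cong: "(\<And>g. g \<in> SL4 \<Longrightarrow> p g = q g) \<Longrightarrow> regular p \<longleftrightarrow> regular q"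
  unfolding regular_def by simp

typedef rep = "{(n, \<rho>). is_rep n \<rho>}"
proof
  show "(0, \<lambda>_. 1\<^sub>m 0) \<in> {(n, \<rho>). is_rep n \<rho>}"
    by (simp add: is_rep_def)
qed

definition rdim :: "rep \<Rightarrow> nat" where
  "rdim U = fst (Rep_rep U)"

definition act :: "rep \<Rightarrow> complex mat \<Rightarrow> complex mat" where
  "act U = snd (Rep_rep U)"

lemma act_is_rep: "is_rep (rdim U) (act U)"
  using Rep_rep[of U] by (auto simp: rdim_def act_def)

lemma Abs_rep_simps:
  assumes "is_rep n \<rho>"
  shows "rdim (Abs_rep (n, \<rho>)) = n" "act (Abs_rep (n, \<rho>)) = \<rho>"
  using assms by (simp_all add: rdim_def act_def Abs_rep_inverse)

lemma act_carrier: "g \<in> SL4 \<Longrightarrow> act U g \<in> carrier_mat (rdim U) (rdim U)"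
  and act_one: "act U (1\<^sub>m 4) = 1\<^sub>m (rdim U)"
  and act_mult: "g \<in> SL4 \<Longrightarrow> h \<in> SL4 \<Longrightarrow> act U (g * h) = act U g * act U h"
  and act_regular: "i < rdim U \<Longrightarrow> j < rdim U \<Longrightarrow> regular (\<lambda>g. act U g $$ (i, j))"
  using act_is_rep[of U] unfolding is_rep_def by auto

lemma act_dim [simp]:
  "g \<in> SL4 \<Longrightarrow> dim_row (act U g) = rdim U" "g \<in> SL4 \<Longrightarrow> dim_col (act U g) = rdim U"
  using act_carrier by auto

definition trivial_rep :: rep where
  "trivial_rep = Abs_rep (1, \<lambda>_. 1\<^sub>m 1)"

definition zero_rep :: rep where
  "zero_rep = Abs_rep (0, \<lambda>_. 1\<^sub>m 0)"

definition std_rep :: rep where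
  "std_rep = Abs_rep (4, \<lambda>g. g)"

lemma is_rep_basic: "is_rep 1 (\<lambda>_. 1\<^sub>m 1)" "is_rep 0 (\<lambda>_. 1\<^sub>m 0)" "is_rep 4 (\<lambda>g. g)"
  by (auto simp: is_rep_def regular_const regular_coord SL4_def)

definition rep_iso :: "rep \<Rightarrow> rep \<Rightarrow> bool" where
  "rep_iso U W \<longleftrightarrow> rdim U = rdim W \<and>
     (\<exists>P \<in> carrier_mat (rdim W) (rdim U). invertible_mat P \<and>
        (\<forall>g\<in>SL4. P * act U g = act W g * P))"


subsection \<open>Direct sum and tensor product\<close>

definition dsum_mat :: "complex mat \<Rightarrow> complex mat \<Rightarrow> complex mat" where
  "dsum_mat A B = four_block_mat A (0\<^sub>m (dim_row A) (dim_col B)) (0\<^sub>m (dim_row B) (dim_col A)) B"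

definition kron_mat :: "complex mat \<Rightarrow> complex mat \<Rightarrow> complex mat" where
  "kron_mat A B = mat (dim_row A * dim_row B) (dim_col A * dim_col B)
     (\<lambda>(i, j). A $$ (i div dim_row B, j div dim_col B) * B $$ (i mod dim_row B, j mod dim_col B))"

lemma dsum_mat_dim [simp]:
  "dim_row (dsum_mat A B) = dim_row A + dim_row B"
  "dim_col (dsum_mat A B) = dim_col A + dim_col B"
  by (simp_all add: dsum_mat_def)

lemma kron_mat_dim [simp]:
  "dim_row (kron_mat A B) = dim_row A * dim_row B"
  "dim_col (kron_mat A B) = dim_col A * dim_col B"
  by (simp_all add: kron_mat_def)

lemma dsum_mat_carrier:
  "A \<in> carrier_mat a b \<Longrightarrow> B \<in> carrier_mat c d \<Longrightarrow> dsum_mat A B \<in> carrier_mat (a + c) (b + d)"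
  by (intro carrier_matI) auto

lemma kron_mat_carrier:
  "A \<in> carrier_mat a b \<Longrightarrow> B \<in> carrier_mat c d \<Longrightarrow> kron_mat A B \<in> carrier_mat (a * c) (b * d)"
  by (intro carrier_matI) auto

lemma dsum_mat_one: "dsum_mat (1\<^sub>m a) (1\<^sub>m b) = 1\<^sub>m (a + b)"
  by (simp add: dsum_mat_def)

lemma dsum_mat_mult:
  assumes "A \<in> carrier_mat a b" "B \<in> carrier_mat c d" "C \<in> carrier_mat b e" "D \<in> carrier_mat d f"
  shows "dsum_mat A B * dsum_mat C D = dsum_mat (A * C) (B * D)"
proof -
  have AC: "A * C \<in> carrier_mat a e" and BD: "B * D \<in> carrier_mat c f"
    using assms by auto
  have 1: "dsum_mat A B = four_block_mat A (0\<^sub>m a d) (0\<^sub>m c b) B"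
    "dsum_mat C D = four_block_mat C (0\<^sub>m b f) (0\<^sub>m d e) D"
    "dsum_mat (A * C) (B * D) = four_block_mat (A * C) (0\<^sub>m a f) (0\<^sub>m c e) (B * D)"
    using assms AC BD by (simp_all only: dsum_mat_def carrier_matD)
  have 2: "A * C + 0\<^sub>m a d * 0\<^sub>m d e = A * C" "A * 0\<^sub>m b f + 0\<^sub>m a d * D = 0\<^sub>m a f"
    "0\<^sub>m c b * C + B * 0\<^sub>m d e = 0\<^sub>m c e" "0\<^sub>m c b * 0\<^sub>m b f + B * D = B * D"
    using assms AC BD by simp_all
  show ?thesis
    unfolding 1
    by (subst mult_four_block_mat[OF assms(1) zero_carrier_mat zero_carrier_mat assms(2)
          assms(3) zero_carrier_mat zero_carrier_mat assms(4)]) (simp only: 2)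
qed

lemma dsum_mat_index:
  "A \<in> carrier_mat a a \<Longrightarrow> B \<in> carrier_mat b b \<Longrightarrow> i < a + b \<Longrightarrow> j < a + b \<Longrightarrow>
   dsum_mat A B $$ (i, j) =
     (if i < a then if j < a then A $$ (i, j) else 0
      else if j < a then 0 else B $$ (i - a, j - a))"
  by (auto simp: dsum_mat_def)

lemma div_less_mult: "i < a * b \<Longrightarrow> i div b < (a::nat)"
  by (simp add: less_mult_imp_div_less)

lemma mod_less_mult: "i < a * b \<Longrightarrow> i mod b < (b::nat)"
  by (cases "b = 0") simp_all

lemma kron_mat_index:
  "A \<in> carrier_mat a b \<Longrightarrow> B \<in> carrier_mat c d \<Longrightarrow> i < a * c \<Longrightarrow> j < b * d \<Longrightarrow>
   kron_mat A B $$ (i, j) = A $$ (i div c, j div d) * B $$ (i mod c, j mod d)"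
  by (auto simp: kron_mat_def)

lemma sum_div_mod:
  fixes f :: "nat \<Rightarrow> nat \<Rightarrow> complex"
  shows "(\<Sum>k = 0..<b * d. f (k div d) (k mod d)) = (\<Sum>i = 0..<b. \<Sum>j = 0..<d. f i j)"
proof -
  have "(\<Sum>k = 0..<b * d. f (k div d) (k mod d))
      = (\<Sum>i = 0..<b. \<Sum>k = i * d..<i * d + d. f (k div d) (k mod d))"
    by (simp only: atLeast0LessThan sum.nat_group)
  also have "\<dots> = (\<Sum>i = 0..<b. \<Sum>j = 0..<d. f i j)"
  proof (rule sum.cong[OF refl])
    fix i
    have "(\<Sum>k = i * d..<i * d + d. f (k div d) (k mod d))
        = (\<Sum>j = 0..<d. f ((j + i * d) div d) ((j + i * d) mod d))"
      using sum.shift_bounds_nat_ivl[of "\<lambda>k. f (k div d) (k mod d)" 0 "i * d" d]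
      by (simp add: add.commute)
    also have "\<dots> = (\<Sum>j = 0..<d. f i j)"
      by (rule sum.cong) auto
    finally show "(\<Sum>k = i * d..<i * d + d. f (k div d) (k mod d)) = (\<Sum>j = 0..<d. f i j)" .
  qed
  finally show ?thesis .
qed

lemma mat_mult_index:
  "A \<in> carrier_mat a b \<Longrightarrow> B \<in> carrier_mat b c \<Longrightarrow> i < a \<Longrightarrow> j < c \<Longrightarrow>
   (A * B) $$ (i, j) = (\<Sum>k = 0..<b. A $$ (i, k) * B $$ (k, j))"
  by (auto simp: scalar_prod_def intro!: sum.cong)

lemma kron_mat_mult:
  assumes A: "A \<in> carrier_mat a b" and B: "B \<in> carrier_mat c d"
    and C: "C \<in> carrier_mat b e" and D: "D \<in> carrier_mat d f"
  shows "kron_mat A B * kron_mat C D = kron_mat (A * C) (B * D)"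
proof (rule eq_matI)
  fix i j
  assume "i < dim_row (kron_mat (A * C) (B * D))" "j < dim_col (kron_mat (A * C) (B * D))"
  then have i: "i < a * c" and j: "j < e * f"
    using assms by auto
  note i' = div_less_mult[OF i] mod_less_mult[OF i] and j' = div_less_mult[OF j] mod_less_mult[OF j]
  have "(kron_mat A B * kron_mat C D) $$ (i, j)
      = (\<Sum>k = 0..<b * d. (A $$ (i div c, k div d) * B $$ (i mod c, k mod d)) *
           (C $$ (k div d, j div f) * D $$ (k mod d, j mod f)))"
    by (simp add: mat_mult_index[OF kron_mat_carrier[OF A B] kron_mat_carrier[OF C D] i j]
        kron_mat_index[OF A B i] kron_mat_index[OF C D _ j])
  also have "\<dots> = (\<Sum>k = 0..<b. \<Sum>l = 0..<d. (A $$ (i div c, k) * B $$ (i mod c, l)) *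
           (C $$ (k, j div f) * D $$ (l, j mod f)))"
    by (rule sum_div_mod)
  also have "\<dots> = (\<Sum>k = 0..<b. A $$ (i div c, k) * C $$ (k, j div f)) *
       (\<Sum>l = 0..<d. B $$ (i mod c, l) * D $$ (l, j mod f))"
    by (simp add: sum_product mult_ac)
  also have "\<dots> = kron_mat (A * C) (B * D) $$ (i, j)"
    by (simp add: kron_mat_index[OF mult_carrier_mat[OF A C] mult_carrier_mat[OF B D] i j]
        mat_mult_index[OF A C i'(1) j'(1)] mat_mult_index[OF B D i'(2) j'(2)])
  finally show "(kron_mat A B * kron_mat C D) $$ (i, j) = kron_mat (A * C) (B * D) $$ (i, j)" .
qed (use assms in auto)

lemma kron_mat_one: "kron_mat (1\<^sub>m a) (1\<^sub>m b) = 1\<^sub>m (a * b)"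
proof (rule eq_matI)
  fix i j assume "i < dim_row (1\<^sub>m (a * b))" "j < dim_col (1\<^sub>m (a * b))"
  then have i: "i < a * b" and j: "j < a * b" by auto
  have "i = j \<longleftrightarrow> i div b = j div b \<and> i mod b = j mod b"
    by (metis div_mult_mod_eq)
  then show "kron_mat (1\<^sub>m a) (1\<^sub>m b) $$ (i, j) = 1\<^sub>m (a * b) $$ (i, j)"
    using i j div_less_mult[OF i] mod_less_mult[OF i] div_less_mult[OF j] mod_less_mult[OF j]
    by (subst kron_mat_index[of _ a a _ b b]) auto
qed auto

definition rep_sum :: "rep \<Rightarrow> rep \<Rightarrow> rep" where
  "rep_sum U W = Abs_rep (rdim U + rdim W, \<lambda>g. dsum_mat (act U g) (act W g))"

definition rep_tensor :: "rep \<Rightarrow> rep \<Rightarrow> rep" where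
  "rep_tensor U W = Abs_rep (rdim U * rdim W, \<lambda>g. kron_mat (act U g) (act W g))"

lemma is_rep_dsum:
  assumes r: "is_rep n \<rho>" and s: "is_rep m \<sigma>"
  shows "is_rep (n + m) (\<lambda>g. dsum_mat (\<rho> g) (\<sigma> g))"
proof -
  have "regular (\<lambda>g. dsum_mat (\<rho> g) (\<sigma> g) $$ (i, j))" if "i < n + m" "j < n + m" for i j
  proof -
    have "regular (\<lambda>g. if i < n then if j < n then \<rho> g $$ (i, j) else 0
      else if j < n then 0 else \<sigma> g $$ (i - n, j - n))"
      using r s that by (cases "i < n"; cases "j < n") (auto simp: is_rep_def regular_const)
    then show ?thesis
      by (subst regular_cong[OF dsum_mat_index[of _ n _ m]]) (use r s that in \<open>auto simp: is_rep_def\<close>)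
  qed
  moreover have "dsum_mat (\<rho> (g * h)) (\<sigma> (g * h)) = dsum_mat (\<rho> g) (\<sigma> g) * dsum_mat (\<rho> h) (\<sigma> h)"
    if "g \<in> SL4" "h \<in> SL4" for g h
    using r s that by (subst dsum_mat_mult[of _ n n _ m m _ n _ m]) (auto simp: is_rep_def)
  ultimately show ?thesis
    using r s by (auto simp: is_rep_def dsum_mat_one intro!: dsum_mat_carrier)
qed

lemma is_rep_kron:
  assumes r: "is_rep n \<rho>" and s: "is_rep m \<sigma>"
  shows "is_rep (n * m) (\<lambda>g. kron_mat (\<rho> g) (\<sigma> g))"
proof -
  have "regular (\<lambda>g. kron_mat (\<rho> g) (\<sigma> g) $$ (i, j))" if i: "i < n * m" and j: "j < n * m" for i j
  proof -
    have "regular (\<lambda>g. \<rho> g $$ (i div m, j div m) * \<sigma> g $$ (i mod m, j mod m))"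
      using r s div_less_mult[OF i] mod_less_mult[OF i] div_less_mult[OF j] mod_less_mult[OF j]
      by (auto simp: is_rep_def intro!: regular_mult)
    then show ?thesis
      by (subst regular_cong[OF kron_mat_index[of _ n n _ m m]])
        (use r s that in \<open>auto simp: is_rep_def\<close>)
  qed
  moreover have "kron_mat (\<rho> (g * h)) (\<sigma> (g * h)) = kron_mat (\<rho> g) (\<sigma> g) * kron_mat (\<rho> h) (\<sigma> h)"
    if "g \<in> SL4" "h \<in> SL4" for g h
    using r s that by (subst kron_mat_mult[of _ n n _ m m _ n _ m]) (auto simp: is_rep_def)
  ultimately show ?thesis
    using r s by (auto simp: is_rep_def kron_mat_one intro!: kron_mat_carrier)
qed

lemma rdim_simps [simp]:
  "rdim trivial_rep = 1" "rdim zero_rep = 0" "rdim std_rep = 4"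
  "rdim (rep_sum U W) = rdim U + rdim W" "rdim (rep_tensor U W) = rdim U * rdim W"
  unfolding trivial_rep_def zero_rep_def std_rep_def rep_sum_def rep_tensor_def
  by (intro Abs_rep_simps(1) is_rep_basic is_rep_dsum is_rep_kron act_is_rep)+

lemma act_simps [simp]:
  "act trivial_rep = (\<lambda>g. 1\<^sub>m 1)" "act zero_rep = (\<lambda>g. 1\<^sub>m 0)" "act std_rep = (\<lambda>g. g)"
  "act (rep_sum U W) = (\<lambda>g. dsum_mat (act U g) (act W g))"
  "act (rep_tensor U W) = (\<lambda>g. kron_mat (act U g) (act W g))"
  unfolding trivial_rep_def zero_rep_def std_rep_def rep_sum_def rep_tensor_def
  by (intro Abs_rep_simps(2) is_rep_basic is_rep_dsum is_rep_kron act_is_rep)+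


section \<open>The representation ring\<close>

subsection \<open>The semiring of isomorphism classes\<close>

lemma invertible_matI:
  assumes "P \<in> carrier_mat n n" "Q \<in> carrier_mat n n" "P * Q = 1\<^sub>m n" "Q * P = 1\<^sub>m n"
  shows "invertible_mat P"
  using assms unfolding invertible_mat_def inverts_mat_def by auto

lemma invertible_matE:
  assumes "invertible_mat P" "P \<in> carrier_mat n n"
  obtains Q where "Q \<in> carrier_mat n n" "P * Q = 1\<^sub>m n" "Q * P = 1\<^sub>m n"
proof -
  from assms obtain Q where Q: "P * Q = 1\<^sub>m n" "Q * P = 1\<^sub>m (dim_row Q)"
    unfolding invertible_mat_def inverts_mat_def by auto
  from arg_cong[OF Q(1), of dim_col] arg_cong[OF Q(2), of dim_col] assms(2)
  have "Q \<in> carrier_mat n n" by auto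
  with Q that show ?thesis by auto
qed

lemma rep_isoI:
  assumes "rdim U = n" "rdim W = n" "P \<in> carrier_mat n n" "Q \<in> carrier_mat n n"
    "P * Q = 1\<^sub>m n" "Q * P = 1\<^sub>m n" "\<And>g. g \<in> SL4 \<Longrightarrow> P * act U g = act W g * P"
  shows "rep_iso U W"
  unfolding rep_iso_def using assms invertible_matI[OF assms(3-6)] by auto

lemma rep_isoE:
  assumes "rep_iso U W"
  obtains n P Q where "rdim U = n" "rdim W = n" "P \<in> carrier_mat n n" "Q \<in> carrier_mat n n"
    "P * Q = 1\<^sub>m n" "Q * P = 1\<^sub>m n" "\<And>g. g \<in> SL4 \<Longrightarrow> P * act U g = act W g * P"
  using assms unfolding rep_iso_def by (metis invertible_matE)

lemma rep_iso_reindex: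
  assumes n: "rdim U = n" "rdim W = n" and f: "bij_betw f {0..<n} {0..<n}"
    and eq: "\<And>g i j. g \<in> SL4 \<Longrightarrow> i < n \<Longrightarrow> j < n \<Longrightarrow> act W g $$ (f i, f j) = act U g $$ (i, j)"
  shows "rep_iso U W"
proof -
  define P :: "complex mat" where "P = mat n n (\<lambda>(a, i). if a = f i then 1 else 0)"
  define Q :: "complex mat" where "Q = mat n n (\<lambda>(i, a). if a = f i then 1 else 0)"
  have P: "P \<in> carrier_mat n n" and Q: "Q \<in> carrier_mat n n"
    by (auto simp: P_def Q_def)
  have inj: "f i = f j \<longleftrightarrow> i = j" if "i < n" "j < n" for i j
    using f that by (auto simp: bij_betw_def inj_on_def)
  have lt: "f i < n" if "i < n" for i
    using f that by (auto simp: bij_betw_def)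
  have surj: "\<exists>i<n. a = f i" if "a < n" for a
  proof -
    have "a \<in> f ` {0..<n}" using f that by (simp add: bij_betw_def)
    then show ?thesis by auto
  qed
  have QP: "Q * P = 1\<^sub>m n"
  proof (rule eq_matI)
    fix i j assume "i < dim_row (1\<^sub>m n)" "j < dim_col (1\<^sub>m n)"
    then show "(Q * P) $$ (i, j) = 1\<^sub>m n $$ (i, j)"
      by (simp add: mat_mult_index[OF Q P]) (simp add: P_def Q_def if_distrib if_distribR inj lt cong: if_cong)
  qed (use P Q in auto)
  have PQ: "P * Q = 1\<^sub>m n"
    by (rule mat_mult_left_right_inverse[OF Q P QP])
  have "P * act U g = act W g * P" if g: "g \<in> SL4" for g
  proof (rule eq_matI)
    have U: "act U g \<in> carrier_mat n n" and W: "act W g \<in> carrier_mat n n"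
      using act_carrier[OF g] n by metis+
    fix a j assume "a < dim_row (act W g * P)" "j < dim_col (act W g * P)"
    then have a: "a < n" and j: "j < n" using P W by auto
    from surj[OF a] obtain i where i: "i < n" "a = f i" by auto
    have "(P * act U g) $$ (a, j) = (\<Sum>k = 0..<n. P $$ (a, k) * act U g $$ (k, j))"
      by (rule mat_mult_index[OF P U a j])
    also have "\<dots> = (\<Sum>k = 0..<n. (if i = k then act U g $$ (k, j) else 0))"
      using i by (intro sum.cong) (auto simp: P_def inj lt)
    also have "\<dots> = act U g $$ (i, j)" using i by simp
    also have "\<dots> = act W g $$ (a, f j)" using eq[OF g i(1) j] i by simp
    also have "\<dots> = (\<Sum>k = 0..<n. (if k = f j then act W g $$ (a, k) else 0))"
      using lt[OF j] by simp
    also have "\<dots> = (\<Sum>k = 0..<n. act W g $$ (a, k) * P $$ (k, j))"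
      using j by (intro sum.cong) (auto simp: P_def)
    also have "\<dots> = (act W g * P) $$ (a, j)"
      by (rule mat_mult_index[OF W P a j, symmetric])
    finally show "(P * act U g) $$ (a, j) = (act W g * P) $$ (a, j)" .
  qed (use P n g in auto)
  then show ?thesis
    by (intro rep_isoI[OF n P Q PQ QP])
qed

lemma rep_iso_refl: "rep_iso U U"
  by (rule rep_iso_reindex[where f = "\<lambda>i. i"]) (auto simp: bij_betw_def)

lemma rep_iso_eq:
  assumes "rdim U = rdim W"
    and "\<And>g i j. g \<in> SL4 \<Longrightarrow> i < rdim U \<Longrightarrow> j < rdim U \<Longrightarrow> act W g $$ (i, j) = act U g $$ (i, j)"
  shows "rep_iso U W"
  by (rule rep_iso_reindex[where f = "\<lambda>i. i" and n = "rdim U"]) (use assms in \<open>auto simp: bij_betw_def\<close>)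

lemma rep_iso_sym: assumes "rep_iso U W" shows "rep_iso W U"
proof -
  from assms obtain n P Q where n: "rdim U = n" "rdim W = n" and P: "P \<in> carrier_mat n n"
    and Q: "Q \<in> carrier_mat n n" and PQ: "P * Q = 1\<^sub>m n" and QP: "Q * P = 1\<^sub>m n"
    and eq: "\<And>g. g \<in> SL4 \<Longrightarrow> P * act U g = act W g * P"
    by (rule rep_isoE) blast
  have "Q * act W g = act U g * Q" if g: "g \<in> SL4" for g
  proof -
    have U: "act U g \<in> carrier_mat n n" and W: "act W g \<in> carrier_mat n n"
      using act_carrier[OF g] n by metis+
    have "Q * act W g = Q * act W g * (P * Q)"
      unfolding PQ using Q W by simp
    also have "\<dots> = Q * (act W g * P) * Q"
      using P Q W by (simp add: assoc_mult_mat[of _ n n _ n _ n])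
    also have "\<dots> = Q * (P * act U g) * Q" using eq[OF g] by simp
    also have "\<dots> = (Q * P) * act U g * Q"
      using P Q U by (simp add: assoc_mult_mat[of _ n n _ n _ n])
    also have "\<dots> = act U g * Q" using QP U by simp
    finally show ?thesis .
  qed
  then show ?thesis by (intro rep_isoI[OF n(2,1) Q P QP PQ])
qed

lemma rep_iso_trans: assumes "rep_iso U V" "rep_iso V W" shows "rep_iso U W"
proof -
  from assms(1) obtain n P Q where n: "rdim U = n" "rdim V = n" and P: "P \<in> carrier_mat n n"
    and Q: "Q \<in> carrier_mat n n" and PQ: "P * Q = 1\<^sub>m n" and QP: "Q * P = 1\<^sub>m n"
    and eq: "\<And>g. g \<in> SL4 \<Longrightarrow> P * act U g = act V g * P"
    by (rule rep_isoE) blast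
  from assms(2) obtain R S where W: "rdim W = n" and R: "R \<in> carrier_mat n n"
    and S: "S \<in> carrier_mat n n" and RS: "R * S = 1\<^sub>m n" and SR: "S * R = 1\<^sub>m n"
    and eq': "\<And>g. g \<in> SL4 \<Longrightarrow> R * act V g = act W g * R"
    by (rule rep_isoE) (use n in auto)
  note a = assoc_mult_mat[of _ n n _ n _ n]
  have "(R * P) * (Q * S) = R * (P * Q) * S" using P Q R S by (simp add: a)
  then have 1: "(R * P) * (Q * S) = 1\<^sub>m n" using PQ RS R by simp
  have "(Q * S) * (R * P) = Q * (S * R) * P" using P Q R S by (simp add: a)
  then have 2: "(Q * S) * (R * P) = 1\<^sub>m n" using SR QP Q by simp
  have "R * P * act U g = act W g * (R * P)" if g: "g \<in> SL4" for g
  proof -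
    have c: "act U g \<in> carrier_mat n n" "act V g \<in> carrier_mat n n" "act W g \<in> carrier_mat n n"
      using act_carrier[OF g] n W by metis+
    have "R * P * act U g = R * (P * act U g)" using c P R by (simp add: a)
    also have "\<dots> = R * act V g * P" unfolding eq[OF g] using c P R by (simp add: a)
    also have "\<dots> = act W g * (R * P)" unfolding eq'[OF g] using c P R by (simp add: a)
    finally show ?thesis .
  qed
  then show ?thesis
    using rep_isoI[OF n(1) W _ _ 1 2] P Q R S by auto
qed

lemma rep_iso_sum: assumes "rep_iso U U'" "rep_iso W W'"
  shows "rep_iso (rep_sum U W) (rep_sum U' W')"
proof -
  from assms(1) obtain n P Q where n: "rdim U = n" "rdim U' = n" and P: "P \<in> carrier_mat n n"
    and Q: "Q \<in> carrier_mat n n" and PQ: "P * Q = 1\<^sub>m n" and QP: "Q * P = 1\<^sub>m n"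
    and eq: "\<And>g. g \<in> SL4 \<Longrightarrow> P * act U g = act U' g * P"
    by (rule rep_isoE) blast
  from assms(2) obtain m R S where m: "rdim W = m" "rdim W' = m" and R: "R \<in> carrier_mat m m"
    and S: "S \<in> carrier_mat m m" and RS: "R * S = 1\<^sub>m m" and SR: "S * R = 1\<^sub>m m"
    and eq': "\<And>g. g \<in> SL4 \<Longrightarrow> R * act W g = act W' g * R"
    by (rule rep_isoE) blast
  have c: "act U g \<in> carrier_mat n n" "act U' g \<in> carrier_mat n n"
    "act W g \<in> carrier_mat m m" "act W' g \<in> carrier_mat m m" if "g \<in> SL4" for g
    using act_carrier[OF that] n m by metis+
  show ?thesis
    by (rule rep_isoI[where n = "n + m" and P = "dsum_mat P R" and Q = "dsum_mat Q S"])
      (use n m P Q R S c PQ QP RS SR eq eq' in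
        \<open>auto simp: dsum_mat_mult[of _ n n _ m m _ n _ m] dsum_mat_one intro: dsum_mat_carrier\<close>)
qed

lemma rep_iso_tensor: assumes "rep_iso U U'" "rep_iso W W'"
  shows "rep_iso (rep_tensor U W) (rep_tensor U' W')"
proof -
  from assms(1) obtain n P Q where n: "rdim U = n" "rdim U' = n" and P: "P \<in> carrier_mat n n"
    and Q: "Q \<in> carrier_mat n n" and PQ: "P * Q = 1\<^sub>m n" and QP: "Q * P = 1\<^sub>m n"
    and eq: "\<And>g. g \<in> SL4 \<Longrightarrow> P * act U g = act U' g * P"
    by (rule rep_isoE) blast
  from assms(2) obtain m R S where m: "rdim W = m" "rdim W' = m" and R: "R \<in> carrier_mat m m"
    and S: "S \<in> carrier_mat m m" and RS: "R * S = 1\<^sub>m m" and SR: "S * R = 1\<^sub>m m"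
    and eq': "\<And>g. g \<in> SL4 \<Longrightarrow> R * act W g = act W' g * R"
    by (rule rep_isoE) blast
  have c: "act U g \<in> carrier_mat n n" "act U' g \<in> carrier_mat n n"
    "act W g \<in> carrier_mat m m" "act W' g \<in> carrier_mat m m" if "g \<in> SL4" for g
    using act_carrier[OF that] n m by metis+
  show ?thesis
    by (rule rep_isoI[where n = "n * m" and P = "kron_mat P R" and Q = "kron_mat Q S"])
      (use n m P Q R S c PQ QP RS SR eq eq' in
        \<open>auto simp: kron_mat_mult[of _ n n _ m m _ n _ m] kron_mat_one intro: kron_mat_carrier\<close>)
qed

lemma rep_sum_index:
  assumes "g \<in> SL4" "i < rdim U + rdim W" "j < rdim U + rdim W"
  shows "act (rep_sum U W) g $$ (i, j) =
     (if i < rdim U then if j < rdim U then act U g $$ (i, j) else 0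
      else if j < rdim U then 0 else act W g $$ (i - rdim U, j - rdim U))"
  using dsum_mat_index[OF act_carrier act_carrier] assms by simp

lemma rep_tensor_index:
  assumes "g \<in> SL4" "i < rdim U * rdim W" "j < rdim U * rdim W"
  shows "act (rep_tensor U W) g $$ (i, j) =
     act U g $$ (i div rdim W, j div rdim W) * act W g $$ (i mod rdim W, j mod rdim W)"
  using kron_mat_index[OF act_carrier act_carrier] assms by simp

lemma rep_sum_assoc: "rep_iso (rep_sum (rep_sum U V) W) (rep_sum U (rep_sum V W))"
  by (rule rep_iso_eq) (auto simp del: act_simps simp: rep_sum_index)

lemma rep_sum_zero: "rep_iso (rep_sum zero_rep U) U"
  by (rule rep_iso_eq) (auto simp del: act_simps simp: rep_sum_index)

lemma rep_sum_comm: "rep_iso (rep_sum U W) (rep_sum W U)"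
proof (rule rep_iso_reindex)
  let ?n = "rdim U" and ?m = "rdim W"
  let ?f = "\<lambda>i. if i < ?n then i + ?m else i - ?n"
  show "bij_betw ?f {0..<?n + ?m} {0..<?n + ?m}"
    by (rule bij_betwI[where g = "\<lambda>i. if i < ?m then i + ?n else i - ?m"]) auto
qed (auto simp del: act_simps simp: rep_sum_index)

lemma div_mult_mod_less:
  assumes "b < n" "a < m" shows "b * m + a < n * (m::nat)"
proof -
  have "b * m + a < Suc b * m" using assms(2) by simp
  also have "\<dots> \<le> n * m" using assms(1) by (intro mult_le_mono1) simp
  finally show ?thesis .
qed

lemma rep_tensor_comm: "rep_iso (rep_tensor U W) (rep_tensor W U)"
proof (rule rep_iso_reindex)
  let ?n = "rdim U" and ?m = "rdim W"
  let ?f = "\<lambda>i. i mod ?m * ?n + i div ?m"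
  have lt: "i mod b * a + i div b < a * b" if "i < a * b" for i a b :: nat
    using div_mult_mod_less[of "i mod b" b "i div b" a] mod_less_mult[OF that] div_less_mult[OF that]
    by (simp add: mult.commute)
  show "bij_betw ?f {0..<?n * ?m} {0..<?n * ?m}"
  proof (rule bij_betwI[where g = "\<lambda>i. i mod ?n * ?m + i div ?n"])
    show "?f \<in> {0..<?n * ?m} \<rightarrow> {0..<?n * ?m}"
      using lt by auto
    show "(\<lambda>i. i mod ?n * ?m + i div ?n) \<in> {0..<?n * ?m} \<rightarrow> {0..<?n * ?m}"
      using lt[of _ ?m ?n] by (auto simp: mult.commute)
  next
    fix i assume "i \<in> {0..<?n * ?m}"
    then show "?f i mod ?n * ?m + ?f i div ?n = i"
      using div_less_mult[of i ?n ?m] by (auto simp: )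
  next
    fix i assume "i \<in> {0..<?n * ?m}"
    then show "(i mod ?n * ?m + i div ?n) mod ?m * ?n + (i mod ?n * ?m + i div ?n) div ?m = i"
      using div_less_mult[of i ?m ?n] by (auto simp: mult.commute)
  qed
  fix g i j assume g: "g \<in> SL4" and i: "i < ?n * ?m" and j: "j < ?n * ?m"
  show "act (rep_tensor W U) g $$ (?f i, ?f j) = act (rep_tensor U W) g $$ (i, j)"
    using lt[OF i] lt[OF j] i j div_less_mult[OF i] div_less_mult[OF j]
    by (simp add: rep_tensor_index[OF g] mult.commute del: act_simps)
qed auto

lemma rep_tensor_assoc: "rep_iso (rep_tensor (rep_tensor U V) W) (rep_tensor U (rep_tensor V W))"
proof (rule rep_iso_eq)
  let ?n = "rdim U" and ?m = "rdim V" and ?k = "rdim W"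
  fix g i j assume g: "g \<in> SL4"
    and i: "i < rdim (rep_tensor (rep_tensor U V) W)" and j: "j < rdim (rep_tensor (rep_tensor U V) W)"
  have 1: "i div ?k < ?n * ?m" "j div ?k < ?n * ?m" "i mod (?m * ?k) < ?m * ?k" "j mod (?m * ?k) < ?m * ?k"
    using i j div_less_mult[of i "?n * ?m" ?k] div_less_mult[of j "?n * ?m" ?k]
      mod_less_mult[of i ?n "?m * ?k"] mod_less_mult[of j ?n "?m * ?k"] by (auto simp: mult.assoc)
  have 2: "l div k div m = l div (m * k)" "l div k mod m = l mod (m * k) div k"
    "l mod (m * k) mod k = l mod k" for l k m :: nat
    by (simp_all add: div_mult2_eq mod_mult2_eq mult.commute[of m k])
       (cases "k = 0"; simp)
  show "act (rep_tensor U (rep_tensor V W)) g $$ (i, j) = act (rep_tensor (rep_tensor U V) W) g $$ (i, j)"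
    using i j 1 by (simp add: rep_tensor_index[OF g] 2 mult.assoc del: act_simps)
qed (auto simp: mult.assoc)

lemma rep_tensor_one: "rep_iso (rep_tensor trivial_rep U) U"
  by (rule rep_iso_eq) (auto simp: kron_mat_index[OF one_carrier_mat act_carrier])

lemma rep_tensor_sum:
  "rep_iso (rep_tensor (rep_sum U V) W) (rep_sum (rep_tensor U W) (rep_tensor V W))"
proof (rule rep_iso_eq)
  let ?n = "rdim U" and ?m = "rdim V" and ?k = "rdim W"
  fix g i j assume g: "g \<in> SL4"
    and i: "i < rdim (rep_tensor (rep_sum U V) W)" and j: "j < rdim (rep_tensor (rep_sum U V) W)"
  have 1: "l div ?k < ?n \<longleftrightarrow> l < ?n * ?k" if "l < (?n + ?m) * ?k" for l
    using that by (cases "?k = 0") (simp_all add: div_less_iff_less_mult)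
  have 2: "(l - ?n * ?k) div ?k = l div ?k - ?n" "(l - ?n * ?k) mod ?k = l mod ?k"
    if "\<not> l < ?n * ?k" for l
  proof -
    from that obtain r where l: "l = ?n * ?k + r" using le_Suc_ex[of "?n * ?k" l] by auto
    show "(l - ?n * ?k) div ?k = l div ?k - ?n" "(l - ?n * ?k) mod ?k = l mod ?k"
      unfolding l by (cases "?k = 0"; simp)+
  qed
  have 3: "l div ?k < ?n + ?m" if "l < (?n + ?m) * ?k" for l using div_less_mult[OF that] .
  show "act (rep_sum (rep_tensor U W) (rep_tensor V W)) g $$ (i, j) =
        act (rep_tensor (rep_sum U V) W) g $$ (i, j)"
    using i j 1[of i] 1[of j] 2[of i] 2[of j] 3[of i] 3[of j]
    by (auto simp: rep_tensor_index[OF g] rep_sum_index[OF g] distrib_right simp del: act_simps)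
qed (simp add: distrib_right)

lemma rep_tensor_zero: "rep_iso (rep_tensor zero_rep U) zero_rep"
  by (rule rep_iso_eq) auto

quotient_type rep_class = rep / rep_iso
  by (rule equivpI) (auto intro: reflpI sympI transpI rep_iso_refl rep_iso_sym rep_iso_trans)

lift_definition class_dim :: "rep_class \<Rightarrow> nat" is rdim
  by (simp add: rep_iso_def)

instantiation rep_class :: comm_semiring_1
begin

lift_definition zero_rep_class :: rep_class is zero_rep .
lift_definition one_rep_class :: rep_class is trivial_rep .
lift_definition plus_rep_class :: "rep_class \<Rightarrow> rep_class \<Rightarrow> rep_class" is rep_sum
  by (rule rep_iso_sum)
lift_definition times_rep_class :: "rep_class \<Rightarrow> rep_class \<Rightarrow> rep_class" is rep_tensor
  by (rule rep_iso_tensor)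

instance
proof
  fix a b c :: rep_class
  show "a + b + c = a + (b + c)" by transfer (rule rep_sum_assoc)
  show "a + b = b + a" by transfer (rule rep_sum_comm)
  show "0 + a = a" by transfer (rule rep_sum_zero)
  show "a * b * c = a * (b * c)" by transfer (rule rep_tensor_assoc)
  show ab: "a * b = b * a" for a b :: rep_class by transfer (rule rep_tensor_comm)
  show "1 * a = a" by transfer (rule rep_tensor_one)
  show "(a + b) * c = a * c + b * c" by transfer (rule rep_tensor_sum)
  show z: "0 * a = 0" by transfer (rule rep_tensor_zero)
  show "a * 0 = 0" using ab z by metis
  show "(0::rep_class) \<noteq> 1" by transfer (simp add: rep_iso_def)
qed

end

lemma class_dim_simps [simp]:
  "class_dim (a + b) = class_dim a + class_dim b" "class_dim 0 = 0" "class_dim 1 = 1"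
  by (transfer; simp)+


subsection \<open>Its Grothendieck ring\<close>

text \<open>The pair \<open>(a, b)\<close> stands for the formal difference \<open>a - b\<close>.\<close>

definition groth_eq :: "rep_class \<times> rep_class \<Rightarrow> rep_class \<times> rep_class \<Rightarrow> bool" where
  "groth_eq = (\<lambda>(a, b) (c, d). \<exists>k. a + d + k = c + b + k)"

lemma groth_eq_iff [simp]: "groth_eq (a, b) (c, d) \<longleftrightarrow> (\<exists>k. a + d + k = c + b + k)"
  by (simp add: groth_eq_def)

lemma equivp_groth_eq: "equivp groth_eq"
proof (rule equivpI)
  show "reflp groth_eq" by (rule reflpI) auto
  show "symp groth_eq" by (rule sympI) (auto simp: groth_eq_def dest: sym)
  show "transp groth_eq"
  proof (rule transpI; clarsimp)
    fix a b c d e f k l :: rep_class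
    assume 1: "a + d + k = c + b + k" and 2: "c + f + l = e + d + l"
    have "a + f + (d + k + l) = (a + d + k) + (f + l)" by (simp add: ac_simps)
    also have "\<dots> = (c + f + l) + (b + k)" unfolding 1 by (simp add: ac_simps)
    also have "\<dots> = e + b + (d + k + l)" unfolding 2 by (simp add: ac_simps)
    finally show "\<exists>k. a + f + k = e + b + k" by blast
  qed
qed

quotient_type rep_ring = "rep_class \<times> rep_class" / groth_eq
  by (rule equivp_groth_eq)

instantiation rep_ring :: comm_ring_1
begin

lift_definition zero_rep_ring :: rep_ring is "(0, 0)" .
lift_definition one_rep_ring :: rep_ring is "(1, 0)" .

lift_definition plus_rep_ring :: "rep_ring \<Rightarrow> rep_ring \<Rightarrow> rep_ring" is
  "\<lambda>(a, b) (c, d). (a + c, b + d)"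
proof clarsimp
  fix a b a' b' c d c' d' k l :: rep_class
  assume 1: "a + b' + k = a' + b + k" and 2: "c + d' + l = c' + d + l"
  have "a + c + (b' + d') + (k + l) = (a + b' + k) + (c + d' + l)" by (simp add: ac_simps)
  also have "\<dots> = a' + c' + (b + d) + (k + l)" unfolding 1 2 by (simp add: ac_simps)
  finally show "\<exists>k. a + c + (b' + d') + k = a' + c' + (b + d) + k" by blast
qed

lift_definition uminus_rep_ring :: "rep_ring \<Rightarrow> rep_ring" is "\<lambda>(a, b). (b, a)"
proof clarsimp
  fix a b c d k :: rep_class
  assume "a + d + k = c + b + k"
  then have "b + c + k = d + a + k" by (simp add: ac_simps)
  then show "\<exists>k. b + c + k = d + a + k" ..
qed

definition minus_rep_ring :: "rep_ring \<Rightarrow> rep_ring \<Rightarrow> rep_ring" where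
  "minus_rep_ring x y = x + - y"

lift_definition times_rep_ring :: "rep_ring \<Rightarrow> rep_ring \<Rightarrow> rep_ring" is
  "\<lambda>(a, b) (c, d). (a * c + b * d, a * d + b * c)"
proof clarsimp
  fix a b a' b' c d c' d' k l :: rep_class
  assume 1: "a + b' + k = a' + b + k" and 2: "c + d' + l = c' + d + l"
  let ?s = "a' * c + b' * d + a' * d + b' * c + k * c + k * d + a' * l + b' * l"
  have "a * c + b * d + (a' * d' + b' * c') + ?s
      = (a + b' + k) * c + (a' + b + k) * d + (a' * (c + d' + l) + b' * (c' + d + l))"
    by (simp add: algebra_simps)
  also have "\<dots> = (a' + b + k) * c + (a + b' + k) * d + (a' * (c' + d + l) + b' * (c + d' + l))"
    unfolding 1 2 ..
  also have "\<dots> = a' * c' + b' * d' + (a * d + b * c) + ?s"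
    by (simp add: algebra_simps)
  finally show "\<exists>k. a * c + b * d + (a' * d' + b' * c') + k = a' * c' + b' * d' + (a * d + b * c) + k"
    by blast
qed

instance
proof
  fix x y z :: rep_ring
  show "x + y + z = x + (y + z)" by transfer (auto simp: ac_simps)
  show "x + y = y + x" by transfer (auto simp: ac_simps)
  show "0 + x = x" by transfer auto
  show "- x + x = 0" by transfer (auto simp: ac_simps)
  show "x - y = x + - y" by (rule minus_rep_ring_def)
  show "x * y * z = x * (y * z)" by transfer (auto simp: algebra_simps)
  show "x * y = y * x" by transfer (auto simp: algebra_simps)
  show "1 * x = x" by transfer auto
  show "(x + y) * z = x * z + y * z" by transfer (auto simp: algebra_simps)
  show "(0::rep_ring) \<noteq> 1"
  proof (transfer, clarsimp)
    fix k :: rep_class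
    assume "k = 1 + k"
    then have "class_dim k = class_dim (1 + k)" by simp
    then show False by simp
  qed
qed

end

definition rcls :: "rep \<Rightarrow> rep_ring" where
  "rcls U = abs_rep_ring (abs_rep_class U, 0)"


section \<open>Symmetric powers and Schur functors\<close>

text \<open>The subrepresentation of \<open>U\<close> on an invariant subspace \<open>W\<close>, and the quotient representation of
  \<open>U\<close> by \<open>W\<close>, in coordinates: the columns of \<open>B\<close> form a basis of \<open>W\<close>, and \<open>C\<close> is a surjection
  with kernel \<open>W\<close>. For invariant \<open>W\<close> both exist and are unique up to isomorphism, so that the
  choices made in \<open>sub_rep\<close> and \<open>quot_rep\<close> do not affect the class in the representation ring.\<close>

definition is_subrep :: "rep \<Rightarrow> complex vec set \<Rightarrow> rep \<Rightarrow> bool" where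
  "is_subrep U W R \<longleftrightarrow> (\<exists>B \<in> carrier_mat (rdim U) (rdim R).
     mat_kernel B = {0\<^sub>v (rdim R)} \<and>
     (\<lambda>x. B *\<^sub>v x) ` carrier_vec (rdim R) = W \<and>
     (\<forall>g\<in>SL4. act U g * B = B * act R g))"

definition is_quotrep :: "rep \<Rightarrow> complex vec set \<Rightarrow> rep \<Rightarrow> bool" where
  "is_quotrep U W R \<longleftrightarrow> (\<exists>C \<in> carrier_mat (rdim R) (rdim U).
     mat_kernel C = W \<and>
     (\<lambda>x. C *\<^sub>v x) ` carrier_vec (rdim U) = carrier_vec (rdim R) \<and>
     (\<forall>g\<in>SL4. C * act U g = act R g * C))"

definition sub_rep :: "rep \<Rightarrow> complex vec set \<Rightarrow> rep" where
  "sub_rep U W = (SOME R. is_subrep U W R)"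

definition quot_rep :: "rep \<Rightarrow> complex vec set \<Rightarrow> rep" where
  "quot_rep U W = (SOME R. is_quotrep U W R)"

primrec tensor_pow :: "nat \<Rightarrow> rep \<Rightarrow> rep" where
  "tensor_pow 0 U = trivial_rep"
| "tensor_pow (Suc d) U = rep_tensor U (tensor_pow d U)"

text \<open>For \<open>n = rdim U\<close>, the basis vector of \<open>tensor_pow d U\<close> with index \<open>i\<close> is
  \<open>e_(digit n i (d-1)) \<otimes> \<dots> \<otimes> e_(digit n i 0)\<close>; thus tensor factors are numbered from right to
  left, starting with \<open>0\<close>. The matrix \<open>place_perm n d \<sigma>\<close> moves the tensor factor number \<open>k\<close> to
  place \<open>\<sigma> k\<close>.\<close>

definition digit :: "nat \<Rightarrow> nat \<Rightarrow> nat \<Rightarrow> nat" where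
  "digit n i k = (i div n ^ k) mod n"

definition place_perm :: "nat \<Rightarrow> nat \<Rightarrow> (nat \<Rightarrow> nat) \<Rightarrow> complex mat" where
  "place_perm n d \<sigma> = mat (n ^ d) (n ^ d)
     (\<lambda>(i, j). if \<forall>k<d. digit n i (\<sigma> k) = digit n j k then 1 else 0)"

definition sym_relations :: "nat \<Rightarrow> nat \<Rightarrow> complex vec set" where
  "sym_relations n d =
     LinearCombinations.module.span class_ring (module_vec TYPE(complex) (n ^ d))
       {v - place_perm n d \<sigma> *\<^sub>v v | v \<sigma>. v \<in> carrier_vec (n ^ d) \<and> \<sigma> permutes {..<d}}"

definition sym_power :: "int \<Rightarrow> rep \<Rightarrow> rep" where
  "sym_power m U = (if m < 0 then zero_rep
     else quot_rep (tensor_pow (nat m) U) (sym_relations (rdim U) (nat m)))"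

text \<open>A partition is given by the list of its parts. Its canonical tableau has the entries
  \<open>0, 1, 2, \<dots>\<close>, filled in row by row; entry \<open>k\<close> is in the cell \<open>cells \<mu> ! k\<close>, given as a pair of
  row and column.\<close>

definition cells :: "nat list \<Rightarrow> (nat \<times> nat) list" where
  "cells \<mu> = concat (map (\<lambda>i. map (\<lambda>j. (i, j)) [0..<\<mu> ! i]) [0..<length \<mu>])"

definition row_group :: "nat list \<Rightarrow> (nat \<Rightarrow> nat) set" where
  "row_group \<mu> = {p. p permutes {..<sum_list \<mu>} \<and>
     (\<forall>k<sum_list \<mu>. fst (cells \<mu> ! p k) = fst (cells \<mu> ! k))}"

definition col_group :: "nat list \<Rightarrow> (nat \<Rightarrow> nat) set" where
  "col_group \<mu> = {q. q permutes {..<sum_list \<mu>} \<and>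
     (\<forall>k<sum_list \<mu>. snd (cells \<mu> ! q k) = snd (cells \<mu> ! k))}"

text \<open>The Young symmetrizer \<open>c_\<mu> = a_\<mu> b_\<mu>\<close> acting on the \<open>d\<close>-th tensor power of an
  \<open>n\<close>-dimensional space, \<open>d = |\<mu>|\<close>. Since the action of the group algebra of the symmetric group
  on tensors is from the right, the row symmetrizer \<open>a_\<mu>\<close> is applied first.\<close>

definition young_symmetrizer :: "nat \<Rightarrow> nat list \<Rightarrow> complex mat" where
  "young_symmetrizer n \<mu> = (let d = sum_list \<mu> in
     mat (n ^ d) (n ^ d) (\<lambda>ij. \<Sum>q\<in>col_group \<mu>. of_int (sign q) * place_perm n d q $$ ij) *
     mat (n ^ d) (n ^ d) (\<lambda>ij. \<Sum>p\<in>row_group \<mu>. place_perm n d p $$ ij))"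

definition schur_functor :: "nat list \<Rightarrow> rep \<Rightarrow> rep" where
  "schur_functor \<mu> U = sub_rep (tensor_pow (sum_list \<mu>) U)
     ((\<lambda>v. young_symmetrizer (rdim U) \<mu> *\<^sub>v v) ` carrier_vec (rdim U ^ sum_list \<mu>))"

abbreviation Sym :: "int \<Rightarrow> rep_ring" where
  "Sym m \<equiv> rcls (sym_power m std_rep)"

abbreviation Sym_Sym :: "int \<Rightarrow> int \<Rightarrow> rep_ring" where
  "Sym_Sym r s \<equiv> rcls (sym_power r (sym_power s std_rep))"

abbreviation Schur :: "nat list \<Rightarrow> rep_ring" where
  "Schur \<mu> \<equiv> rcls (schur_functor \<mu> std_rep)"

end

theory Submission
  imports Defs "HOL-Combinatorics.Permutations" "HOL-Library.Multiset"
    "HOL-Computational_Algebra.Formal_Power_Series" "Jordan_Normal_Form.Schur_Decomposition"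
begin

text \<open>Equality in the ring of isomorphism classes is reduced to equality of characters. The tensor
  powers of \<open>V\<close> satisfy \<open>\<rho>(g\<^sup>*) = \<rho>(g)\<^sup>*\<close>, so orthogonal projections onto invariant subspaces commute
  with the action; no integration over a compact group is needed. If two such projections \<open>P\<close> and \<open>Q\<close>
  have the same characters \<open>g \<mapsto> tr (P \<rho>(g))\<close> and \<open>g \<mapsto> tr (Q \<rho>(g))\<close>, a Casimir-type sum gives a nonzero
  intertwiner between them, and an intertwiner of maximal rank is an isomorphism. Every representation
  in the identity is cut out of such a tensor power by an idempotent.

  The characters are computed from the eigenvalues \<open>x\<^sub>1, \<dots>, x\<^sub>4\<close> of \<open>g\<close>: the trace of \<open>g\<close> composed with
  a permutation of the tensor factors is a product of power sums over the cycles of the permutation.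
  This yields Newton's recursion for symmetric powers, and a finite evaluation for each of the four
  Schur functors, whose Young symmetrizers are idempotent up to a nonzero scalar by von Neumann's
  lemma. The identity of characters then follows from
  \<open>\<Sum> h\<^sub>2\<^sub>t z\<^sup>t = (1 + e\<^sub>2 z + z\<^sup>2) / \<Prod> (1 - x\<^sub>i\<^sup>2 z)\<close>, with \<open>e\<^sub>2\<close> the second elementary symmetric function of the \<open>x\<^sub>i\<close>,
  and \<open>\<Sum> h\<^sub>t[S\<^sup>2] z\<^sup>t = 1 / \<Prod> (1 - x\<^sub>i x\<^sub>j z)\<close>, the last product over \<open>i \<le> j\<close>: the quotient is
  \<open>(1 + e\<^sub>2 z + z\<^sup>2) \<Prod> (1 - x\<^sub>i x\<^sub>j z)\<close> with product over \<open>i < j\<close>, whose coefficients are signed sums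
  of characters of the Schur functors in the statement.\<close>

subsection \<open>Sums over groups of permutations\<close>

text \<open>\<open>sub_rep\<close> and \<open>quot_rep\<close> pick some representation in arbitrary
  coordinates, so the adjoint relation, which holds in the standard basis of a tensor power, is lost
  for the symmetric powers and Schur functors themselves. Each is therefore kept as the target of a
  surjection from a representation that has the relation. This class is closed under sums, tensor
  products and further quotients, which the nested power S^t(S^2) requires. Traces are invariant
  under conjugation and every complex matrix has a triangular form, so eigenvalues are available for
  all of SL_4 without a density argument for diagonalizable elements. The determinant enters as e_4
  = 1. A Young symmetrizer of degree eight has 4^8 rows. It is never evaluated as a matrix: its
  square and its trace against the action become sums over pairs of permutations, which a verified
  list program evaluates from the row and column numbers of the cells. The scalars 12, 8, 45 and 960
  that come out are the products of hook lengths.\<close>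

definition colour_group :: "nat set \<Rightarrow> (nat \<Rightarrow> nat) \<Rightarrow> (nat \<Rightarrow> nat) set" where
  "colour_group S c = {p. p permutes S \<and> (\<forall>k\<in>S. c (p k) = c k)}"

lemma finite_colour_group: "finite S \<Longrightarrow> finite (colour_group S c)"
  by (rule finite_subset[OF _ finite_permutations[of S]]) (auto simp: colour_group_def)

lemma transpose_comp_permutes:
  assumes "q permutes S" "b \<in> insert a S"
  shows "transpose a b \<circ> q permutes insert a S"
  using assms by (intro permutes_compose permutes_swap_id permutes_subset[OF assms(1)]) auto

text \<open>Coset decomposition: \<open>p\<close> factors uniquely as
  \<open>transpose a (p a)\<close> after a permutation fixing \<open>a\<close>, and it preserves
  colours iff \<open>c (p a) = c a\<close> and the other factor preserves them on \<open>S\<close>.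
  \<open>colour_group\<close> is a Young subgroup: the colours are the rows or columns of a tableau,
  or one constant for the full symmetric group.\<close>

lemma colour_group_sum_insert:
  fixes F :: "(nat \<Rightarrow> nat) \<Rightarrow> 'b::comm_monoid_add"
  assumes "a \<notin> S"
  shows "(\<Sum>p\<in>colour_group (insert a S) c. F p) =
    (\<Sum>b\<in>{b\<in>insert a S. c b = c a}. \<Sum>q\<in>colour_group S c. F (transpose a b \<circ> q))"
proof -
  have 1: "transpose a b \<circ> q \<in> colour_group (insert a S) c"
    if "b \<in> insert a S" "c b = c a" "q \<in> colour_group S c" for b q
  proof -
    from that have q: "q permutes S" by (auto simp: colour_group_def)
    have "q a = a" using q assms by (rule permutes_not_in)
    then have "c ((transpose a b \<circ> q) k) = c k" if "k \<in> insert a S" for k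
      using \<open>c b = c a\<close> \<open>q \<in> colour_group S c\<close> that
      by (auto simp: colour_group_def transpose_def)
    then show ?thesis
      using transpose_comp_permutes[OF q that(1)] by (simp add: colour_group_def)
  qed
  have w: "transpose a (p a) \<circ> p \<in> colour_group S c"
    if "p \<in> colour_group (insert a S) c" for p
  proof -
    from that have p: "p permutes insert a S" and c: "\<And>k. k \<in> insert a S \<Longrightarrow> c (p k) = c k"
      by (auto simp: colour_group_def)
    have "c ((transpose a (p a) \<circ> p) k) = c k" if "k \<in> S" for k
      using that c[of k] c[of a] assms by (auto simp: transpose_def)
    then show ?thesis
      using permutes_insert_lemma[OF p] by (simp add: colour_group_def)
  qed
  have tt: "transpose a x \<circ> (transpose a x \<circ> p) = p" for x and p :: "nat \<Rightarrow> nat"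
    by (simp add: fun_eq_iff)
  have "(\<Sum>p\<in>colour_group (insert a S) c. F p) =
    (\<Sum>(b, q)\<in>{b\<in>insert a S. c b = c a} \<times> colour_group S c. F (transpose a b \<circ> q))"
  proof (rule sum.reindex_bij_witness[where j = "\<lambda>p. (p a, transpose a (p a) \<circ> p)"
        and i = "\<lambda>(b, q). transpose a b \<circ> q"], goal_cases)
    case (2 p)
    then have "p permutes insert a S" "c (p a) = c a" by (auto simp: colour_group_def)
    then show ?case
      using permutes_in_image[of p "insert a S" a] w[OF 2] by auto
  next
    case (3 bq)
    then have "(snd bq) a = a" using assms by (auto simp: colour_group_def permutes_not_in)
    then show ?case using tt by (simp add: case_prod_beta prod_eq_iff)
  next
    case (4 bq)
    then show ?case using 1[of "fst bq" "snd bq"] by (auto simp: case_prod_beta)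
  qed (simp_all add: tt)
  then show ?thesis by (simp add: sum.cartesian_product)
qed

text \<open>Each pair holds a sign and the list of values on \<open>0..<n\<close>. The recursion
  follows the coset decomposition: composing with the transposition of \<open>n\<close> and
  \<open>b\<close> sends \<open>n\<close> to \<open>b\<close> and replaces the old value
  \<open>b\<close> by \<open>n\<close>.\<close>

fun signed_perms :: "nat list \<Rightarrow> nat \<Rightarrow> (int \<times> nat list) list" where
  "signed_perms c 0 = [(1, [])]"
| "signed_perms c (Suc n) = concat (map (\<lambda>(s, L).
     map (\<lambda>b. if b = n then (s, L @ [n]) else (- s, map (\<lambda>z. if z = b then n else z) L @ [b]))
       (filter (\<lambda>b. c ! b = c ! n) [0..<Suc n])) (signed_perms c n))"

lemma sum_list_concat_map:
  "sum_list (map f (concat (map g xs))) = sum_list (map (\<lambda>x. sum_list (map f (g x))) xs)"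
  for f :: "'a \<Rightarrow> 'b::comm_monoid_add"
  by (induction xs) auto

text \<open>The summand is a function of the sign and the value list, so that the right side is a
  program that can be run on a concrete colouring.\<close>

lemma sum_colour_group_code:
  fixes F :: "int \<Rightarrow> nat list \<Rightarrow> 'b::comm_monoid_add"
  shows "(\<Sum>p\<in>colour_group {..<n} (\<lambda>k. c ! k). F (sign p) (map p [0..<n])) =
    sum_list (map (\<lambda>(s, L). F s L) (signed_perms c n))"
proof (induction n arbitrary: F)
  case 0
  have "colour_group {..<0} (\<lambda>k. c ! k) = {id}" by (auto simp: colour_group_def)
  then show ?case by simp
next
  case (Suc n)
  \<comment> \<open>\<open>G s L b\<close> is the summand after extending \<open>(s, L)\<close> by
    the image \<open>b\<close> of the new point.\<close>
  define G where "G s L = (\<lambda>b. case if b = n then (s, L @ [n])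
     else (- s, map (\<lambda>z. if z = b then n else z) L @ [b]) of (s, L) \<Rightarrow> F s L)" for s :: int and L
  have G: "F (sign (transpose n b \<circ> q)) (map (transpose n b \<circ> q) [0..<Suc n]) =
      G (sign q) (map q [0..<n]) b"
    if "b \<in> insert n {..<n}" "q \<in> colour_group {..<n} (\<lambda>k. c ! k)" for b q
  proof -
    from that have q: "q permutes {..<n}" by (auto simp: colour_group_def)
    then have [simp]: "q n = n" by (auto intro: permutes_not_in)
    have lt: "q k < n" if "k < n" for k using permutes_in_image[OF q] that by auto
    have s: "sign (transpose n b \<circ> q) = (if b = n then sign q else - sign q)"
      using permutes_imp_permutation[OF _ q] by (simp add: sign_compose sign_swap_id permutation_swap_id)
    have "map (transpose n b \<circ> q) [0..<n] = map (\<lambda>z. if z = b then n else z) (map q [0..<n])"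
      by (auto simp: transpose_def) (use lt in fastforce)
    moreover have "map (transpose n b \<circ> q) [0..<n] = map q [0..<n]" if "b = n"
      using that by simp
    ultimately show ?thesis using s by (simp add: G_def del: map_map)
  qed
  have "(\<Sum>p\<in>colour_group {..<Suc n} (\<lambda>k. c ! k). F (sign p) (map p [0..<Suc n])) =
    (\<Sum>b\<in>{b\<in>insert n {..<n}. c ! b = c ! n}. \<Sum>q\<in>colour_group {..<n} (\<lambda>k. c ! k).
       F (sign (transpose n b \<circ> q)) (map (transpose n b \<circ> q) [0..<Suc n]))"
    unfolding lessThan_Suc by (rule colour_group_sum_insert) simp
  also have "\<dots> = (\<Sum>b\<in>{b\<in>insert n {..<n}. c ! b = c ! n}. \<Sum>q\<in>colour_group {..<n} (\<lambda>k. c ! k).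
       G (sign q) (map q [0..<n]) b)"
    by (intro sum.cong refl G) auto
  also have "\<dots> = (\<Sum>q\<in>colour_group {..<n} (\<lambda>k. c ! k).
      \<Sum>b\<in>{b\<in>insert n {..<n}. c ! b = c ! n}. G (sign q) (map q [0..<n]) b)"
    by (rule sum.swap)
  also have "\<dots> = (\<Sum>q\<in>colour_group {..<n} (\<lambda>k. c ! k).
      sum_list (map (G (sign q) (map q [0..<n])) (filter (\<lambda>b. c ! b = c ! n) [0..<Suc n])))"
    by (subst sum_list_distinct_conv_sum_set)
      (auto intro!: sum.cong arg_cong2[where f = sum] simp del: upt_Suc simp: less_Suc_eq)
  also have "\<dots> = sum_list (map (\<lambda>(s, L). F s L) (signed_perms c (Suc n)))"
    unfolding Suc.IH[of "\<lambda>s L. sum_list (map (G s L) (filter (\<lambda>b. c ! b = c ! n) [0..<Suc n]))"]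
      signed_perms.simps sum_list_concat_map
    by (intro arg_cong[where f = sum_list] map_cong refl)
      (auto simp: G_def o_def case_prod_beta simp del: upt_Suc)
  finally show ?case .
qed

section \<open>Fixed functions, cycle types and power sums\<close>

definition fixsum :: "(nat \<Rightarrow> complex) \<Rightarrow> nat \<Rightarrow> nat set \<Rightarrow> (nat \<Rightarrow> nat) \<Rightarrow> (nat \<Rightarrow> nat) \<Rightarrow> complex" where
  "fixsum y n S q w = (\<Sum>f\<in>{f\<in>PiE S (\<lambda>_. {..<n}). \<forall>k\<in>S. f (q k) = f k}. \<Prod>k\<in>S. y (f k) ^ w k)"

definition psum :: "(nat \<Rightarrow> complex) \<Rightarrow> nat \<Rightarrow> nat \<Rightarrow> complex" where
  "psum y n k = (\<Sum>i<n. y i ^ k)"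

text \<open>\<open>fixsum\<close> runs over the functions that are constant on the cycles, so it is
  a product of power sums, one per cycle. Removing one point: a fixed point \<open>a\<close>
  contributes its own factor; otherwise \<open>f a = f b\<close> is forced and the weight of
  \<open>a\<close> passes to \<open>b\<close>. The weights \<open>w\<close> exist for this
  contraction; the traces start with all weights 1.\<close>

lemma fixsum_insert:
  assumes S: "finite S" "a \<notin> S" and q: "q permutes S" and b: "b \<in> insert a S"
  shows "fixsum y n (insert a S) (transpose a b \<circ> q) w =
    (if b = a then psum y n (w a) * fixsum y n S q w else fixsum y n S q (w(b := w b + w a)))"
proof -
  have qa [simp]: "q a = a" using q S by (auto intro: permutes_not_in)
  have qS: "q k \<in> S \<longleftrightarrow> k \<in> S" for k using permutes_in_image[OF q] .
  have qne: "q k \<noteq> a" if "k \<in> S" for k using qS[of k] that S by auto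
  show ?thesis
  proof (cases "b = a")
    case True
    have "fixsum y n (insert a S) (transpose a b \<circ> q) w =
      (\<Sum>(i, f)\<in>{..<n} \<times> {f\<in>PiE S (\<lambda>_. {..<n}). \<forall>k\<in>S. f (q k) = f k}.
        y i ^ w a * (\<Prod>k\<in>S. y (f k) ^ w k))"
      unfolding fixsum_def True
    proof (rule sum.reindex_bij_witness[where j = "\<lambda>f. (f a, restrict f S)" and i = "\<lambda>(i, f). f(a := i)"],
        goal_cases)
      case (1 f) then show ?case by (auto simp: fun_eq_iff PiE_def extensional_def)
    next
      case (2 f) then show ?case using qS by (auto simp: PiE_def)
    next
      case (3 x) then show ?case
        by (cases x) (auto simp: fun_eq_iff PiE_def extensional_def restrict_def \<open>a \<notin> S\<close>)
    next
      case (4 x) then show ?case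
        using qne by (cases x) (auto simp: PiE_def extensional_def \<open>a \<notin> S\<close>)
    next
      case (5 f) then show ?case using S by (auto intro!: prod.cong)
    qed
    then show ?thesis
      by (simp add: True fixsum_def psum_def sum.cartesian_product[symmetric] sum_product)
  next
    case False
    then have bS: "b \<in> S" using b by auto
    have t: "f (transpose a b x) = f x" if "f a = f b" for f :: "nat \<Rightarrow> nat" and x
      using that by (auto simp: transpose_def)
    have "fixsum y n (insert a S) (transpose a b \<circ> q) w = fixsum y n S q (w(b := w b + w a))"
      unfolding fixsum_def
    proof (rule sum.reindex_bij_witness[where j = "\<lambda>f. restrict f S" and i = "\<lambda>f. f(a := f b)"],
        goal_cases)
      case (1 f)
      then have "f a = f b" by (auto dest: bspec[of _ _ a])
      with 1 bS show ?case by (auto simp: fun_eq_iff PiE_def extensional_def)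
    next
      case (2 f)
      then have "f a = f b" by (auto dest: bspec[of _ _ a])
      with 2 show ?case using qS by (auto simp: PiE_def t)
    next
      case (3 f) then show ?case
        by (auto simp: fun_eq_iff PiE_def extensional_def restrict_def \<open>a \<notin> S\<close>)
    next
      case (4 f)
      then have "(f(a := f b)) (transpose a b (q k)) = (f(a := f b)) k" if "k \<in> insert a S" for k
        using that qne bS S False by (subst t) auto
      with 4 bS show ?case by (auto simp: PiE_def extensional_def)
    next
      case (5 f)
      then have "f a = f b" by (auto dest: bspec[of _ _ a])
      then show ?case using S bS
        by (simp add: prod.remove[of S b] power_add mult_ac)
    qed
    then show ?thesis using False by simp
  qed
qed

text \<open>Deleting the largest point of a permutation from its cycle, and adding its weight to the weight
  of its image, ends with the total weights of the cycles.\<close>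

fun cycle_weights :: "nat \<Rightarrow> nat list \<Rightarrow> nat list \<Rightarrow> nat list" where
  "cycle_weights 0 L W = []"
| "cycle_weights (Suc n) L W = (let b = L ! n; v = W ! n in
     if b = n then v # cycle_weights n L W
     else cycle_weights n (map (\<lambda>z. if z = n then b else z) L) (W[b := W ! b + v]))"

text \<open>The recursion never shortens \<open>L\<close> and \<open>W\<close>, hence only lower
  bounds on their lengths and conditions on the first \<open>n\<close> entries are imposed.\<close>

lemma fixsum_code:
  assumes "q permutes {..<n}" "n \<le> length L" "n \<le> length W"
    "\<And>k. k < n \<Longrightarrow> L ! k = q k" "\<And>k. k < n \<Longrightarrow> W ! k = w k"
  shows "fixsum y m {..<n} q w = prod_list (map (psum y m) (cycle_weights n L W))"
  using assms
proof (induction n arbitrary: q L W w)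
  case 0
  then show ?case by (simp add: fixsum_def)
next
  case (Suc n)
  define b where "b = q n"
  define q' where "q' = transpose n b \<circ> q"
  have p: "q permutes insert n {..<n}" using Suc.prems(1) by (simp add: lessThan_Suc)
  have q': "q' permutes {..<n}"
    using permutes_insert_lemma[OF p] by (simp add: q'_def b_def)
  have q: "q = transpose n b \<circ> q'" by (simp add: q'_def fun_eq_iff)
  have b: "b \<in> insert n {..<n}" using permutes_in_image[OF p] by (simp add: b_def)
  have q'n: "q' n = n" using q' by (auto intro: permutes_not_in)
  have ne: "q k \<noteq> b" if "k < n" for k
    using permutes_inj[OF p] that by (auto simp: b_def inj_def)
  have "fixsum y m {..<Suc n} q w = fixsum y m (insert n {..<n}) (transpose n b \<circ> q') w"
    unfolding lessThan_Suc q[symmetric] ..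
  also have "\<dots> = (if b = n then psum y m (w n) * fixsum y m {..<n} q' w
      else fixsum y m {..<n} q' (w(b := w b + w n)))"
    by (rule fixsum_insert) (use q' b in auto)
  also have "\<dots> = prod_list (map (psum y m) (cycle_weights (Suc n) L W))"
  proof (cases "b = n")
    case True
    then have "q = q'" by (simp add: q)
    have "fixsum y m {..<n} q' w = prod_list (map (psum y m) (cycle_weights n L W))"
      by (rule Suc.IH[OF q']) (use Suc.prems \<open>q = q'\<close>[symmetric] in auto)
    then show ?thesis using True Suc.prems by (simp add: b_def Let_def)
  next
    case False
    have bn: "b < n" using b False by auto
    \<comment> \<open>Bypassing \<open>n\<close> in its cycle: the predecessor of \<open>n\<close>
      is now sent to \<open>b = q n\<close>, all other points keep their image.\<close>
    have q'k: "(if q k = n then b else q k) = q' k" if "k < n" for k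
      using ne[OF that] False by (auto simp: q'_def transpose_def)
    have "fixsum y m {..<n} q' (w(b := w b + w n)) = prod_list (map (psum y m)
        (cycle_weights n (map (\<lambda>z. if z = n then b else z) L) (W[b := W ! b + W ! n])))"
      by (rule Suc.IH[OF q']) (use Suc.prems bn in \<open>auto simp: nth_list_update q'k[symmetric]\<close>)
    then show ?thesis using False Suc.prems(4)[of n] Suc.prems(5)[of n]
      by (simp add: Let_def b_def[symmetric] del: map_eq_conv)
  qed
  finally show ?case .
qed

fun tally_add :: "int \<Rightarrow> nat list \<Rightarrow> (int \<times> nat list) list \<Rightarrow> (int \<times> nat list) list" where
  "tally_add s L [] = [(s, L)]"
| "tally_add s L ((s', L') # T) = (if L = L' then (s + s', L') # T else (s', L') # tally_add s L T)"

text \<open>Expands the sum, over column permutations \<open>q\<close> and row permutations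
  \<open>p\<close>, of the sign of \<open>q\<close> times the power sum product of
  \<open>q \<circ> p\<close>. Sorting the cycle weights merges equal cycle types; the 5184 pairs of
  the largest case collapse to 22 entries. The result is the hook product times the Schur function,
  written in power sums.\<close>

definition cycle_tally :: "nat list \<Rightarrow> nat list \<Rightarrow> (int \<times> nat list) list" where
  "cycle_tally rs cs = (let d = length rs; PS = signed_perms rs d in
    foldr (\<lambda>(s, Q). foldr (\<lambda>(_, P). tally_add s
       (foldr insort (cycle_weights d (map (\<lambda>k. Q ! k) P) (replicate d (Suc 0))) [])) PS)
       (signed_perms cs d) [])"

definition tally_value :: "(nat \<Rightarrow> complex) \<Rightarrow> (int \<times> nat list) list \<Rightarrow> complex" where
  "tally_value p T = sum_list (map (\<lambda>(s, L). of_int s * prod_list (map p L)) T)"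

lemma tally_value_Nil [simp]: "tally_value p [] = 0"
  and tally_value_Cons [simp]: "tally_value p ((s, L) # T) = of_int s * prod_list (map p L) + tally_value p T"
  by (simp_all add: tally_value_def)

lemma tally_value_add [simp]:
  "tally_value p (tally_add s L T) = of_int s * prod_list (map p L) + tally_value p T"
  by (induction s L T rule: tally_add.induct) (auto simp: algebra_simps)

lemma prod_list_map_insort: "prod_list (map p (foldr insort xs [])) = prod_list (map p xs)"
  for p :: "nat \<Rightarrow> complex"
proof -
  have "mset (foldr insort xs []) = mset xs" by (induction xs) auto
  then show ?thesis by (metis mset_map prod_mset_prod_list)
qed

lemma sum_fixsum_code:
  assumes len: "length rs = d"
  shows "(\<Sum>q\<in>colour_group {..<d} (\<lambda>k. cs ! k). \<Sum>p\<in>colour_group {..<d} (\<lambda>k. rs ! k).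
      of_int (sign q) * fixsum y m {..<d} (q \<circ> p) (\<lambda>_. Suc 0)) = tally_value (psum y m) (cycle_tally rs cs)"
proof -
  define H where "H s Q P = of_int s * prod_list (map (psum y m)
     (cycle_weights d (map (\<lambda>k. Q ! k) P) (replicate d (Suc 0))))" for s and Q P :: "nat list"
  have H: "of_int (sign q) * fixsum y m {..<d} (q \<circ> p) (\<lambda>_. Suc 0) =
      H (sign q) (map q [0..<d]) (map p [0..<d])"
    if "q \<in> colour_group {..<d} (\<lambda>k. cs ! k)" "p \<in> colour_group {..<d} (\<lambda>k. rs ! k)" for p q
  proof -
    from that have q: "q permutes {..<d}" and p: "p permutes {..<d}"
      by (auto simp: colour_group_def)
    have "p k < d" if "k < d" for k using permutes_in_image[OF p] that by auto
    then show ?thesis unfolding H_def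
      by (intro arg_cong2[where f = times] refl fixsum_code permutes_compose p q) auto
  qed
  have T: "tally_value (psum y m) (foldr (\<lambda>(_, P). tally_add s
       (foldr insort (cycle_weights d (map (\<lambda>k. Q ! k) P) (replicate d (Suc 0))) [])) X T)
     = sum_list (map (\<lambda>(_, P). H s Q P) X) + tally_value (psum y m) T" for s Q X T
    by (induction X) (auto simp: H_def prod_list_map_insort)
  have T': "tally_value (psum y m) (foldr (\<lambda>(s, Q). foldr (\<lambda>(_, P). tally_add s
       (foldr insort (cycle_weights d (map (\<lambda>k. Q ! k) P) (replicate d (Suc 0))) [])) X) Y [])
     = sum_list (map (\<lambda>(s, Q). sum_list (map (\<lambda>(_, P). H s Q P) X)) Y)" for X Y
    by (induction Y) (auto simp: T)
  have "(\<Sum>q\<in>colour_group {..<d} (\<lambda>k. cs ! k). \<Sum>p\<in>colour_group {..<d} (\<lambda>k. rs ! k).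
      of_int (sign q) * fixsum y m {..<d} (q \<circ> p) (\<lambda>_. Suc 0)) =
    (\<Sum>q\<in>colour_group {..<d} (\<lambda>k. cs ! k). \<Sum>p\<in>colour_group {..<d} (\<lambda>k. rs ! k).
      H (sign q) (map q [0..<d]) (map p [0..<d]))"
    by (intro sum.cong refl H)
  also have "\<dots> = sum_list (map (\<lambda>(s, Q). sum_list (map (\<lambda>(_, P). H s Q P) (signed_perms rs d)))
      (signed_perms cs d))"
    by (simp add: sum_colour_group_code[of "\<lambda>s Q. sum_list (map (\<lambda>(_, P). H s Q P) (signed_perms rs d))", symmetric]
        sum_colour_group_code[of "\<lambda>_ P. H (sign q) (map q [0..<d]) P" for q, symmetric])
  finally show ?thesis unfolding cycle_tally_def len Let_def T' .
qed

section \<open>The proportionality factor of a Young symmetrizer as a program\<close>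

fun column_sign :: "nat list \<Rightarrow> nat list \<Rightarrow> nat \<Rightarrow> nat list \<Rightarrow> int" where
  "column_sign c r 0 f = 1"
| "column_sign c r (Suc n) f = sum_list (map (\<lambda>b. if f ! b = r ! n then
      (if b = n then column_sign c r n f else - column_sign c r n (f[b := f ! n])) else 0)
    (filter (\<lambda>b. c ! b = c ! n) [0..<Suc n]))"

text \<open>The coset recursion again. With \<open>q n = b\<close> the condition at \<open>n\<close>
  reads \<open>f b = r n\<close> and is tested at once; the other conditions concern
  \<open>f\<close> with its value at \<open>b\<close> replaced by \<open>f n\<close>. The early test
  avoids enumerating the column group inside a sum that already runs over pairs of
  permutations.\<close>

lemma column_sign_code:
  assumes "n \<le> length L" "\<And>k. k < n \<Longrightarrow> L ! k = f k"
  shows "(\<Sum>q\<in>colour_group {..<n} (\<lambda>k. c ! k). if \<forall>k<n. f (q k) = r ! k then sign q else 0) =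
    column_sign c r n L"
  using assms
proof (induction n arbitrary: f L)
  case 0
  have "colour_group {..<0} (\<lambda>k. c ! k) = {id}" by (auto simp: colour_group_def)
  then show ?case by simp
next
  case (Suc n)
  have *: "(\<Sum>q\<in>colour_group {..<n} (\<lambda>k. c ! k).
        if \<forall>k<Suc n. f ((transpose n b \<circ> q) k) = r ! k then sign (transpose n b \<circ> q) else 0)
      = (if L ! b = r ! n then (if b = n then column_sign c r n L
          else - column_sign c r n (L[b := L ! n])) else 0)" (is "?l = ?r")
    if b: "b \<in> insert n {..<n}" for b
  proof -
    have Lb: "L ! b = f b" using Suc.prems b by auto
    have eq: "(if \<forall>k<Suc n. f ((transpose n b \<circ> q) k) = r ! k then sign (transpose n b \<circ> q) else 0) =
        (if f b = r ! n then (if b = n then 1 else - 1) *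
           (if \<forall>k<n. (f \<circ> transpose n b) (q k) = r ! k then sign q else 0) else 0)"
      if "q \<in> colour_group {..<n} (\<lambda>k. c ! k)" for q
    proof -
      from that have q: "q permutes {..<n}" by (auto simp: colour_group_def)
      then have [simp]: "q n = n" by (auto intro: permutes_not_in)
      have s: "sign (transpose n b \<circ> q) = (if b = n then sign q else - sign q)"
        using permutes_imp_permutation[OF _ q] by (simp add: sign_compose sign_swap_id permutation_swap_id)
      show ?thesis unfolding s by (auto simp: less_Suc_eq)
    qed
    have "?l = (if f b = r ! n then (if b = n then 1 else - 1) * (\<Sum>q\<in>colour_group {..<n} (\<lambda>k. c ! k).
           if \<forall>k<n. (f \<circ> transpose n b) (q k) = r ! k then sign q else 0) else 0)"
      by (subst sum.cong[OF refl eq]) (auto simp: sum_distrib_left)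
    also have "\<dots> = ?r"
    proof (cases "b = n")
      case True
      have "(\<Sum>q\<in>colour_group {..<n} (\<lambda>k. c ! k).
           if \<forall>k<n. (f \<circ> transpose n b) (q k) = r ! k then sign q else 0) = column_sign c r n L"
        by (rule Suc.IH) (use True Suc.prems in auto)
      then show ?thesis using True Lb by simp
    next
      case False
      have "(\<Sum>q\<in>colour_group {..<n} (\<lambda>k. c ! k).
           if \<forall>k<n. (f \<circ> transpose n b) (q k) = r ! k then sign q else 0) =
          column_sign c r n (L[b := L ! n])"
        by (rule Suc.IH) (use False b Suc.prems in \<open>auto simp: nth_list_update transpose_def\<close>)
      then show ?thesis using False Lb by simp
    qed
    finally show ?thesis .
  qed
  have "(\<Sum>q\<in>colour_group {..<Suc n} (\<lambda>k. c ! k).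
        if \<forall>k<Suc n. f (q k) = r ! k then sign q else 0) =
    (\<Sum>b\<in>{b\<in>insert n {..<n}. c ! b = c ! n}. \<Sum>q\<in>colour_group {..<n} (\<lambda>k. c ! k).
        if \<forall>k<Suc n. f ((transpose n b \<circ> q) k) = r ! k then sign (transpose n b \<circ> q) else 0)"
    unfolding lessThan_Suc by (rule colour_group_sum_insert) simp
  also have "\<dots> = (\<Sum>b\<in>{b\<in>insert n {..<n}. c ! b = c ! n}. if L ! b = r ! n then
      (if b = n then column_sign c r n L else - column_sign c r n (L[b := L ! n])) else 0)"
    by (intro sum.cong refl *) auto
  also have "\<dots> = column_sign c r (Suc n) L"
    unfolding column_sign.simps
    by (subst sum_list_distinct_conv_sum_set)
      (auto intro!: sum.cong simp del: upt_Suc simp: less_Suc_eq)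
  finally show ?case .
qed

text \<open>The factor \<kappa> in c c = \<kappa> c, for the Young symmetrizer c of the tableau
  whose entry k lies in row \<open>rs ! k\<close> and column \<open>cs ! k\<close>.\<close>

definition young_scalar :: "nat list \<Rightarrow> nat list \<Rightarrow> int" where
  "young_scalar rs cs = (let d = length rs; PS = signed_perms rs d in
    sum_list (map (\<lambda>(s, Q). s * sum_list (map (\<lambda>(_, P). column_sign cs rs d (map (\<lambda>k. rs ! (Q ! k)) P)) PS))
      (signed_perms cs d)))"

lemma young_scalar_code:
  assumes len: "length rs = d"
  shows "(\<Sum>q\<in>colour_group {..<d} (\<lambda>k. cs ! k). \<Sum>p\<in>colour_group {..<d} (\<lambda>k. rs ! k). sign q *
      (\<Sum>q'\<in>colour_group {..<d} (\<lambda>k. cs ! k). if \<forall>k<d. rs ! (q (p (q' k))) = rs ! k then sign q' else 0))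
    = young_scalar rs cs"
proof -
  define H where "H s Q P = s * column_sign cs rs d (map (\<lambda>k. rs ! (Q ! k)) P)"
    for s and Q P :: "nat list"
  have H: "sign q * (\<Sum>q'\<in>colour_group {..<d} (\<lambda>k. cs ! k).
        if \<forall>k<d. rs ! (q (p (q' k))) = rs ! k then sign q' else 0) =
      H (sign q) (map q [0..<d]) (map p [0..<d])"
    if "q \<in> colour_group {..<d} (\<lambda>k. cs ! k)" "p \<in> colour_group {..<d} (\<lambda>k. rs ! k)" for p q
  proof -
    from that have p: "p permutes {..<d}" by (auto simp: colour_group_def)
    have "p k < d" if "k < d" for k using permutes_in_image[OF p] that by auto
    then show ?thesis unfolding H_def
      by (intro arg_cong2[where f = times] refl column_sign_code) auto
  qed
  have "(\<Sum>q\<in>colour_group {..<d} (\<lambda>k. cs ! k). \<Sum>p\<in>colour_group {..<d} (\<lambda>k. rs ! k). sign q *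
      (\<Sum>q'\<in>colour_group {..<d} (\<lambda>k. cs ! k). if \<forall>k<d. rs ! (q (p (q' k))) = rs ! k then sign q' else 0))
     = (\<Sum>q\<in>colour_group {..<d} (\<lambda>k. cs ! k). \<Sum>p\<in>colour_group {..<d} (\<lambda>k. rs ! k).
      H (sign q) (map q [0..<d]) (map p [0..<d]))"
    by (intro sum.cong refl H)
  also have "\<dots> = sum_list (map (\<lambda>(s, Q). sum_list (map (\<lambda>(_, P). H s Q P) (signed_perms rs d)))
      (signed_perms cs d))"
    by (simp add: sum_colour_group_code[of "\<lambda>s Q. sum_list (map (\<lambda>(_, P). H s Q P) (signed_perms rs d))", symmetric]
        sum_colour_group_code[of "\<lambda>_ P. H (sign q) (map q [0..<d]) P" for q, symmetric])
  finally show ?thesis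
    unfolding young_scalar_def len Let_def H_def sum_list_const_mult[symmetric] case_prod_beta .
qed

subsection \<open>Self-adjoint monoids of matrices\<close>

definition adj :: "complex mat \<Rightarrow> complex mat" where
  "adj A = mat (dim_col A) (dim_row A) (\<lambda>(i, j). cnj (A $$ (j, i)))"

lemma adj_dim [simp]: "dim_row (adj A) = dim_col A" "dim_col (adj A) = dim_row A"
  by (simp_all add: adj_def)

lemma adj_carrier [simp]: "A \<in> carrier_mat m n \<Longrightarrow> adj A \<in> carrier_mat n m"
  by auto

lemma adj_index [simp]: "i < dim_col A \<Longrightarrow> j < dim_row A \<Longrightarrow> adj A $$ (i, j) = cnj (A $$ (j, i))"
  by (simp add: adj_def)

lemma adj_adj [simp]: "adj (adj A) = A"
  by (rule eq_matI) auto

lemma adj_one [simp]: "adj (1\<^sub>m n) = 1\<^sub>m n"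
  by (rule eq_matI) auto

lemma adj_zero [simp]: "adj (0\<^sub>m m n) = 0\<^sub>m n m"
  by (rule eq_matI) auto

lemma adj_mult: "A \<in> carrier_mat m n \<Longrightarrow> B \<in> carrier_mat n k \<Longrightarrow> adj (A * B) = adj B * adj A"
  by (rule eq_matI) (auto simp: scalar_prod_def mult.commute)

lemma adj_add: "A \<in> carrier_mat m n \<Longrightarrow> B \<in> carrier_mat m n \<Longrightarrow> adj (A + B) = adj A + adj B"
  by (rule eq_matI) auto

lemma adj_minus: "A \<in> carrier_mat m n \<Longrightarrow> B \<in> carrier_mat m n \<Longrightarrow> adj (A - B) = adj A - adj B"
  by (rule eq_matI) auto

definition mtrace :: "complex mat \<Rightarrow> complex" where
  "mtrace A = (\<Sum>i<dim_row A. A $$ (i, i))"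

lemma mtrace_mult_comm:
  assumes "A \<in> carrier_mat m n" "B \<in> carrier_mat n m"
  shows "mtrace (A * B) = mtrace (B * A)"
proof -
  have "mtrace (A * B) = (\<Sum>i<m. \<Sum>k<n. A $$ (i, k) * B $$ (k, i))"
    using assms by (auto simp: mtrace_def scalar_prod_def atLeast0LessThan intro!: sum.cong)
  also have "\<dots> = (\<Sum>k<n. \<Sum>i<m. A $$ (i, k) * B $$ (k, i))" by (rule sum.swap)
  also have "\<dots> = mtrace (B * A)"
    using assms by (auto simp: mtrace_def scalar_prod_def atLeast0LessThan mult.commute intro!: sum.cong)
  finally show ?thesis .
qed

lemma mtrace_minus: "A \<in> carrier_mat n n \<Longrightarrow> B \<in> carrier_mat n n \<Longrightarrow> mtrace (A - B) = mtrace A - mtrace B"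
  by (auto simp: mtrace_def sum_subtractf)

lemma mtrace_smult: "mtrace (c \<cdot>\<^sub>m A) = c * mtrace A" if "A \<in> carrier_mat n n"
  using that by (auto simp: mtrace_def sum_distrib_left)

lemma mtrace_one [simp]: "mtrace (1\<^sub>m n) = of_nat n"
  by (simp add: mtrace_def)

section \<open>The Frobenius inner product\<close>

definition frob :: "complex mat \<Rightarrow> complex mat \<Rightarrow> complex" where
  "frob A B = mtrace (A * adj B)"

lemma frob_sum:
  assumes "A \<in> carrier_mat n n" "B \<in> carrier_mat n n"
  shows "frob A B = (\<Sum>i<n. \<Sum>j<n. A $$ (i, j) * cnj (B $$ (i, j)))"
  using assms by (auto simp: frob_def mtrace_def scalar_prod_def atLeast0LessThan intro!: sum.cong)

lemma frob_cnj: "A \<in> carrier_mat n n \<Longrightarrow> B \<in> carrier_mat n n \<Longrightarrow> frob B A = cnj (frob A B)"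
  by (simp add: frob_sum mult.commute)

lemma frob_lin:
  assumes "A \<in> carrier_mat n n" "B \<in> carrier_mat n n" "C \<in> carrier_mat n n"
  shows "frob (A + c \<cdot>\<^sub>m B) C = frob A C + c * frob B C"
    "frob C (A + c \<cdot>\<^sub>m B) = frob C A + cnj c * frob C B"
  using assms by (simp_all add: frob_sum[of _ n] sum.distrib algebra_simps sum_distrib_left)

lemma frob_self:
  assumes "A \<in> carrier_mat n n"
  shows "frob A A = of_real (\<Sum>i<n. \<Sum>j<n. (cmod (A $$ (i, j)))\<^sup>2)"
  using assms by (simp only: frob_sum of_real_sum complex_norm_square)

lemma frob_eq_0_iff:
  assumes "A \<in> carrier_mat n n"
  shows "frob A A = 0 \<longleftrightarrow> A = 0\<^sub>m n n"
proof
  assume "frob A A = 0"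
  then have "(\<Sum>i<n. \<Sum>j<n. (cmod (A $$ (i, j)))\<^sup>2) = 0"
    unfolding frob_self[OF assms] of_real_eq_0_iff .
  then have "A $$ (i, j) = 0" if "i < n" "j < n" for i j
    using that by (subst (asm) sum_nonneg_eq_0_iff) (auto simp: sum_nonneg sum_nonneg_eq_0_iff)
  then show "A = 0\<^sub>m n n" using assms by (intro eq_matI) auto
qed (simp add: frob_sum[of _ n])

text \<open>By cyclicity \<open>frob A A\<close> is the trace of \<open>adj A * A\<close>. Several
  matrix equalities below follow by applying this to a difference.\<close>

lemma adj_mult_self_eq_0:
  assumes A: "A \<in> carrier_mat n n" and 0: "adj A * A = 0\<^sub>m n n"
  shows "A = 0\<^sub>m n n"
proof -
  have "frob A A = mtrace (adj A * A)"
    unfolding frob_def by (rule mtrace_mult_comm) (use A in auto)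
  then have "frob A A = 0" by (simp add: 0 mtrace_def)
  then show ?thesis using frob_eq_0_iff[OF A] by simp
qed

text \<open>Gaussian elimination over the coordinates in \<open>X\<close>: one coordinate
  \<open>x\<close> is cleared with a pivot vector \<open>j\<close>, and the relation found for the
  remaining vectors is completed by a coefficient for \<open>j\<close>.\<close>

lemma linear_dependence:
  fixes v :: "'i \<Rightarrow> 'x \<Rightarrow> complex"
  assumes "finite X" "finite I" "card X < card I"
  shows "\<exists>c. (\<exists>i\<in>I. c i \<noteq> 0) \<and> (\<forall>x\<in>X. (\<Sum>i\<in>I. c i * v i x) = 0)"
  using assms
proof (induction X arbitrary: I v rule: finite_induct)
  case empty
  then obtain i where "i \<in> I" by (metis card_gt_0_iff ex_in_conv card.empty)
  then show ?case by (intro exI[of _ "\<lambda>_. 1"]) auto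
next
  case (insert x X)
  show ?case
  proof (cases "\<forall>i\<in>I. v i x = 0")
    case True
    then show ?thesis using insert.IH[of I v] insert by auto
  next
    case False
    then obtain j where j: "j \<in> I" "v j x \<noteq> 0" by blast
    define u where "u i y = v i y - v i x / v j x * v j y" for i y
    have "card X < card (I - {j})" using insert j by simp
    then obtain c i0 where c: "i0 \<in> I - {j}" "c i0 \<noteq> 0" "\<And>y. y \<in> X \<Longrightarrow> (\<Sum>i\<in>I - {j}. c i * u i y) = 0"
      using insert.IH[of "I - {j}" u] insert.prems by auto
    define d where "d i = (if i = j then - (\<Sum>i\<in>I - {j}. c i * v i x) / v j x else c i)" for i
    have "(\<Sum>i\<in>I. d i * v i y) = (\<Sum>i\<in>I - {j}. c i * u i y)" for y
    proof -
      have "(\<Sum>i\<in>I. d i * v i y) = d j * v j y + (\<Sum>i\<in>I - {j}. d i * v i y)"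
        using j insert.prems by (simp add: sum.remove)
      also have "(\<Sum>i\<in>I - {j}. d i * v i y) = (\<Sum>i\<in>I - {j}. c i * v i y)"
        by (intro sum.cong) (auto simp: d_def)
      finally show ?thesis
        by (simp add: d_def u_def algebra_simps sum_subtractf sum_distrib_left sum_distrib_right sum_divide_distrib)
    qed
    moreover have "(\<Sum>i\<in>I - {j}. c i * u i x) = 0" using j by (simp add: u_def)
    ultimately show ?thesis using c j by (intro exI[of _ d]) (auto simp: d_def)
  qed
qed

text \<open>Nonzero pairwise orthogonal matrices are independent in a space of dimension
  \<open>n * n\<close>. This is the upper bound in two maximality arguments below, one for
  orthogonal bases and one for intertwiners.\<close>

lemma frob_orthogonal_bound:
  assumes a: "\<And>i. i < k \<Longrightarrow> a i \<in> carrier_mat n n" "\<And>i. i < k \<Longrightarrow> frob (a i) (a i) \<noteq> 0"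
    and o: "\<And>i j. i < k \<Longrightarrow> j < k \<Longrightarrow> i \<noteq> j \<Longrightarrow> frob (a i) (a j) = 0"
  shows "k \<le> n * n"
proof (rule ccontr)
  assume "\<not> k \<le> n * n"
  then obtain c i0 where c: "i0 < k" "c i0 \<noteq> 0"
    "\<And>x. x \<in> {..<n} \<times> {..<n} \<Longrightarrow> (\<Sum>i<k. c i * a i $$ x) = 0"
    using linear_dependence[of "{..<n} \<times> {..<n}" "{..<k}" "\<lambda>i x. a i $$ x"] by auto
  have "c i0 * frob (a i0) (a i0) = (\<Sum>i<k. c i * frob (a i) (a i0))"
    using c(1) by (simp add: sum.remove[of _ i0] o)
  also have "\<dots> = (\<Sum>i<k. \<Sum>p<n. \<Sum>q<n. c i * a i $$ (p, q) * cnj (a i0 $$ (p, q)))"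
    using c(1) a by (intro sum.cong) (simp_all add: frob_sum[of _ n] sum_distrib_left mult.assoc)
  also have "\<dots> = (\<Sum>p<n. \<Sum>q<n. (\<Sum>i<k. c i * a i $$ (p, q)) * cnj (a i0 $$ (p, q)))"
    unfolding sum_distrib_right sum.swap[of _ "{..<n}" "{..<k}"] ..
  also have "\<dots> = 0" using c(3) by simp
  finally show False using a(2) c by simp
qed

section \<open>Polynomials in a matrix\<close>

primrec horner :: "nat \<Rightarrow> complex mat \<Rightarrow> complex list \<Rightarrow> complex mat" where
  "horner n H [] = 0\<^sub>m n n"
| "horner n H (c # cs) = c \<cdot>\<^sub>m 1\<^sub>m n + H * horner n H cs"

primrec matpow :: "nat \<Rightarrow> complex mat \<Rightarrow> nat \<Rightarrow> complex mat" where
  "matpow n H 0 = 1\<^sub>m n"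
| "matpow n H (Suc k) = H * matpow n H k"

lemma horner_carrier [simp]: "H \<in> carrier_mat n n \<Longrightarrow> horner n H cs \<in> carrier_mat n n"
  by (induction cs) auto

lemma matpow_carrier [simp]: "H \<in> carrier_mat n n \<Longrightarrow> matpow n H k \<in> carrier_mat n n"
  by (induction k) auto

lemma horner_dim [simp]:
  assumes "H \<in> carrier_mat n n"
  shows "dim_row (horner n H cs) = n" "dim_col (horner n H cs) = n"
  using horner_carrier[OF assms, of cs] by auto

lemma square_mat_eqI:
  assumes "A \<in> carrier_mat n n" "B \<in> carrier_mat n n"
    "\<And>i j. i < n \<Longrightarrow> j < n \<Longrightarrow> A $$ (i, j) = B $$ (i, j)"
  shows "A = B"
  using assms by (intro eq_matI) auto

lemma horner_index:
  assumes H: "H \<in> carrier_mat n n" and ij: "i < n" "j < n"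
  shows "horner n H cs $$ (i, j) = (\<Sum>k<length cs. cs ! k * matpow n H k $$ (i, j))"
  using ij(1)
proof (induction cs arbitrary: i)
  case (Cons c cs)
  have "(H * horner n H cs) $$ (i, j) = (\<Sum>l<n. H $$ (i, l) * (\<Sum>k<length cs. cs ! k * matpow n H k $$ (l, j)))"
    using Cons ij H by (simp add: mat_mult_index[of _ n n _ n] atLeast0LessThan del: index_mult_mat(1))
  also have "\<dots> = (\<Sum>k<length cs. cs ! k * (\<Sum>l<n. H $$ (i, l) * matpow n H k $$ (l, j)))"
    unfolding sum_distrib_left by (subst sum.swap) (simp add: mult_ac)
  also have "\<dots> = (\<Sum>k<length cs. cs ! k * matpow n H (Suc k) $$ (i, j))"
    using Cons.prems ij H by (simp add: mat_mult_index[of _ n n _ n] atLeast0LessThan del: index_mult_mat(1))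
  finally show ?case
    using Cons.prems ij H by (simp add: sum.lessThan_Suc_shift del: sum.lessThan_Suc index_mult_mat(1))
qed (use ij in auto)

text \<open>The first \<open>n * n + 1\<close> powers of \<open>H\<close> are too many to be
  independent; the list holds the coefficients of a relation, constant term at the head.\<close>

lemma horner_annihilates:
  assumes H: "H \<in> carrier_mat n n"
  shows "\<exists>cs. (\<exists>c\<in>set cs. c \<noteq> 0) \<and> horner n H cs = 0\<^sub>m n n"
proof -
  obtain c i0 where c: "i0 < Suc (n * n)" "c i0 \<noteq> 0"
    "\<And>x. x \<in> {..<n} \<times> {..<n} \<Longrightarrow> (\<Sum>i<Suc (n * n). c i * matpow n H i $$ x) = 0"
    using linear_dependence[of "{..<n} \<times> {..<n}" "{..<Suc (n * n)}" "\<lambda>i x. matpow n H i $$ x"] by auto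
  have "horner n H (map c [0..<Suc (n * n)]) $$ (i, j) = 0" if "i < n" "j < n" for i j
    using c(3)[of "(i, j)"] that unfolding horner_index[OF H that] by (simp del: upt_Suc)
  then have "horner n H (map c [0..<Suc (n * n)]) = 0\<^sub>m n n"
    using H horner_carrier[OF H] by (intro square_mat_eqI[of _ n]) (auto simp del: upt_Suc)
  then show ?thesis using c(1,2)
    by (intro exI[of _ "map c [0..<Suc (n * n)]"]) (auto simp del: upt_Suc)
qed

text \<open>The instance of interest is the image of SL_4 under a representation compatible with
  adjoints; the commutant then consists of its endomorphisms. Closure under products and adjoints
  puts \<open>x * adj y\<close> in \<open>X\<close>, so traces against \<open>X\<close> determine
  inner products.\<close>

locale star_monoid =
  fixes n :: nat and X :: "complex mat set"
  assumes X_carrier: "x \<in> X \<Longrightarrow> x \<in> carrier_mat n n"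
    and X_one: "1\<^sub>m n \<in> X"
    and X_mult: "x \<in> X \<Longrightarrow> y \<in> X \<Longrightarrow> x * y \<in> X"
    and X_adj: "x \<in> X \<Longrightarrow> adj x \<in> X"
begin

definition commutant :: "complex mat set" where
  "commutant = {T \<in> carrier_mat n n. \<forall>x\<in>X. T * x = x * T}"

lemma commutant_carrier [simp]: "T \<in> commutant \<Longrightarrow> T \<in> carrier_mat n n"
  unfolding commutant_def by blast

lemma commutantI: "T \<in> carrier_mat n n \<Longrightarrow> (\<And>x. x \<in> X \<Longrightarrow> T * x = x * T) \<Longrightarrow> T \<in> commutant"
  unfolding commutant_def by blast

lemma commutant_commutes: "T \<in> commutant \<Longrightarrow> x \<in> X \<Longrightarrow> T * x = x * T"
  unfolding commutant_def by blast

lemmas assoc = assoc_mult_mat[of _ n n _ n _ n]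

lemma mult_closed [simp]: "A \<in> carrier_mat n n \<Longrightarrow> B \<in> carrier_mat n n \<Longrightarrow> A * B \<in> carrier_mat n n"
  by auto

lemma commutant_one [simp]: "1\<^sub>m n \<in> commutant"
  using left_mult_one_mat[OF X_carrier] right_mult_one_mat[OF X_carrier]
  by (intro commutantI) auto

lemma commutant_zero [simp]: "0\<^sub>m n n \<in> commutant"
  using left_mult_zero_mat[OF X_carrier] right_mult_zero_mat[OF X_carrier]
  by (intro commutantI) auto

lemma commutant_mult [simp]:
  assumes "S \<in> commutant" "T \<in> commutant"
  shows "S * T \<in> commutant"
proof -
  have "S * T * x = x * (S * T)" if x: "x \<in> X" for x
  proof -
    have "S * T * x = S * (x * T)"
      using assms X_carrier[OF x] commutant_commutes[OF assms(2) x] by (simp add: assoc)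
    also have "\<dots> = x * (S * T)"
      using assms X_carrier[OF x] commutant_commutes[OF assms(1) x] by (simp add: assoc[symmetric])
    finally show ?thesis .
  qed
  then show ?thesis using assms by (intro commutantI) auto
qed

lemma commutant_lin:
  assumes "S \<in> commutant" "T \<in> commutant"
  shows "S + T \<in> commutant" "S - T \<in> commutant" "c \<cdot>\<^sub>m T \<in> commutant"
proof -
  note c = assms[THEN commutant_carrier]
  have "(S + T) * x = x * (S + T)" "(S - T) * x = x * (S - T)" "(c \<cdot>\<^sub>m T) * x = x * (c \<cdot>\<^sub>m T)"
    if x: "x \<in> X" for x
    using c X_carrier[OF x] commutant_commutes[OF assms(1) x] commutant_commutes[OF assms(2) x]
    by (auto simp: add_mult_distrib_mat[OF c] mult_add_distrib_mat[of _ n n _ n]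
      minus_mult_distrib_mat[OF c] mult_minus_distrib_mat[of _ n n _ n]
      mult_smult_assoc_mat[of _ n n _ n] mult_smult_distrib[of _ n n _ n])
  then show "S + T \<in> commutant" "S - T \<in> commutant" "c \<cdot>\<^sub>m T \<in> commutant"
    using c by (auto intro!: commutantI)
qed

lemma commutant_adj [simp]: assumes "T \<in> commutant" shows "adj T \<in> commutant"
proof -
  have "adj T * x = x * adj T" if x: "x \<in> X" for x
  proof -
    have "adj (adj x * T) = adj (T * adj x)"
      using commutant_commutes[OF assms X_adj[OF x]] by simp
    then show ?thesis
      using assms X_carrier[OF x] by (simp add: adj_mult[of _ n n _ n])
  qed
  then show ?thesis using assms by (intro commutantI) auto
qed

lemmas distribs = add_mult_distrib_mat[of _ n n _ _ n] mult_add_distrib_mat[of _ n n _ n]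
  minus_mult_distrib_mat[of _ n n _ _ n] mult_minus_distrib_mat[of _ n n _ n]

lemma horner_commutes:
  assumes H: "H \<in> carrier_mat n n"
  shows "horner n H cs * H = H * horner n H cs"
proof (induction cs)
  case (Cons c cs)
  have "horner n H (c # cs) * H = (c \<cdot>\<^sub>m 1\<^sub>m n) * H + H * (horner n H cs * H)"
    using H by (simp add: distribs assoc)
  also have "\<dots> = H * horner n H (c # cs)"
    using H Cons.IH by (simp add: distribs mult_smult_assoc_mat[of _ n n _ n] mult_smult_distrib[of _ n n _ n])
  finally show ?case .
qed (use H in auto)

lemma horner_commutant: "H \<in> commutant \<Longrightarrow> horner n H cs \<in> commutant"
  by (induction cs) (auto intro!: commutant_lin)

text \<open>The square of \<open>H * Y\<close> is \<open>adj Y * (H * (H * Y))\<close>: a Hermitian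
  matrix has no nilpotent part at the eigenvalue 0.\<close>

lemma hermitian_cancel:
  assumes H: "H \<in> carrier_mat n n" "adj H = H" and Y: "Y \<in> carrier_mat n n" and 0: "H * (H * Y) = 0\<^sub>m n n"
  shows "H * Y = 0\<^sub>m n n"
proof (rule adj_mult_self_eq_0)
  have "adj (H * Y) * (H * Y) = adj Y * (H * (H * Y))"
    using H Y by (simp add: adj_mult[of _ n n _ n] assoc)
  then show "adj (H * Y) * (H * Y) = 0\<^sub>m n n" using Y by (simp add: 0)
qed (use H Y in auto)

text \<open>Zero constant terms are removed one by one with \<open>hermitian_cancel\<close>, which
  works as long as one factor \<open>H\<close> remains in front; the first nonzero coefficient ends
  up as \<open>c\<close>.\<close>

lemma horner_strip:
  assumes H: "H \<in> carrier_mat n n" "adj H = H"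
    and "H * horner n H cs = 0\<^sub>m n n" "\<exists>c\<in>set cs. c \<noteq> 0"
  shows "\<exists>c cs'. c \<noteq> 0 \<and> H * (c \<cdot>\<^sub>m 1\<^sub>m n + H * horner n H cs') = 0\<^sub>m n n"
  using assms(3,4)
proof (induction cs)
  case (Cons c cs)
  show ?case
  proof (cases "c = 0")
    case True
    then have "horner n H (c # cs) = H * horner n H cs"
      using H by (intro square_mat_eqI[of _ n]) (auto simp del: index_mult_mat(1))
    then have "H * horner n H cs = 0\<^sub>m n n"
      using Cons.prems hermitian_cancel[OF H, of "horner n H cs"] H by simp
    then show ?thesis using Cons True by auto
  next
    case False
    then show ?thesis using Cons.prems by auto
  qed
qed simp

text \<open>From \<open>H * (c + H * Y) = 0\<close> with \<open>Y\<close> a polynomial in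
  \<open>H\<close>, the matrix \<open>r = - Y / c\<close> solves \<open>H * H * r = H\<close>, so it
  inverts \<open>H\<close> on its range. As a polynomial in \<open>H\<close> it commutes with
  \<open>H\<close> and stays in the commutant.\<close>

lemma hermitian_inverse:
  assumes H: "H \<in> commutant" "adj H = H"
  shows "\<exists>r\<in>commutant. r * H = H * r \<and> H * H * r = H"
proof -
  note Hc = commutant_carrier[OF H(1)]
  obtain cs0 where "\<exists>c\<in>set cs0. c \<noteq> 0" "horner n H cs0 = 0\<^sub>m n n"
    using horner_annihilates[OF Hc] by blast
  then have "\<exists>c\<in>set cs0. c \<noteq> 0" "H * horner n H cs0 = 0\<^sub>m n n"
    using Hc by auto
  from horner_strip[OF Hc H(2) this(2,1)] obtain c cs
    where c: "c \<noteq> 0" and 0: "H * (c \<cdot>\<^sub>m 1\<^sub>m n + H * horner n H cs) = 0\<^sub>m n n" by blast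
  let ?Y = "horner n H cs" and ?r = "(- 1 / c) \<cdot>\<^sub>m horner n H cs"
  have Y: "?Y \<in> carrier_mat n n" using Hc by simp
  have "c \<cdot>\<^sub>m H + H * H * ?Y = 0\<^sub>m n n"
    using 0 Hc Y by (simp add: distribs assoc mult_smult_distrib[of _ n n _ n])
  then have e: "c * H $$ (i, j) + (H * H * ?Y) $$ (i, j) = 0" if "i < n" "j < n" for i j
    using that Hc Y index_add_mat(1)[of i "H * H * ?Y" j "c \<cdot>\<^sub>m H"]
    by (metis carrier_matD index_smult_mat(1) index_zero_mat(1) mult_closed)
  have "H * H * ?r = (- 1 / c) \<cdot>\<^sub>m (H * H * ?Y)"
    using Hc Y by (simp add: mult_smult_distrib[of _ n n _ n])
  also have "\<dots> = H"
    using Hc Y e c by (intro square_mat_eqI[of _ n])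
      (auto simp: divide_simps add_eq_0_iff simp del: index_mult_mat(1))
  finally have "H * H * ?r = H" .
  moreover have "?r * H = H * ?r"
    using Hc Y horner_commutes[OF Hc, of cs] by (simp add: mult_smult_distrib[of _ n n _ n] mult_smult_assoc_mat[of _ n n _ n])
  moreover have "?r \<in> commutant" using horner_commutant[OF H(1)] H by (intro commutant_lin)
  ultimately show ?thesis by blast
qed

text \<open>The Moore--Penrose inverse is a polynomial in \<open>T\<^sup>* T\<close> times \<open>T\<^sup>*\<close>, and so stays in the
  commutant.\<close>

lemma moore_penrose:
  assumes T: "T \<in> commutant"
  obtains S where "S \<in> commutant" "T * S * T = T" "S * T * S = S"
    "adj (S * T) = S * T" "adj (T * S) = T * S"
proof -
  let ?H = "adj T * T"
  have Tc [simp]: "T \<in> carrier_mat n n" using T by simp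
  have H: "?H \<in> commutant" "adj ?H = ?H" using T by (auto simp: adj_mult[of _ n n _ n])
  from hermitian_inverse[OF this] obtain r where r: "r \<in> commutant" and rH: "r * ?H = ?H * r"
    and HHr: "?H * ?H * r = ?H" by blast
  have rc [simp]: "r \<in> carrier_mat n n" using r by simp
  have Hc [simp]: "?H \<in> carrier_mat n n" using H by simp
  \<comment> \<open>\<open>E\<close> turns out to be the orthogonal projection onto the range of
    \<open>adj T\<close>.\<close>
  define E where "E = ?H * r"
  have Ec [simp]: "E \<in> carrier_mat n n" by (simp add: E_def)
  have HE: "?H * E = ?H" using HHr by (simp add: E_def assoc)
  have aHE: "adj E * ?H = ?H"
    using arg_cong[OF HE, of adj] H(2) by (simp add: adj_mult[of ?H n n E n])
  have aEE: "adj E * E = E"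
    using arg_cong[OF aHE, of "\<lambda>M. M * r"] by (simp add: E_def assoc)
  then have E: "adj E = E"
    by (metis Ec adj_adj adj_carrier adj_mult)
  have EH: "E * ?H = ?H" using aHE E by simp
  have "M - M - (M - M) = 0\<^sub>m n n" if "M \<in> carrier_mat n n" for M :: "complex mat"
    using that by (intro eq_matI) auto
  note z = this[OF Hc]
  have TE: "T * E = T"
  proof -
    \<comment> \<open>With H = \<open>adj T * T\<close>, this square is (1 - E) H (1 - E), which
      vanishes because \<open>E\<close> fixes H from both sides.\<close>
    have "adj (T - T * E) * (T - T * E) = (adj T - E * adj T) * (T - T * E)"
      by (simp add: adj_minus[of _ n n] adj_mult[of _ n n _ n] E)
    also have "\<dots> = (?H - E * ?H) - (?H * E - E * (?H * E))"
      by (simp add: distribs assoc minus_carrier_mat)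
    also have "\<dots> = 0\<^sub>m n n" unfolding HE EH by (rule z)
    finally have "T - T * E = 0\<^sub>m n n" by (rule adj_mult_self_eq_0[rotated]) (simp add: minus_carrier_mat)
    then have "(T - T * E) $$ (i, j) = 0" if "i < n" "j < n" for i j using that by simp
    then have "T $$ (i, j) = (T * E) $$ (i, j)" if "i < n" "j < n" for i j
      using that carrier_matD[OF Tc] carrier_matD[OF Ec] by (simp del: index_mult_mat(1))
    then show ?thesis by (intro square_mat_eqI[of _ n]) (simp_all del: index_mult_mat(1))
  qed
  \<comment> \<open>The generalized inverse of \<open>adj T * T\<close>, times
    \<open>adj T\<close>.\<close>
  define S where "S = r * adj T"
  have Sc [simp]: "S \<in> carrier_mat n n" by (simp add: S_def)
  have ST: "S * T = E" using rH by (simp add: S_def E_def assoc)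
  have TST: "T * S * T = T" using ST TE by (simp add: assoc)
  have EaT: "E * adj T = adj T"
    using arg_cong[OF TE, of adj] by (simp add: adj_mult[of _ n n _ n] E)
  have "E * S = S"
  proof -
    have "E * S = ?H * r * (r * adj T)" by (simp only: E_def S_def)
    also have "\<dots> = r * (?H * r) * adj T"
      using rH by (simp add: assoc[of _ _ _, symmetric] del: assoc)
    also have "\<dots> = r * (E * adj T)" by (simp add: E_def assoc)
    finally show ?thesis by (simp add: EaT S_def)
  qed
  then have STS: "S * T * S = S" by (simp add: ST)
  have aFT: "adj (T * S) * T = T"
  proof -
    have "adj (T * S) * T = T * (adj r * ?H)"
      by (simp add: S_def adj_mult[of _ n n _ n] assoc)
    also have "adj r * ?H = adj E" by (simp add: E_def adj_mult[of ?H n n r n] H(2))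
    finally show ?thesis by (simp add: E TE)
  qed
  have "adj (T * S) * (T * S) = T * S"
    using arg_cong[OF aFT, of "\<lambda>M. M * S"] by (simp add: assoc)
  then have F: "adj (T * S) = T * S"
    by (metis Sc Tc adj_adj adj_carrier adj_mult mult_closed)
  show thesis
  proof
    show "S \<in> commutant" using r T by (simp add: S_def)
    show "T * S * T = T" "S * T * S = S" by fact+
    show "adj (S * T) = S * T" "adj (T * S) = T * S" using E F by (simp_all add: ST)
  qed
qed

text \<open>When \<open>P x\<close> and \<open>Q x\<close> have the same trace for all \<open>x \<in> X\<close>, the relation
  \<open>\<Sum> c\<^sub>x P x \<mapsto> \<Sum> c\<^sub>x Q x\<close> is isometric for the Frobenius inner product, hence well defined.\<close>

inductive_set pair_span :: "complex mat \<Rightarrow> complex mat \<Rightarrow> (complex mat \<times> complex mat) set" for P Q where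
  base: "x \<in> X \<Longrightarrow> (P * x, Q * x) \<in> pair_span P Q"
| lin: "(a, b) \<in> pair_span P Q \<Longrightarrow> (a', b') \<in> pair_span P Q \<Longrightarrow>
    (a + c \<cdot>\<^sub>m a', b + c \<cdot>\<^sub>m b') \<in> pair_span P Q"

section \<open>Projections with equal characters\<close>

definition projection :: "complex mat \<Rightarrow> bool" where
  "projection P \<longleftrightarrow> P \<in> commutant \<and> adj P = P \<and> P * P = P"

lemma projectionD [simp]:
  "projection P \<Longrightarrow> P \<in> commutant" "projection P \<Longrightarrow> adj P = P" "projection P \<Longrightarrow> P * P = P"
  by (auto simp: projection_def)

text \<open>\<open>P\<close> moves past \<open>x * adj y\<close>, which lies in \<open>X\<close>,
  and is idempotent. So inner products of elements \<open>P * x\<close> are values of the character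
  of \<open>P\<close>, and equal characters give equal inner products.\<close>

lemma projection_frob:
  assumes P: "projection P" and x: "x \<in> X" and y: "y \<in> X"
  shows "frob (P * x) (P * y) = mtrace (P * (x * adj y))"
proof -
  note c = X_carrier[OF x] X_carrier[OF y]
  have "frob (P * x) (P * y) = mtrace (P * (x * adj y * P))"
    using P c by (simp add: frob_def adj_mult[of _ n n _ n] assoc)
  also have "x * adj y * P = P * (x * adj y)"
    using commutant_commutes[OF projectionD(1)[OF P] X_mult[OF x X_adj[OF y]]] by simp
  also have "P * (P * (x * adj y)) = P * (x * adj y)"
    using P c by (simp add: assoc[symmetric])
  finally show ?thesis .
qed

context
  fixes P Q assumes P: "projection P" and Q: "projection Q"
    and tr: "\<And>x. x \<in> X \<Longrightarrow> mtrace (P * x) = mtrace (Q * x)"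
begin

lemma pair_span_carrier:
  assumes "(a, b) \<in> pair_span P Q"
  shows "a \<in> carrier_mat n n \<and> b \<in> carrier_mat n n \<and> P * a = a \<and> Q * b = b"
  using assms
proof induction
  case (base x)
  then show ?case using P Q X_carrier[OF base] by (simp add: assoc[symmetric])
next
  case (lin a b a' b' c)
  then show ?case using P Q by (auto simp: distribs mult_smult_distrib[of _ n n _ n])
qed

lemma pair_span_frob:
  assumes "(a, b) \<in> pair_span P Q" "(a', b') \<in> pair_span P Q"
  shows "frob a a' = frob b b'"
  using assms(2)
proof induction
  case (base y)
  note y = base
  have c: "P * y \<in> carrier_mat n n" "Q * y \<in> carrier_mat n n" using P Q X_carrier[OF y] by auto
  from assms(1) show ?case
  proof induction
    case (base x)
    then show ?case
      using projection_frob[OF P base y] projection_frob[OF Q base y] tr[OF X_mult[OF base X_adj[OF y]]] by simp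
  next
    case (lin a b a' b' k)
    then show ?case
      using pair_span_carrier[OF lin(1)] pair_span_carrier[OF lin(2)] c by (simp add: frob_lin[of _ n])
  qed
next
  case (lin a' b' a'' b'' k)
  then show ?case
    using pair_span_carrier[OF lin(1)] pair_span_carrier[OF lin(2)] pair_span_carrier[OF assms(1)]
    by (simp add: frob_lin[of _ n])
qed

text \<open>Left multiplication by \<open>X\<close> acts on both components at once because
  \<open>P\<close> and \<open>Q\<close> commute with \<open>X\<close>; relative to a basis of pairs
  it has the same matrix on both sides.\<close>

lemma pair_span_mult:
  assumes x: "x \<in> X" and "(a, b) \<in> pair_span P Q"
  shows "(x * a, x * b) \<in> pair_span P Q"
  using assms(2)
proof induction
  case (base y)
  note c = X_carrier[OF x] X_carrier[OF base]
  have "x * (P * y) = P * (x * y)" "x * (Q * y) = Q * (x * y)"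
    using P Q c commutant_commutes[OF projectionD(1)[OF P] x] commutant_commutes[OF projectionD(1)[OF Q] x]
    by (simp_all add: assoc[symmetric])
  then show ?case using pair_span.base[OF X_mult[OF x base], of P Q] by simp
next
  case (lin a b a' b' c)
  then show ?case
    using pair_span.lin[OF lin(3,4), of c] X_carrier[OF x] pair_span_carrier[OF lin(1)] pair_span_carrier[OF lin(2)]
    by (simp add: distribs mult_smult_distrib[of _ n n _ n])
qed

text \<open>Gram-Schmidt for an orthogonal system of greatest length. The remainder of the first
  component is orthogonal to the system, so it has norm 0 by maximality; the remainder of the second
  has the same norm by \<open>pair_span_frob\<close>. Hence both components have the coefficients
  computed from the first.\<close>

lemma pair_span_basis:
  obtains k :: nat and v where "\<And>i. i < k \<Longrightarrow> v i \<in> pair_span P Q"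
    "\<And>i. i < k \<Longrightarrow> frob (fst (v i)) (fst (v i)) \<noteq> 0"
    "\<And>a b s t. (a, b) \<in> pair_span P Q \<Longrightarrow> s < n \<Longrightarrow> t < n \<Longrightarrow>
      a $$ (s, t) = (\<Sum>i<k. frob a (fst (v i)) / frob (fst (v i)) (fst (v i)) * fst (v i) $$ (s, t)) \<and>
      b $$ (s, t) = (\<Sum>i<k. frob a (fst (v i)) / frob (fst (v i)) (fst (v i)) * snd (v i) $$ (s, t))"
    "\<And>i j. i < k \<Longrightarrow> j < k \<Longrightarrow> i \<noteq> j \<Longrightarrow> frob (fst (v i)) (fst (v j)) = 0"
proof -
  define good where "good k v \<longleftrightarrow> (\<forall>i<k. v i \<in> pair_span P Q \<and> frob (fst (v i)) (fst (v i)) \<noteq> 0) \<and>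
    (\<forall>i<k. \<forall>j<k. i \<noteq> j \<longrightarrow> frob (fst (v i)) (fst (v j)) = 0)" for k and v :: "nat \<Rightarrow> complex mat \<times> complex mat"
  have "k \<le> n * n" if "good k v" for k v
  proof (rule frob_orthogonal_bound[of k "\<lambda>i. fst (v i)"])
    fix i assume "i < k"
    then have "(fst (v i), snd (v i)) \<in> pair_span P Q" using that by (simp add: good_def)
    from pair_span_carrier[OF this] show "fst (v i) \<in> carrier_mat n n" by simp
  qed (use that in \<open>simp_all add: good_def\<close>)
  moreover have "good 0 v" for v by (simp add: good_def)
  ultimately obtain k where k: "\<exists>v. good k v" and max: "\<And>k'. \<exists>v. good k' v \<Longrightarrow> k' \<le> k"
    using Nat.ex_has_greatest_nat[of "\<lambda>k. \<exists>v. good k v" 0 "n * n"] by blast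
  from k obtain v where v: "good k v" ..
  let ?a = "\<lambda>i. fst (v i)" and ?b = "\<lambda>i. snd (v i)"
  have vD: "(?a i, ?b i) \<in> pair_span P Q" "frob (?a i) (?a i) \<noteq> 0" if "i < k" for i
    using v that by (auto simp: good_def)
  have orth: "frob (?a i) (?a j) = 0" if "i < k" "j < k" "i \<noteq> j" for i j
    using v that by (auto simp: good_def)
  have expand: "a $$ (s, t) = (\<Sum>i<k. frob a (?a i) / frob (?a i) (?a i) * ?a i $$ (s, t)) \<and>
      b $$ (s, t) = (\<Sum>i<k. frob a (?a i) / frob (?a i) (?a i) * ?b i $$ (s, t))"
    if ab: "(a, b) \<in> pair_span P Q" and st: "s < n" "t < n" for a b s t
  proof -
    define c where "c i = frob a (?a i) / frob (?a i) (?a i)" for i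
    \<comment> \<open>After \<open>m\<close> Gram-Schmidt steps the inner products with the first
      \<open>m\<close> basis elements are 0 and the others are unchanged.\<close>
    have "\<exists>a' b'. (a', b') \<in> pair_span P Q \<and>
      (\<forall>s<n. \<forall>t<n. a' $$ (s, t) = a $$ (s, t) - (\<Sum>i<m. c i * ?a i $$ (s, t))) \<and>
      (\<forall>s<n. \<forall>t<n. b' $$ (s, t) = b $$ (s, t) - (\<Sum>i<m. c i * ?b i $$ (s, t))) \<and>
      (\<forall>j<k. frob a' (?a j) = (if j < m then 0 else frob a (?a j)))" if "m \<le> k" for m
      using that
    proof (induction m)
      case 0
      then show ?case using ab by (intro exI[of _ a] exI[of _ b]) auto
    next
      case (Suc m)
      then obtain a' b' where IH: "(a', b') \<in> pair_span P Q"
        "\<forall>s<n. \<forall>t<n. a' $$ (s, t) = a $$ (s, t) - (\<Sum>i<m. c i * ?a i $$ (s, t))"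
        "\<forall>s<n. \<forall>t<n. b' $$ (s, t) = b $$ (s, t) - (\<Sum>i<m. c i * ?b i $$ (s, t))"
        "\<forall>j<k. frob a' (?a j) = (if j < m then 0 else frob a (?a j))" by auto
      have m: "m < k" using Suc by simp
      note car = pair_span_carrier[OF IH(1)] pair_span_carrier[OF vD(1)[OF m]]
      have "frob (a' + (- c m) \<cdot>\<^sub>m ?a m) (?a j) = (if j < Suc m then 0 else frob a (?a j))" if "j < k" for j
        using IH(4) that m car pair_span_carrier[OF vD(1)[OF that]] vD(2)[OF m] orth[OF m that]
        by (auto simp: frob_lin[of _ n] c_def less_Suc_eq)
      then show ?case
        using IH(2,3) car
        by (intro exI[of _ "a' + (- c m) \<cdot>\<^sub>m ?a m"] exI[of _ "b' + (- c m) \<cdot>\<^sub>m ?b m"])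
          (auto intro!: pair_span.lin IH(1) vD(1)[OF m])
    qed
    from this[OF order_refl] obtain a' b' where res: "(a', b') \<in> pair_span P Q"
      "\<forall>s<n. \<forall>t<n. a' $$ (s, t) = a $$ (s, t) - (\<Sum>i<k. c i * ?a i $$ (s, t))"
      "\<forall>s<n. \<forall>t<n. b' $$ (s, t) = b $$ (s, t) - (\<Sum>i<k. c i * ?b i $$ (s, t))"
      "\<forall>j<k. frob a' (?a j) = 0" by auto
    note car = pair_span_carrier[OF res(1)]
    have a'0: "frob a' a' = 0"
    proof (rule ccontr)
      assume "frob a' a' \<noteq> 0"
      moreover have "frob (?a j) a' = 0" if "j < k" for j
        using frob_cnj[of a' n "?a j"] car pair_span_carrier[OF vD(1)[OF that]] res(4) that by simp
      ultimately have "good (Suc k) (v(k := (a', b')))"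
        using vD orth res by (auto simp: good_def less_Suc_eq)
      then show False using max[of "Suc k"] by auto
    qed
    moreover have "frob b' b' = 0" using pair_span_frob[OF res(1) res(1)] a'0 by simp
    ultimately have "a' = 0\<^sub>m n n" "b' = 0\<^sub>m n n" using car frob_eq_0_iff by auto
    then show ?thesis using res(2,3) st by (simp add: c_def)
  qed
  show thesis
  proof (rule that[of k v])
    show "v i \<in> pair_span P Q" if "i < k" for i using vD(1)[OF that] by simp
  qed (fact vD(2) expand orth)+
qed

text \<open>For an orthogonal basis \<open>(a\<^sub>i, b\<^sub>i)\<close> of the span, the Casimir-type sum
  \<open>\<Sum> b\<^sub>i M a\<^sub>i\<^sup>* / \<langle>a\<^sub>i, a\<^sub>i\<rangle>\<close> commutes with \<open>X\<close> for every matrix \<open>M\<close>; here \<open>M\<close> is a matrix unit.\<close>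

lemma exists_intertwiner:
  assumes "P \<noteq> 0\<^sub>m n n"
  shows "\<exists>T\<in>commutant. T \<noteq> 0\<^sub>m n n \<and> Q * T = T \<and> T * P = T"
proof -
  obtain k :: nat and v where vs: "\<And>i. i < k \<Longrightarrow> v i \<in> pair_span P Q"
    and d0: "\<And>i. i < k \<Longrightarrow> frob (fst (v i)) (fst (v i)) \<noteq> 0"
    and ex: "\<And>a b s t. (a, b) \<in> pair_span P Q \<Longrightarrow> s < n \<Longrightarrow> t < n \<Longrightarrow>
      a $$ (s, t) = (\<Sum>i<k. frob a (fst (v i)) / frob (fst (v i)) (fst (v i)) * fst (v i) $$ (s, t)) \<and>
      b $$ (s, t) = (\<Sum>i<k. frob a (fst (v i)) / frob (fst (v i)) (fst (v i)) * snd (v i) $$ (s, t))"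
    and orth: "\<And>i j. i < k \<Longrightarrow> j < k \<Longrightarrow> i \<noteq> j \<Longrightarrow> frob (fst (v i)) (fst (v j)) = 0"
  proof (rule pair_span_basis, goal_cases)
    case (1 k v)
    show ?case by (rule 1(1)[of k v, OF 1(2,3,4,5)])
  qed
  define a where "a i = fst (v i)" for i
  define b where "b i = snd (v i)" for i
  define d where "d i = frob (a i) (a i)" for i
  have ab: "(a i, b i) \<in> pair_span P Q" if "i < k" for i using vs[OF that] by (simp add: a_def b_def)
  note car = pair_span_carrier[OF ab]
  have acar [simp]: "a i \<in> carrier_mat n n" "b i \<in> carrier_mat n n" if "i < k" for i using car that by auto
  have d: "d i \<noteq> 0" "cnj (d i) = d i" if "i < k" for i
    using d0[OF that] frob_cnj[of "a i" n "a i"] car[OF that] by (simp_all add: d_def a_def)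
  have exa: "A $$ (s, t) = (\<Sum>i<k. frob A (a i) / d i * a i $$ (s, t))"
    and exb: "B $$ (s, t) = (\<Sum>i<k. frob A (a i) / d i * b i $$ (s, t))"
    if "(A, B) \<in> pair_span P Q" "s < n" "t < n" for A B s t
    using ex[OF that] by (simp_all add: a_def b_def d_def)
  \<comment> \<open>Entry \<open>(s, u)\<close> of the sum of the
    \<open>b i * M * adj (a i) / d i\<close>, where \<open>M\<close> is the matrix unit with its 1
    at \<open>(q, r)\<close>.\<close>
  define T where "T q r = mat n n (\<lambda>(s, u). \<Sum>i<k. b i $$ (s, q) * cnj (a i $$ (u, r)) / d i)" for q r
  have Tc [simp]: "T q r \<in> carrier_mat n n" for q r by (simp add: T_def)
  have Ti: "T q r $$ (s, u) = (\<Sum>i<k. b i $$ (s, q) * cnj (a i $$ (u, r)) / d i)" if "s < n" "u < n" for q r s u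
    using that by (simp add: T_def)
  have left: "(M * T q r) $$ (s, u) = (\<Sum>i<k. (M * b i) $$ (s, q) * cnj (a i $$ (u, r)) / d i)"
    if "M \<in> carrier_mat n n" "s < n" "u < n" "q < n" for M q r s u
  proof -
    have "(M * T q r) $$ (s, u) = (\<Sum>l<n. M $$ (s, l) * (\<Sum>i<k. b i $$ (l, q) * cnj (a i $$ (u, r)) / d i))"
      using that by (simp add: mat_mult_index[of _ n n _ n] Ti atLeast0LessThan del: index_mult_mat(1))
    also have "\<dots> = (\<Sum>i<k. (\<Sum>l<n. M $$ (s, l) * b i $$ (l, q)) * cnj (a i $$ (u, r)) / d i)"
      unfolding sum_distrib_left sum_distrib_right sum_divide_distrib
      by (subst sum.swap) (simp add: mult_ac)
    also have "\<dots> = (\<Sum>i<k. (M * b i) $$ (s, q) * cnj (a i $$ (u, r)) / d i)"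
      using that by (intro sum.cong) (simp_all add: mat_mult_index[of _ n n _ n] atLeast0LessThan del: index_mult_mat(1))
    finally show ?thesis .
  qed
  have right: "(T q r * M) $$ (s, u) = (\<Sum>i<k. b i $$ (s, q) * cnj ((adj M * a i) $$ (u, r)) / d i)"
    if "M \<in> carrier_mat n n" "s < n" "u < n" "r < n" for M q r s u
  proof -
    have "(T q r * M) $$ (s, u) = (\<Sum>l<n. (\<Sum>i<k. b i $$ (s, q) * cnj (a i $$ (l, r)) / d i) * M $$ (l, u))"
      using that by (simp add: mat_mult_index[of _ n n _ n] Ti atLeast0LessThan del: index_mult_mat(1))
    also have "\<dots> = (\<Sum>i<k. b i $$ (s, q) * cnj (\<Sum>l<n. cnj (M $$ (l, u)) * a i $$ (l, r)) / d i)"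
      unfolding sum_distrib_left sum_distrib_right sum_divide_distrib cnj_sum
      by (subst sum.swap) (simp add: mult_ac)
    also have "\<dots> = (\<Sum>i<k. b i $$ (s, q) * cnj ((adj M * a i) $$ (u, r)) / d i)"
      using that by (intro sum.cong) (simp_all add: mat_mult_index[of _ n n _ n] atLeast0LessThan del: index_mult_mat(1))
    finally show ?thesis .
  qed
  have comm: "T q r \<in> commutant" if q: "q < n" and r: "r < n" for q r
  proof (rule commutantI)
    fix x assume x: "x \<in> X"
    note xc = X_carrier[OF x]
    show "T q r * x = x * T q r"
    proof (rule square_mat_eqI[of _ n])
      fix s u assume s: "s < n" and u: "u < n"
      \<comment> \<open>\<open>e1\<close> and \<open>e2\<close> express left multiplication by
        \<open>x\<close> on the \<open>b i\<close> and by \<open>adj x\<close> on the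
        \<open>a j\<close> through the same numbers \<open>frob (x * a i) (a j)\<close>; the second
        uses that multiplication by \<open>adj x\<close> is adjoint to multiplication by
        \<open>x\<close>.\<close>
      have e1: "(x * b i) $$ (s, q) = (\<Sum>j<k. frob (x * a i) (a j) / d j * b j $$ (s, q))" if "i < k" for i
        using exb[OF pair_span_mult[OF x ab[OF that]] s q] .
      have e2: "cnj ((adj x * a j) $$ (u, r)) = (\<Sum>i<k. frob (x * a i) (a j) / d i * cnj (a i $$ (u, r)))" if "j < k" for j
      proof -
        have "cnj (frob (adj x * a j) (a i)) = frob (x * a i) (a j)" if "i < k" for i
        proof -
          have "cnj (frob (adj x * a j) (a i)) = frob (a i) (adj x * a j)"
            using frob_cnj[of "adj x * a j" n "a i"] \<open>i < k\<close> \<open>j < k\<close> xc by simp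
          also have "\<dots> = mtrace (a i * (adj (a j) * x))"
            using \<open>i < k\<close> \<open>j < k\<close> xc by (simp add: frob_def adj_mult[of _ n n _ n])
          also have "\<dots> = mtrace (a i * adj (a j) * x)"
            using \<open>i < k\<close> \<open>j < k\<close> xc by (simp add: assoc)
          also have "\<dots> = mtrace (x * (a i * adj (a j)))"
            using \<open>i < k\<close> \<open>j < k\<close> xc by (intro mtrace_mult_comm[of _ n n]) auto
          also have "\<dots> = frob (x * a i) (a j)"
            using \<open>i < k\<close> \<open>j < k\<close> xc by (simp add: frob_def assoc)
          finally show ?thesis .
        qed
        then show ?thesis
          unfolding exa[OF pair_span_mult[OF X_adj[OF x] ab[OF that]] u r] cnj_sum
          by (intro sum.cong) (auto simp: d)
      qed
      have "(T q r * x) $$ (s, u) = (\<Sum>j<k. b j $$ (s, q) * (\<Sum>i<k. frob (x * a i) (a j) / d i * cnj (a i $$ (u, r))) / d j)"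
        unfolding right[OF xc s u r] by (intro sum.cong) (simp_all add: e2)
      also have "\<dots> = (\<Sum>i<k. (\<Sum>j<k. frob (x * a i) (a j) / d j * b j $$ (s, q)) * cnj (a i $$ (u, r)) / d i)"
        unfolding sum_distrib_left sum_distrib_right sum_divide_distrib
        by (subst sum.swap) (simp add: mult_ac)
      also have "\<dots> = (x * T q r) $$ (s, u)"
        unfolding left[OF xc s u q] by (intro sum.cong) (simp_all add: e1)
      finally show "(T q r * x) $$ (s, u) = (x * T q r) $$ (s, u)" .
    qed (use xc in auto)
  qed simp
  have QT: "Q * T q r = T q r" if "q < n" for q r
  proof (rule square_mat_eqI[of _ n])
    fix s u assume "s < n" "u < n"
    then show "(Q * T q r) $$ (s, u) = T q r $$ (s, u)"
      using left[of Q s u q r] that Q car by (simp add: Ti del: index_mult_mat(1))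
  qed (use Q in auto)
  have TP: "T q r * P = T q r" if "r < n" for q r
  proof (rule square_mat_eqI[of _ n])
    fix s u assume "s < n" "u < n"
    then show "(T q r * P) $$ (s, u) = T q r $$ (s, u)"
      using right[of P s u r q] that P car by (simp add: Ti del: index_mult_mat(1))
  qed (use P in auto)
  \<comment> \<open>If every \<open>T q r\<close> were 0, pairing with the entries of
    \<open>a 0\<close> would recover \<open>b 0\<close> by orthogonality, so \<open>b 0 = 0\<close>;
    but it has the same nonzero norm as \<open>a 0\<close>.\<close>
  have "\<exists>q<n. \<exists>r<n. T q r \<noteq> 0\<^sub>m n n"
  proof (rule ccontr)
    assume "\<not> ?thesis"
    then have T0: "T q r = 0\<^sub>m n n" if "q < n" "r < n" for q r using that by blast
    \<comment> \<open>The identity lies in \<open>X\<close>, so \<open>(P, Q)\<close> is in the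
      span; with an empty basis \<open>P\<close> would be 0.\<close>
    have "k \<noteq> 0"
    proof
      assume "k = 0"
      have "(P * 1\<^sub>m n, Q * 1\<^sub>m n) \<in> pair_span P Q" by (rule pair_span.base[OF X_one])
      moreover have "P * 1\<^sub>m n = P" "Q * 1\<^sub>m n = Q"
        using P Q by (auto intro!: right_mult_one_mat[of _ n])
      ultimately have "(P, Q) \<in> pair_span P Q" by simp
      then have "P $$ (s, t) = 0" if "s < n" "t < n" for s t
        using exa that \<open>k = 0\<close> by fastforce
      then show False using assms P by (metis commutant_carrier index_zero_mat(1) projectionD(1) square_mat_eqI zero_carrier_mat)
    qed
    have "b 0 $$ (s, q) = 0" if s: "s < n" and q: "q < n" for s q
    proof -
      have "0 = (\<Sum>u<n. \<Sum>r<n. a 0 $$ (u, r) * T q r $$ (s, u))" using T0 q s by simp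
      also have "\<dots> = (\<Sum>u<n. \<Sum>r<n. \<Sum>i<k. b i $$ (s, q) * (a 0 $$ (u, r) * cnj (a i $$ (u, r))) / d i)"
        using s by (intro sum.cong refl) (simp add: Ti sum_distrib_left mult_ac)
      also have "\<dots> = (\<Sum>i<k. b i $$ (s, q) * frob (a 0) (a i) / d i)"
        using \<open>k \<noteq> 0\<close> unfolding sum.swap[of _ "{..<k}" "{..<n}"]
        by (intro sum.cong refl) (simp add: frob_sum[of _ n] sum_distrib_left sum_divide_distrib)
      also have "\<dots> = (\<Sum>i<k. if i = 0 then b 0 $$ (s, q) else 0)"
        using orth[of 0] d \<open>k \<noteq> 0\<close> by (intro sum.cong refl) (auto simp: a_def d_def)
      also have "\<dots> = b 0 $$ (s, q)" using \<open>k \<noteq> 0\<close> by simp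
      finally show ?thesis by simp
    qed
    then have "frob (b 0) (b 0) = 0" using \<open>k \<noteq> 0\<close> by (simp add: frob_sum[of _ n])
    then show False
      using pair_span_frob[OF ab ab, of 0 0] d[of 0] \<open>k \<noteq> 0\<close> by (simp add: d_def)
  qed
  then show ?thesis using comm QT TP by blast
qed

end

lemma zero_mult [simp]: "A \<in> carrier_mat n n \<Longrightarrow> 0\<^sub>m n n * A = 0\<^sub>m n n"
  "A \<in> carrier_mat n n \<Longrightarrow> A * 0\<^sub>m n n = 0\<^sub>m n n"
  by auto

text \<open>Among mutually inverse intertwiners \<open>T\<close>, \<open>S\<close> between a part E
  = \<open>S * T\<close> of \<open>P\<close> and a part F = \<open>T * S\<close> of
  \<open>Q\<close>, a maximal pair is taken. By cyclicity E and F have equal characters, hence so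
  have the remainders \<open>P - E\<close> and \<open>Q - F\<close>. If \<open>P - E\<close> were
  nonzero there would be a further intertwiner, and adding it to \<open>T\<close> would contradict
  maximality.\<close>

lemma projections_equivalent:
  assumes P: "projection P" and Q: "projection Q"
    and tr: "\<And>x. x \<in> X \<Longrightarrow> mtrace (P * x) = mtrace (Q * x)"
  obtains T S where "T \<in> commutant" "S \<in> commutant" "S * T = P" "T * S = Q"
proof -
  define inverses where "inverses T S \<longleftrightarrow> T \<in> commutant \<and> S \<in> commutant \<and>
    T * S * T = T \<and> S * T * S = S \<and> adj (S * T) = S * T \<and> adj (T * S) = T * S \<and>
    Q * T = T \<and> T * P = T \<and> P * S = S \<and> S * Q = S" for T S
  \<comment> \<open>Size is measured by the length \<open>k\<close> of an orthogonal system of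
    nonzero matrices fixed under left multiplication by \<open>S * T\<close>, for which a bound is
    available.\<close>
  define good where "good k \<longleftrightarrow> (\<exists>T S v. inverses T S \<and>
    (\<forall>i<k. v i \<in> carrier_mat n n \<and> frob (v i) (v i) \<noteq> 0 \<and> S * T * v i = v i) \<and>
    (\<forall>i<k. \<forall>j<k. i \<noteq> j \<longrightarrow> frob (v i) (v j) = 0))" for k :: nat
  have "k \<le> n * n" if "good k" for k
  proof -
    from that obtain v where "\<forall>i<k. v i \<in> carrier_mat n n \<and> frob (v i) (v i) \<noteq> 0"
      "\<forall>i<k. \<forall>j<k. i \<noteq> j \<longrightarrow> frob (v i) (v j) = 0" unfolding good_def by blast
    then show ?thesis by (intro frob_orthogonal_bound[of k v n]) auto
  qed
  moreover have "good 0"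
    unfolding good_def
    by (rule exI[of _ "0\<^sub>m n n"], rule exI[of _ "0\<^sub>m n n"])
      (use projectionD(1)[OF P, THEN commutant_carrier] projectionD(1)[OF Q, THEN commutant_carrier] in
        \<open>simp add: inverses_def\<close>)
  ultimately obtain k where k: "good k" and max: "\<And>k'. good k' \<Longrightarrow> k' \<le> k"
    using Nat.ex_has_greatest_nat[of good 0 "n * n"] by blast
  then obtain T S v where inv: "inverses T S"
    and v: "\<And>i. i < k \<Longrightarrow> v i \<in> carrier_mat n n" "\<And>i. i < k \<Longrightarrow> frob (v i) (v i) \<noteq> 0"
      "\<And>i. i < k \<Longrightarrow> S * T * v i = v i" "\<And>i j. i < k \<Longrightarrow> j < k \<Longrightarrow> i \<noteq> j \<Longrightarrow> frob (v i) (v j) = 0"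
    unfolding good_def by blast
  have TS: "T \<in> commutant" "S \<in> commutant" "T * S * T = T" "S * T * S = S"
    "adj (S * T) = S * T" "adj (T * S) = T * S" "Q * T = T" "T * P = T" "P * S = S" "S * Q = S"
    using inv by (auto simp: inverses_def)
  have c [simp]: "P \<in> carrier_mat n n" "Q \<in> carrier_mat n n" "T \<in> carrier_mat n n" "S \<in> carrier_mat n n"
    using P Q TS by auto
  define E where "E = S * T"
  define F where "F = T * S"
  have EF [simp]: "E \<in> carrier_mat n n" "F \<in> carrier_mat n n" by (simp_all add: E_def F_def)
  have EE: "E * E = E" "F * F = F" using TS(3,4) by (simp_all add: E_def F_def assoc)
  have EP: "E * P = E" "P * E = E" "F * Q = F" "Q * F = F"
    using TS(7-10) by (simp_all add: E_def F_def assoc) (simp_all add: assoc[symmetric])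
  have sub: "A - B - (B - B) = A - B" if "A \<in> carrier_mat n n" "B \<in> carrier_mat n n" for A B :: "complex mat"
    using that by (intro eq_matI) auto
  have PE: "projection (P - E)"
    unfolding projection_def
    using P TS EE EP by (auto simp: distribs adj_minus[of _ n n] sub minus_carrier_mat E_def intro!: commutant_lin)
  have QF: "projection (Q - F)"
    unfolding projection_def
    using Q TS EE EP by (auto simp: distribs adj_minus[of _ n n] sub minus_carrier_mat F_def intro!: commutant_lin)
  have trE: "mtrace (E * x) = mtrace (F * x)" if x: "x \<in> X" for x
  proof -
    have "mtrace (E * x) = mtrace (S * (x * T))"
      using commutant_commutes[OF TS(1) x] X_carrier[OF x] by (simp add: E_def assoc)
    also have "\<dots> = mtrace (x * T * S)" by (rule mtrace_mult_comm[of _ n n]) (use X_carrier[OF x] in auto)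
    also have "x * T * S = F * x"
      using commutant_commutes[of F x] TS x X_carrier[OF x] by (simp add: F_def assoc)
    finally show ?thesis .
  qed
  have tr': "mtrace ((P - E) * x) = mtrace ((Q - F) * x)" if x: "x \<in> X" for x
    using tr[OF x] trE[OF x] X_carrier[OF x] by (simp add: distribs mtrace_minus[of _ n])
  have PE0: "P - E = 0\<^sub>m n n"
  proof (rule ccontr)
    assume "P - E \<noteq> 0\<^sub>m n n"
    from exists_intertwiner[OF PE QF tr' this] obtain T' where T': "T' \<in> commutant" "T' \<noteq> 0\<^sub>m n n"
      "(Q - F) * T' = T'" "T' * (P - E) = T'" by blast
    obtain S' where S': "S' \<in> commutant" "T' * S' * T' = T'" "S' * T' * S' = S'"
      "adj (S' * T') = S' * T'" "adj (T' * S') = T' * S'" by (rule moore_penrose[OF T'(1)])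
    have c' [simp]: "T' \<in> carrier_mat n n" "S' \<in> carrier_mat n n" using T' S' by auto
    have PEc [simp]: "P - E \<in> carrier_mat n n" "Q - F \<in> carrier_mat n n" by (simp_all add: minus_carrier_mat)
    have "adj (T' * (P - E)) = adj T'" using T'(4) by simp
    then have "(P - E) * adj T' = adj T'" using projectionD(2)[OF PE] by (simp add: adj_mult[of _ n n _ n])
    moreover have "S' * T' = adj T' * adj S'" using S'(4) by (simp add: adj_mult[of _ n n _ n])
    ultimately have "(P - E) * (S' * T') = S' * T'" by (simp add: assoc[symmetric])
    then have "(P - E) * (S' * T' * S') = S' * T' * S'" by (simp add: assoc[symmetric])
    then have PS': "(P - E) * S' = S'" by (simp add: S'(3))
    have "adj ((Q - F) * T') = adj T'" using T'(3) by simp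
    then have "adj T' * (Q - F) = adj T'" using projectionD(2)[OF QF] by (simp add: adj_mult[of _ n n _ n])
    moreover have "T' * S' = adj S' * adj T'" using S'(5) by (simp add: adj_mult[of _ n n _ n])
    ultimately have "(T' * S') * (Q - F) = T' * S'" by (simp add: assoc)
    then have "(S' * T' * S') * (Q - F) = S' * T' * S'" by (simp add: assoc)
    then have SQ': "S' * (Q - F) = S'" by (simp add: S'(3))
    have zz: "A - A = 0\<^sub>m n n" if "A \<in> carrier_mat n n" for A :: "complex mat"
      using that by auto
    \<comment> \<open>The old pair annihilates the remainders \<open>P - E\<close> and
      \<open>Q - F\<close>, between which the new pair acts. Hence all mixed products vanish and the
      sums form a pair of the required kind.\<close>
    have z: "S * (Q - F) = 0\<^sub>m n n" "(P - E) * S = 0\<^sub>m n n" "T * (P - E) = 0\<^sub>m n n" "(Q - F) * T = 0\<^sub>m n n"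
      using TS(3,4,7-10) by (simp_all add: distribs E_def F_def assoc zz)
    have zP: "P * (P - E) = P - E" "(P - E) * P = P - E" "Q * (Q - F) = Q - F" "(Q - F) * Q = Q - F"
      using P Q EP by (simp_all add: distribs)
    have ST': "S * T' = 0\<^sub>m n n"
      using assoc[of S "Q - F" T'] z(1) T'(3) by simp
    have S'T: "S' * T = 0\<^sub>m n n"
      using assoc[of S' "Q - F" T] z(4) SQ' by simp
    have TS': "T * S' = 0\<^sub>m n n"
      using assoc[of T "P - E" S'] z(3) PS' by simp
    have T'S: "T' * S = 0\<^sub>m n n"
      using assoc[of T' "P - E" S] z(2) T'(4) by simp
    have QT': "Q * T' = T'" using assoc[of Q "Q - F" T'] zP(3) T'(3) by simp
    have T'P: "T' * P = T'" using assoc[of T' "P - E" P] zP(2) T'(4) by simp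
    have PS2: "P * S' = S'" using assoc[of P "P - E" S'] zP(1) PS' by simp
    have SQ2: "S' * Q = S'" using assoc[of S' "Q - F" Q] zP(4) SQ' by simp
    have ST2: "(S + S') * (T + T') = S * T + S' * T'" "(T + T') * (S + S') = T * S + T' * S'"
      by (simp_all add: distribs ST' S'T TS' T'S)
    \<comment> \<open>The additional member of the system: nonzero, fixed by the enlarged product,
      and orthogonal to each \<open>v i\<close>, because \<open>S * T\<close> fixes
      \<open>v i\<close> and annihilates \<open>V\<close>.\<close>
    define V where "V = S' * T'"
    have Vc [simp]: "V \<in> carrier_mat n n" by (simp add: V_def)
    have VV: "V * V = V" using S'(3) by (simp add: V_def assoc[symmetric])
    have EV: "S * T * V = 0\<^sub>m n n"
    proof -
      have "S * T * V = S * (T * S' * T')" by (simp add: V_def assoc)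
      then show ?thesis by (simp add: TS')
    qed
    have VE: "V * (S * T) = 0\<^sub>m n n"
    proof -
      have "V * (S * T) = S' * (T' * S * T)" by (simp add: V_def assoc)
      then show ?thesis by (simp add: T'S)
    qed
    have V0: "V \<noteq> 0\<^sub>m n n"
    proof
      assume "V = 0\<^sub>m n n"
      then have "T' * (S' * T') = 0\<^sub>m n n" using zero_mult(2)[of T'] by (simp only: V_def c')
      then show False using S'(2) T'(2) by (simp add: assoc)
    qed
    have inv': "inverses (T + T') (S + S')"
      unfolding inverses_def ST2
    proof (intro conjI)
      have "(T * S + T' * S') * (T + T') = T * S * T + T' * (S' * T) + (T * (S * T') + T' * S' * T')"
        by (simp add: distribs assoc)
      then show "(T * S + T' * S') * (T + T') = T + T'" using TS(3) S'(2) by (simp add: ST' S'T)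
      have "(S * T + S' * T') * (S + S') = S * T * S + S' * (T' * S) + (S * (T * S') + S' * T' * S')"
        by (simp add: distribs assoc)
      then show "(S * T + S' * T') * (S + S') = S + S'" using TS(4) S'(3) by (simp add: TS' T'S)
    qed (use TS T' S' QT' T'P PS2 SQ2 in \<open>auto simp: distribs adj_add[of _ n n] intro!: commutant_lin\<close>)
    have vV: "frob V (v i) = 0" if i: "i < k" for i
    proof -
      have "V * adj (v i) = V * adj (S * T * v i)" using v(3)[OF i] by simp
      also have "\<dots> = V * (adj (v i) * (S * T))"
        using v(1)[OF i] TS(5) by (simp add: adj_mult[of "S * T" n n "v i" n])
      finally have "frob V (v i) = mtrace (V * (adj (v i) * (S * T)))" by (simp add: frob_def)
      also have "\<dots> = mtrace (V * adj (v i) * (S * T))" using v(1)[OF i] by (simp add: assoc)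
      also have "\<dots> = mtrace (S * T * (V * adj (v i)))" by (rule mtrace_mult_comm[of _ n n]) (use v(1)[OF i] in auto)
      also have "S * T * (V * adj (v i)) = (S * T * V) * adj (v i)"
        using v(1)[OF i] by (simp add: assoc)
      also have "\<dots> = 0\<^sub>m n n" unfolding EV using v(1)[OF i] by simp
      finally show ?thesis by (simp add: mtrace_def)
    qed
    then have vV': "frob (v i) V = 0" if "i < k" for i
      using frob_cnj[of V n "v i"] v(1)[OF that] that by simp
    have "good (Suc k)"
      unfolding good_def
    proof (intro exI conjI)
      show "inverses (T + T') (S + S')" by (rule inv')
      have V1: "(S * T + S' * T') * V = V" using EV VV by (simp add: distribs V_def[symmetric])
      have "(S * T + S' * T') * v i = v i" if i: "i < k" for i
      proof -
        have "V * v i = V * (S * T * v i)" using v(3)[OF i] by simp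
        also have "\<dots> = V * (S * T) * v i" using v(1)[OF i] by (simp add: assoc)
        also have "\<dots> = 0\<^sub>m n n" unfolding VE using v(1)[OF i] by simp
        finally show ?thesis using v(1,3)[OF i] by (simp add: distribs V_def[symmetric])
      qed
      then show "\<forall>i<Suc k. (v(k := V)) i \<in> carrier_mat n n \<and> frob ((v(k := V)) i) ((v(k := V)) i) \<noteq> 0 \<and>
          (S + S') * (T + T') * (v(k := V)) i = (v(k := V)) i"
        unfolding ST2 using v V1 V0 frob_eq_0_iff[OF Vc] by (auto simp: less_Suc_eq)
      show "\<forall>i<Suc k. \<forall>j<Suc k. i \<noteq> j \<longrightarrow> frob ((v(k := V)) i) ((v(k := V)) j) = 0"
        using v(4) vV vV' by (auto simp: less_Suc_eq)
    qed
    then show False using max by force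
  qed
  have eqI: "A = B" if "A - B = 0\<^sub>m n n" "A \<in> carrier_mat n n" "B \<in> carrier_mat n n" for A B :: "complex mat"
  proof (rule square_mat_eqI[OF that(2,3)])
    fix i j assume "i < n" "j < n"
    then show "A $$ (i, j) = B $$ (i, j)" using arg_cong[OF that(1), of "\<lambda>M. M $$ (i, j)"] that(2,3) by auto
  qed
  \<comment> \<open>The squared norm of a projection is its trace, and \<open>Q - F\<close> and
    \<open>P - E\<close> have the same trace, so \<open>P = E\<close> forces
    \<open>Q = F\<close>.\<close>
  have "mtrace ((Q - F) * 1\<^sub>m n) = mtrace ((P - E) * 1\<^sub>m n)" using tr'[OF X_one] by simp
  also have "\<dots> = 0" unfolding PE0 by (simp add: mtrace_def)
  finally have "mtrace (Q - F) = 0" by (simp add: minus_carrier_mat right_mult_one_mat[of _ n])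
  moreover have "frob (Q - F) (Q - F) = mtrace (Q - F)" using QF by (simp add: frob_def)
  ultimately have "Q - F = 0\<^sub>m n n" using frob_eq_0_iff[of "Q - F" n] by (simp add: minus_carrier_mat)
  then show thesis using that[OF TS(1,2)] eqI[OF PE0] eqI[of Q F] by (simp add: E_def F_def)
qed

end

text \<open>The dimensions appear as equations that the simplifier can discharge, so that it can
  reassociate products of rectangular matrices.\<close>

lemma mult_assoc_dim:
  "dim_col A = dim_row B \<Longrightarrow> dim_col B = dim_row C \<Longrightarrow> A * B * C = A * (B * C)"
  for A B C :: "complex mat"
  by (rule assoc_mult_mat[of A "dim_row A" "dim_row B" B "dim_row C" C "dim_col C"]) auto

lemma mult_one_dim [simp]: "dim_col A = n \<Longrightarrow> A * 1\<^sub>m n = A"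
  for A :: "complex mat"
  using right_mult_one_mat[of A "dim_row A" n] by auto

lemma mtrace_comm_dim:
  "dim_col A = dim_row B \<Longrightarrow> dim_col B = dim_row A \<Longrightarrow> mtrace (A * B) = mtrace (B * A)"
  by (rule mtrace_mult_comm[of _ "dim_row A" "dim_col A"]) auto

subsection \<open>Self-adjoint representations\<close>

interpretation cnj_hom: comm_ring_hom cnj
  by unfold_locales auto

lemma adj_SL4: assumes "g \<in> SL4" shows "adj g \<in> SL4"
proof -
  have g: "g \<in> carrier_mat 4 4" and d: "det g = 1" using assms by (auto simp: SL4_def)
  have "adj g = map_mat cnj (transpose_mat g)" by (rule eq_matI) auto
  then have "det (adj g) = cnj (det (transpose_mat g))" by (simp add: cnj_hom.hom_det)
  also have "\<dots> = 1" using det_transpose[OF g] d by simp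
  finally show ?thesis using g by (auto simp: SL4_def)
qed

text \<open>This depends on the basis, not only on the isomorphism class: the coordinates have to be
  orthonormal for a suitable inner product.\<close>

definition star_rep :: "rep \<Rightarrow> bool" where
  "star_rep U \<longleftrightarrow> (\<forall>g\<in>SL4. act U (adj g) = adj (act U g))"

lemma star_rep_monoid:
  assumes "star_rep U"
  shows "star_monoid (rdim U) (act U ` SL4)"
proof
  show "x \<in> carrier_mat (rdim U) (rdim U)" if "x \<in> act U ` SL4" for x
    using that act_carrier by auto
  show "1\<^sub>m (rdim U) \<in> act U ` SL4"
    using one_in_SL4 act_one[of U] by (metis image_eqI)
  show "x * y \<in> act U ` SL4" if "x \<in> act U ` SL4" "y \<in> act U ` SL4" for x y
  proof -
    from that obtain g h where "g \<in> SL4" "h \<in> SL4" "x = act U g" "y = act U h" by blast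
    then have "x * y = act U (g * h)" "g * h \<in> SL4" using act_mult SL4_mult by simp_all
    then show ?thesis by blast
  qed
  show "adj x \<in> act U ` SL4" if "x \<in> act U ` SL4" for x
  proof -
    from that obtain g where g: "g \<in> SL4" "x = act U g" by blast
    then have "adj x = act U (adj g)" using assms by (simp add: star_rep_def)
    then show ?thesis using adj_SL4[OF g(1)] by blast
  qed
qed

lemma adj_dsum_mat: "adj (dsum_mat A B) = dsum_mat (adj A) (adj B)"
  by (rule eq_matI) (auto simp: dsum_mat_def)

lemma adj_kron_mat: "adj (kron_mat A B) = kron_mat (adj A) (adj B)"
proof (rule eq_matI, goal_cases)
  case (1 i j)
  then have i: "i < dim_col A * dim_col B" and j: "j < dim_row A * dim_row B" by auto
  then show ?case
    using div_less_mult[OF i] mod_less_mult[OF i] div_less_mult[OF j] mod_less_mult[OF j]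
    by (simp add: kron_mat_def)
qed auto

lemma star_rep_simps [simp]:
  "star_rep trivial_rep" "star_rep std_rep" "star_rep zero_rep"
  "star_rep U \<Longrightarrow> star_rep W \<Longrightarrow> star_rep (rep_sum U W)"
  "star_rep U \<Longrightarrow> star_rep W \<Longrightarrow> star_rep (rep_tensor U W)"
  unfolding star_rep_def by (simp_all only: act_simps adj_dsum_mat adj_kron_mat adj_one Ball_def) auto

section \<open>Quotients of self-adjoint representations\<close>

definition covers :: "rep \<Rightarrow> rep \<Rightarrow> bool" where
  "covers U R \<longleftrightarrow> (\<exists>C\<in>carrier_mat (rdim R) (rdim U). \<exists>D\<in>carrier_mat (rdim U) (rdim R).
     C * D = 1\<^sub>m (rdim R) \<and> (\<forall>g\<in>SL4. C * act U g = act R g * C))"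

text \<open>Complete reducibility in the form used here: being an image of a self-adjoint
  representation. In \<open>covers\<close> the map \<open>C\<close> is equivariant while its right
  inverse \<open>D\<close> is merely linear; \<open>covers_projection\<close> makes it
  equivariant.\<close>

definition semisimple :: "rep \<Rightarrow> bool" where
  "semisimple R \<longleftrightarrow> (\<exists>U. star_rep U \<and> covers U R)"

lemma coversI:
  assumes "C \<in> carrier_mat (rdim R) (rdim U)" "D \<in> carrier_mat (rdim U) (rdim R)"
    "C * D = 1\<^sub>m (rdim R)" "\<And>g. g \<in> SL4 \<Longrightarrow> C * act U g = act R g * C"
  shows "covers U R"
  using assms unfolding covers_def by blast

lemma covers_refl: "covers U U"
  by (rule coversI[of "1\<^sub>m (rdim U)" _ _ "1\<^sub>m (rdim U)"]) auto

lemma star_rep_semisimple: "star_rep U \<Longrightarrow> semisimple U"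
  using covers_refl semisimple_def by blast

lemma covers_trans:
  assumes "covers U V" "covers V W"
  shows "covers U W"
proof -
  from assms(1) obtain C D where cD: "C \<in> carrier_mat (rdim V) (rdim U)" "D \<in> carrier_mat (rdim U) (rdim V)"
    and CD: "C * D = 1\<^sub>m (rdim V)" and C: "\<And>g. g \<in> SL4 \<Longrightarrow> C * act U g = act V g * C"
    unfolding covers_def by blast
  from assms(2) obtain C' D' where cD': "C' \<in> carrier_mat (rdim W) (rdim V)" "D' \<in> carrier_mat (rdim V) (rdim W)"
    and CD': "C' * D' = 1\<^sub>m (rdim W)" and C': "\<And>g. g \<in> SL4 \<Longrightarrow> C' * act V g = act W g * C'"
    unfolding covers_def by blast
  note [simp] = carrier_matD[OF cD(1)] carrier_matD[OF cD(2)] carrier_matD[OF cD'(1)] carrier_matD[OF cD'(2)]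
  have "C' * C * (D * D') = C' * (C * D) * D'" by (simp add: mult_assoc_dim)
  then have "C' * C * (D * D') = 1\<^sub>m (rdim W)" by (simp add: CD CD')
  moreover have "C' * C * act U g = act W g * (C' * C)" if g: "g \<in> SL4" for g
  proof -
    have "C' * C * act U g = C' * act V g * C" using g C[OF g] by (simp add: mult_assoc_dim)
    then show ?thesis using g C'[OF g] by (simp add: mult_assoc_dim)
  qed
  ultimately show ?thesis
    by (intro coversI[of "C' * C" _ _ "D * D'"]) auto
qed

lemma semisimple_covers: "semisimple U \<Longrightarrow> covers U R \<Longrightarrow> semisimple R"
  using covers_trans semisimple_def by blast

lemma covers_sum_tensor:
  assumes "covers U U'" "covers W W'"
  shows "covers (rep_sum U W) (rep_sum U' W')" "covers (rep_tensor U W) (rep_tensor U' W')"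
proof -
  from assms(1) obtain C D where C: "C \<in> carrier_mat (rdim U') (rdim U)" and D: "D \<in> carrier_mat (rdim U) (rdim U')"
    and CD: "C * D = 1\<^sub>m (rdim U')" and Cg: "\<And>g. g \<in> SL4 \<Longrightarrow> C * act U g = act U' g * C"
    unfolding covers_def by blast
  from assms(2) obtain C' D' where C': "C' \<in> carrier_mat (rdim W') (rdim W)" and D': "D' \<in> carrier_mat (rdim W) (rdim W')"
    and CD': "C' * D' = 1\<^sub>m (rdim W')" and Cg': "\<And>g. g \<in> SL4 \<Longrightarrow> C' * act W g = act W' g * C'"
    unfolding covers_def by blast
  note U = act_carrier[of _ U] act_carrier[of _ U'] and W = act_carrier[of _ W] act_carrier[of _ W']
  show "covers (rep_sum U W) (rep_sum U' W')"
  proof (rule coversI[of "dsum_mat C C'" _ _ "dsum_mat D D'"])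
    show "dsum_mat C C' * dsum_mat D D' = 1\<^sub>m (rdim (rep_sum U' W'))"
      by (simp add: dsum_mat_mult[OF C C' D D'] CD CD' dsum_mat_one)
    fix g assume g: "g \<in> SL4"
    show "dsum_mat C C' * act (rep_sum U W) g = act (rep_sum U' W') g * dsum_mat C C'"
      using dsum_mat_mult[OF C C' U(1)[OF g] W(1)[OF g]] dsum_mat_mult[OF U(2)[OF g] W(2)[OF g] C C']
      by (simp add: Cg[OF g] Cg'[OF g])
  next
    show "dsum_mat C C' \<in> carrier_mat (rdim (rep_sum U' W')) (rdim (rep_sum U W))"
      "dsum_mat D D' \<in> carrier_mat (rdim (rep_sum U W)) (rdim (rep_sum U' W'))"
      using dsum_mat_carrier[OF C C'] dsum_mat_carrier[OF D D'] by simp_all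
  qed
  show "covers (rep_tensor U W) (rep_tensor U' W')"
  proof (rule coversI[of "kron_mat C C'" _ _ "kron_mat D D'"])
    show "kron_mat C C' * kron_mat D D' = 1\<^sub>m (rdim (rep_tensor U' W'))"
      by (simp add: kron_mat_mult[OF C C' D D'] CD CD' kron_mat_one)
    fix g assume g: "g \<in> SL4"
    show "kron_mat C C' * act (rep_tensor U W) g = act (rep_tensor U' W') g * kron_mat C C'"
      using kron_mat_mult[OF C C' U(1)[OF g] W(1)[OF g]] kron_mat_mult[OF U(2)[OF g] W(2)[OF g] C C']
      by (simp add: Cg[OF g] Cg'[OF g])
  next
    show "kron_mat C C' \<in> carrier_mat (rdim (rep_tensor U' W')) (rdim (rep_tensor U W))"
      "kron_mat D D' \<in> carrier_mat (rdim (rep_tensor U W)) (rdim (rep_tensor U' W'))"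
      using kron_mat_carrier[OF C C'] kron_mat_carrier[OF D D'] by simp_all
  qed
qed

lemma semisimple_sum:
  assumes "semisimple U" "semisimple W"
  shows "semisimple (rep_sum U W)"
proof -
  from assms obtain U' W' where "star_rep U'" "covers U' U" "star_rep W'" "covers W' W"
    unfolding semisimple_def by blast
  then show ?thesis
    using covers_sum_tensor(1) star_rep_simps(4) unfolding semisimple_def by metis
qed

lemma semisimple_tensor:
  assumes "semisimple U" "semisimple W"
  shows "semisimple (rep_tensor U W)"
proof -
  from assms obtain U' W' where "star_rep U'" "covers U' U" "star_rep W'" "covers W' W"
    unfolding semisimple_def by blast
  then show ?thesis
    using covers_sum_tensor(2) star_rep_simps(5) unfolding semisimple_def by metis
qed

lemma semisimple_tensor_pow: "semisimple U \<Longrightarrow> semisimple (tensor_pow d U)"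
  by (induction d) (auto intro: semisimple_tensor star_rep_semisimple)

lemma covers_iso: assumes "rep_iso U W" shows "covers U W"
proof -
  from assms obtain n P Q where "rdim U = n" "rdim W = n" "P \<in> carrier_mat n n" "Q \<in> carrier_mat n n"
    "P * Q = 1\<^sub>m n" "Q * P = 1\<^sub>m n" "\<And>g. g \<in> SL4 \<Longrightarrow> P * act U g = act W g * P"
    by (rule rep_isoE) blast
  then show ?thesis by (intro coversI[of P _ _ Q]) auto
qed

lemma covers_summand: "covers (rep_sum U W) U" "covers (rep_sum U W) W"
proof -
  have *: "covers (rep_sum U W) U" for U W
  proof (rule coversI[of "mat (rdim U) (rdim U + rdim W) (\<lambda>(i, j). if i = j then 1 else 0)" _ _
      "mat (rdim U + rdim W) (rdim U) (\<lambda>(i, j). if i = j then 1 else 0)"])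
    show "mat (rdim U) (rdim U + rdim W) (\<lambda>(i, j). if i = j then 1 else 0) *
      mat (rdim U + rdim W) (rdim U) (\<lambda>(i, j). if i = j then 1 else 0) = (1\<^sub>m (rdim U) :: complex mat)"
    proof (rule eq_matI)
      fix i j assume "i < dim_row (1\<^sub>m (rdim U) :: complex mat)" "j < dim_col (1\<^sub>m (rdim U) :: complex mat)"
      then have i: "i < rdim U" and j: "j < rdim U" by auto
      have "(mat (rdim U) (rdim U + rdim W) (\<lambda>(i, j). if i = j then 1 else 0) *
        mat (rdim U + rdim W) (rdim U) (\<lambda>(i, j). if i = j then 1 else 0)) $$ (i, j) =
        (\<Sum>k = 0..<rdim U + rdim W. if i = k then (if i = j then 1 else 0) else (0::complex))"
        unfolding mat_mult_index[OF mat_carrier mat_carrier i j] using i j by (intro sum.cong) auto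
      then show "(mat (rdim U) (rdim U + rdim W) (\<lambda>(i, j). if i = j then 1 else 0) *
        mat (rdim U + rdim W) (rdim U) (\<lambda>(i, j). if i = j then 1 else 0)) $$ (i, j) = (1\<^sub>m (rdim U) :: complex mat) $$ (i, j)"
        using i j by simp
    qed auto
    fix g assume g: "g \<in> SL4"
    let ?C = "mat (rdim U) (rdim U + rdim W) (\<lambda>(i, j). if i = j then 1 else 0) :: complex mat"
    show "?C * act (rep_sum U W) g = act U g * ?C"
    proof (rule eq_matI)
      fix i j assume "i < dim_row (act U g * ?C)" "j < dim_col (act U g * ?C)"
      then have i: "i < rdim U" and j: "j < rdim U + rdim W" using g by auto
      have C: "?C \<in> carrier_mat (rdim U) (rdim U + rdim W)" by simp
      have S: "act (rep_sum U W) g \<in> carrier_mat (rdim U + rdim W) (rdim U + rdim W)"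
        using act_carrier[OF g, of "rep_sum U W"] by simp
      have "(?C * act (rep_sum U W) g) $$ (i, j) = (\<Sum>k = 0..<rdim U + rdim W. if i = k then act (rep_sum U W) g $$ (k, j) else 0)"
        unfolding mat_mult_index[OF C S i j] using i by (intro sum.cong) auto
      also have "\<dots> = (if j < rdim U then act U g $$ (i, j) else 0)"
        using i j g by (simp add: rep_sum_index del: act_simps)
      also have "\<dots> = (\<Sum>k = 0..<rdim U. if k = j then act U g $$ (i, k) else 0)"
        by simp
      also have "\<dots> = (act U g * ?C) $$ (i, j)"
        unfolding mat_mult_index[OF act_carrier[OF g] C i j] using j by (intro sum.cong) auto
      finally show "(?C * act (rep_sum U W) g) $$ (i, j) = (act U g * ?C) $$ (i, j)" .
    qed (use g in auto)
  qed auto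
  show "covers (rep_sum U W) U" by (rule *)
  show "covers (rep_sum U W) W"
    using covers_trans[OF covers_iso[OF rep_sum_comm] *] .
qed

text \<open>A pseudo-inverse turns an arbitrary section into the orthogonal projection
  \<open>P\<close> along the kernel of \<open>C\<close>. That kernel is invariant, which gives P x =
  P x P; applied to \<open>adj g\<close>, after taking adjoints, it gives x P = P x P. So
  \<open>P\<close> commutes with the action, and \<open>P * D0\<close> is an equivariant
  section.\<close>

lemma covers_projection:
  assumes star: "star_rep U" and cov: "covers U R"
  obtains C D P where "C \<in> carrier_mat (rdim R) (rdim U)" "D \<in> carrier_mat (rdim U) (rdim R)"
    "C * D = 1\<^sub>m (rdim R)" "D * C = P" "star_monoid.projection (rdim U) (act U ` SL4) P"
    "\<And>g. g \<in> SL4 \<Longrightarrow> C * act U g = act R g * C" "\<And>g. g \<in> SL4 \<Longrightarrow> act U g * D = D * act R g"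
proof -
  let ?n = "rdim U" and ?r = "rdim R"
  interpret M: star_monoid ?n "act U ` SL4" by (rule star_rep_monoid[OF star])
  \<comment> \<open>Over the trivial monoid every matrix lies in the commutant, so
    \<open>moore_penrose\<close> applies to \<open>D0 * C\<close>, which is not known to commute
    with the action.\<close>
  interpret one: star_monoid ?n "{1\<^sub>m ?n}" by unfold_locales auto
  from cov obtain C D0 where C: "C \<in> carrier_mat ?r ?n" and D0: "D0 \<in> carrier_mat ?n ?r"
    and CD0: "C * D0 = 1\<^sub>m ?r" and Cg: "\<And>g. g \<in> SL4 \<Longrightarrow> C * act U g = act R g * C"
    unfolding covers_def by blast
  note [simp] = carrier_matD[OF C] carrier_matD[OF D0]
  have K: "D0 * C \<in> one.commutant" using C D0 by (intro one.commutantI) auto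
  obtain S where S: "S \<in> one.commutant" "D0 * C * S * (D0 * C) = D0 * C"
    "adj (S * (D0 * C)) = S * (D0 * C)" by (rule one.moore_penrose[OF K])
  note Sc = one.commutant_carrier[OF S(1)]
  note [simp] = carrier_matD[OF Sc]
  define L where "L = S * D0"
  define P where "P = L * C"
  have Pc: "P \<in> carrier_mat ?n ?n" and Lc: "L \<in> carrier_mat ?n ?r" using C D0 Sc by (auto simp: P_def L_def)
  note [simp] = carrier_matD[OF Pc] carrier_matD[OF Lc]
  have aP: "adj P = P" using S(3) by (simp add: P_def L_def mult_assoc_dim)
  have CP: "C * P = C"
  proof -
    have "C * (D0 * C * S * (D0 * C)) = C * (D0 * C)" by (simp only: S(2))
    then have "(C * D0) * (C * (S * (D0 * C))) = (C * D0) * C" by (simp add: mult_assoc_dim)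
    then show ?thesis by (simp add: CD0 P_def L_def mult_assoc_dim)
  qed
  have PP: "P * P = P"
  proof -
    have "P * P = L * (C * P)" by (simp add: P_def mult_assoc_dim)
    then show ?thesis by (simp only: CP) (simp only: P_def)
  qed
  have PxP: "P * act U g = P * act U g * P" if g: "g \<in> SL4" for g
  proof -
    have "P * act U g = L * (C * act U g)" using g by (simp add: P_def mult_assoc_dim)
    also have "\<dots> = L * act R g * C" using g by (simp add: Cg mult_assoc_dim)
    also have "\<dots> = L * act R g * (C * P)" by (simp add: CP)
    also have "\<dots> = L * (C * act U g) * P" using g by (simp add: Cg mult_assoc_dim)
    also have "\<dots> = P * act U g * P" using g by (simp add: P_def mult_assoc_dim)
    finally show ?thesis .
  qed
  have Pcomm: "P * act U g = act U g * P" if g: "g \<in> SL4" for g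
  proof -
    have "act U g * P = adj (P * act U (adj g))"
      using star g act_carrier[OF adj_SL4[OF g], of U] act_carrier[OF g, of U]
      by (simp add: star_rep_def adj_mult[of P ?n ?n _ ?n] Pc aP)
    also have "P * act U (adj g) = P * act U (adj g) * P" by (rule PxP[OF adj_SL4[OF g]])
    also have "adj (P * act U (adj g) * P) = P * (act U g * P)"
      using star g Pc act_carrier[OF adj_SL4[OF g], of U] act_carrier[OF g, of U]
      by (simp add: star_rep_def adj_mult[of _ ?n ?n _ ?n] aP)
    also have "\<dots> = P * act U g" using PxP[OF g] g by (simp add: mult_assoc_dim)
    finally show ?thesis ..
  qed
  have proj: "M.projection P"
    unfolding M.projection_def using aP PP Pc Pcomm by (auto intro!: M.commutantI)
  define D where "D = P * D0"
  have Dc: "D \<in> carrier_mat ?n ?r" using D0 Pc by (simp add: D_def)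
  note [simp] = carrier_matD[OF Dc]
  have CD: "C * D = 1\<^sub>m ?r"
  proof -
    have "C * D = C * P * D0" by (simp add: D_def mult_assoc_dim)
    then show ?thesis by (simp add: CP CD0)
  qed
  have DC: "D * C = P"
  proof -
    have "D * C = L * ((C * D0) * C)" by (simp add: D_def P_def mult_assoc_dim)
    then show ?thesis by (simp add: CD0 P_def)
  qed
  have "act U g * D = D * act R g" if g: "g \<in> SL4" for g
  proof -
    have "D = P * D" using PP by (simp add: D_def mult_assoc_dim[symmetric])
    then have "act U g * D = P * act U g * D" using g Pcomm[OF g]
      by (metis Dc Pc act_carrier assoc_mult_mat)
    also have "\<dots> = D * (C * act U g * D)" using g by (simp add: DC[symmetric] mult_assoc_dim)
    also have "C * act U g * D = act R g * (C * D)" using g by (simp add: Cg mult_assoc_dim)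
    finally show ?thesis using g by (simp add: CD)
  qed
  then show thesis using that[OF C Dc CD DC proj Cg] by blast
qed

text \<open>Both representations are realized in the sum of their two covers, so that their
  projections lie in a single commutant. The intertwiners between the projections, composed with the
  maps to and from \<open>R\<close> and \<open>R'\<close>, are mutually inverse.\<close>

theorem semisimple_char_iso:
  assumes ss: "semisimple R" "semisimple R'"
    and char: "\<And>g. g \<in> SL4 \<Longrightarrow> mtrace (act R g) = mtrace (act R' g)"
  shows "rep_iso R R'"
proof -
  from ss obtain U U' where U: "star_rep U" "covers U R" "star_rep U'" "covers U' R'"
    unfolding semisimple_def by blast
  define X where "X = rep_sum U U'"
  have X: "star_rep X" "covers X R" "covers X R'"
    using U covers_trans[OF covers_summand(1)] covers_trans[OF covers_summand(2)] by (auto simp: X_def)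
  let ?n = "rdim X"
  interpret M: star_monoid ?n "act X ` SL4" by (rule star_rep_monoid[OF X(1)])
  obtain C D P where C: "C \<in> carrier_mat (rdim R) ?n" and D: "D \<in> carrier_mat ?n (rdim R)"
    and CD: "C * D = 1\<^sub>m (rdim R)" and DC: "D * C = P" and P: "M.projection P"
    and Cg: "\<And>g. g \<in> SL4 \<Longrightarrow> C * act X g = act R g * C" and Dg: "\<And>g. g \<in> SL4 \<Longrightarrow> act X g * D = D * act R g"
  proof (rule covers_projection[OF X(1,2)], goal_cases)
    case (1 C D P)
    show ?case by (rule 1(1)[OF 1(2-8)])
  qed
  obtain C' D' P' where C': "C' \<in> carrier_mat (rdim R') ?n" and D': "D' \<in> carrier_mat ?n (rdim R')"
    and CD': "C' * D' = 1\<^sub>m (rdim R')" and DC': "D' * C' = P'" and P': "M.projection P'"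
    and Cg': "\<And>g. g \<in> SL4 \<Longrightarrow> C' * act X g = act R' g * C'" and Dg': "\<And>g. g \<in> SL4 \<Longrightarrow> act X g * D' = D' * act R' g"
  proof (rule covers_projection[OF X(1,3)], goal_cases)
    case (1 C D P)
    show ?case by (rule 1(1)[OF 1(2-8)])
  qed
  note [simp] = carrier_matD[OF C] carrier_matD[OF D] carrier_matD[OF C'] carrier_matD[OF D']
  have "of_nat (rdim R) = (of_nat (rdim R') :: complex)"
    using char[OF one_in_SL4] by (simp add: act_one)
  then have dim: "rdim R = rdim R'" by simp
  have tP: "mtrace (P * act X g) = mtrace (act R g)" if g: "g \<in> SL4" for g
  proof -
    have "mtrace (P * act X g) = mtrace (D * (C * act X g))" using g by (simp add: DC[symmetric] mult_assoc_dim)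
    also have "\<dots> = mtrace (C * act X g * D)" using g by (intro mtrace_comm_dim) auto
    also have "C * act X g * D = act R g * (C * D)" using g by (simp add: Cg mult_assoc_dim)
    finally show ?thesis using g by (simp add: CD)
  qed
  have tP': "mtrace (P' * act X g) = mtrace (act R' g)" if g: "g \<in> SL4" for g
  proof -
    have "mtrace (P' * act X g) = mtrace (D' * (C' * act X g))" using g by (simp add: DC'[symmetric] mult_assoc_dim)
    also have "\<dots> = mtrace (C' * act X g * D')" using g by (intro mtrace_comm_dim) auto
    also have "C' * act X g * D' = act R' g * (C' * D')" using g by (simp add: Cg' mult_assoc_dim)
    finally show ?thesis using g by (simp add: CD')
  qed
  obtain T S where T: "T \<in> M.commutant" and S: "S \<in> M.commutant" and ST: "S * T = P" and TS: "T * S = P'"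
    by (rule M.projections_equivalent[OF P P']) (use tP tP' char in auto)
  note [simp] = carrier_matD[OF M.commutant_carrier[OF T]] carrier_matD[OF M.commutant_carrier[OF S]]
  define A where "A = C' * (T * D)"
  define B where "B = C * (S * D')"
  have A: "A \<in> carrier_mat (rdim R') (rdim R)" and B: "B \<in> carrier_mat (rdim R) (rdim R')"
    by (auto simp: A_def B_def)
  have "B * A = C * (S * ((D' * C') * (T * D)))" by (simp add: A_def B_def mult_assoc_dim)
  also have "\<dots> = C * ((S * T) * ((S * T) * D))" by (simp add: DC' TS[symmetric] mult_assoc_dim)
  also have "\<dots> = (C * D) * ((C * D) * (C * D))" by (simp add: ST DC[symmetric] mult_assoc_dim)
  finally have BA: "B * A = 1\<^sub>m (rdim R)" by (simp add: CD)
  have "A * B = C' * (T * ((D * C) * (S * D')))" by (simp add: A_def B_def mult_assoc_dim)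
  also have "\<dots> = C' * ((T * S) * ((T * S) * D'))" by (simp add: DC ST[symmetric] mult_assoc_dim)
  also have "\<dots> = (C' * D') * ((C' * D') * (C' * D'))" by (simp add: TS DC'[symmetric] mult_assoc_dim)
  finally have AB: "A * B = 1\<^sub>m (rdim R')" by (simp add: CD')
  have "A * act R g = act R' g * A" if g: "g \<in> SL4" for g
  proof -
    have "A * act R g = C' * (T * (D * act R g))" using g by (simp add: A_def mult_assoc_dim)
    also have "\<dots> = C' * ((T * act X g) * D)" using g by (simp add: Dg[symmetric] mult_assoc_dim)
    also have "T * act X g = act X g * T" using M.commutant_commutes[OF T] g by simp
    also have "C' * (act X g * T * D) = (C' * act X g) * (T * D)" using g by (simp add: mult_assoc_dim)
    also have "\<dots> = act R' g * A" using g by (simp add: Cg' A_def mult_assoc_dim)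
    finally show ?thesis .
  qed
  then show ?thesis
    using A B AB BA dim by (intro rep_isoI[of R "rdim R'" R' A B]) auto
qed

subsection \<open>Quotients and subrepresentations given by an idempotent\<close>

lemma regular_add:
  assumes "regular p" "regular q" shows "regular (\<lambda>g. p g + q g)"
proof -
  from assms obtain p' q' where "p' \<in> poly_funs" "q' \<in> poly_funs" "\<forall>g\<in>SL4. p g = p' g \<and> q g = q' g"
    unfolding regular_def by blast
  then show ?thesis
    unfolding regular_def by (intro bexI[OF _ poly_funs.add[of p' q']]) simp_all
qed

lemma regular_sum: "(\<And>i. i \<in> A \<Longrightarrow> regular (p i)) \<Longrightarrow> regular (\<lambda>g. \<Sum>i\<in>A. p i g)"
  by (induction A rule: infinite_finite_induct) (auto intro: regular_const regular_add)

lemma column_factorization: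
  assumes B: "B \<in> carrier_mat n r" and M: "M \<in> carrier_mat n m"
    and ex: "\<And>j. j < m \<Longrightarrow> \<exists>x\<in>carrier_vec r. B *\<^sub>v x = col M j"
  obtains K where "K \<in> carrier_mat r m" "B * K = M"
proof -
  from ex obtain x where x: "\<And>j. j < m \<Longrightarrow> x j \<in> carrier_vec r" "\<And>j. j < m \<Longrightarrow> B *\<^sub>v x j = col M j"
    by metis
  define K where "K = mat r m (\<lambda>(i, j). x j $ i)"
  have K: "K \<in> carrier_mat r m" by (simp add: K_def)
  have "col K j = x j" if "j < m" for j
    using x(1)[OF that] that by (intro eq_vecI) (auto simp: K_def)
  note colK = this
  have "B * K = M"
  proof (rule mat_col_eqI)
    fix j assume "j < dim_col M"
    then have j: "j < m" using M by simp
    show "col (B * K) j = col M j" by (simp add: col_mult2[OF B K j] colK[OF j] x(2)[OF j])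
  qed (use B K M in auto)
  with K that show thesis by blast
qed

lemma kernel_trivial_cancel:
  assumes B: "B \<in> carrier_mat n r" and ker: "mat_kernel B = {0\<^sub>v r}"
    and M: "M \<in> carrier_mat r m" and N: "N \<in> carrier_mat r m" and eq: "B * M = B * N"
  shows "M = N"
proof (rule mat_col_eqI)
  fix j assume "j < dim_col N"
  then have j: "j < m" using N by auto
  have c: "col M j \<in> carrier_vec r" "col N j \<in> carrier_vec r" using M N j by auto
  have "B *\<^sub>v (col M j - col N j) = col (B * M) j - col (B * N) j"
    using c B by (simp add: mult_minus_distrib_mat_vec[OF B c] col_mult2[OF B M j] col_mult2[OF B N j])
  also have "\<dots> = 0\<^sub>v n" unfolding eq using B N j by (intro eq_vecI) auto
  finally have "col M j - col N j \<in> mat_kernel B"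
    using c B by (intro mat_kernelI[OF B]) auto
  then have "col M j - col N j = 0\<^sub>v r" using ker by simp
  then have "(col M j - col N j) $ i = 0" if "i < r" for i using that by simp
  then show "col M j = col N j" using c M N j by (intro eq_vecI) auto
qed (use M N in auto)

text \<open>A maximal independent set of columns of \<open>P\<close> forms \<open>D\<close>, and the
  coordinates of all columns with respect to it form \<open>C\<close>. Since \<open>P\<close> fixes
  its own columns, \<open>D * (C * D) = D\<close>, and the injective \<open>D\<close>
  cancels.\<close>

lemma idempotent_factorization:
  assumes P: "P \<in> carrier_mat n n" and PP: "P * P = P"
  obtains r C D where "C \<in> carrier_mat r n" "D \<in> carrier_mat n r" "C * D = 1\<^sub>m r" "D * C = (P :: complex mat)"
proof -
  define indep where "indep J \<longleftrightarrow> J \<subseteq> {..<n} \<and>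
    (\<forall>c. (\<forall>x<n. (\<Sum>j\<in>J. c j * P $$ (x, j)) = 0) \<longrightarrow> (\<forall>j\<in>J. c j = 0))" for J
  have bound: "card J \<le> n" if "indep J" for J
    using that card_mono[of "{..<n}" J] by (auto simp: indep_def)
  have "indep {}" by (simp add: indep_def)
  then obtain J where J: "indep J" and max: "\<And>J'. indep J' \<Longrightarrow> card J' \<le> card J"
    using Lattices_Big.ex_has_greatest_nat[of indep "{}" card "Suc n"] bound by (auto simp: less_Suc_eq_le)
  have Jn: "J \<subseteq> {..<n}" and Jfin: "finite J" using J finite_subset[of J "{..<n}"] by (auto simp: indep_def)
  have ex: "\<exists>a. \<forall>x<n. P $$ (x, i) = (\<Sum>j\<in>J. a j * P $$ (x, j))" if i: "i < n" for i
  proof (cases "i \<in> J")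
    case True
    show ?thesis
      by (rule exI[of _ "\<lambda>j. if j = i then 1 else 0"]) (use True Jfin in \<open>simp add: if_distribR if_distrib cong: if_cong\<close>)
  next
    case False
    have "\<not> indep (insert i J)" using max[of "insert i J"] False Jfin by auto
    then obtain c j0 where c: "\<forall>x<n. (\<Sum>j\<in>insert i J. c j * P $$ (x, j)) = 0" "j0 \<in> insert i J" "c j0 \<noteq> 0"
      using Jn i unfolding indep_def by auto
    have ci: "c i \<noteq> 0"
    proof
      assume 0: "c i = 0"
      then have "\<forall>x<n. (\<Sum>j\<in>J. c j * P $$ (x, j)) = 0" using c(1) False Jfin by simp
      then have "\<forall>j\<in>J. c j = 0" using J unfolding indep_def by blast
      then show False using c(2,3) 0 by auto
    qed
    show ?thesis
    proof (rule exI[of _ "\<lambda>j. - c j / c i"], intro allI impI)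
      fix x assume "x < n"
      then have "c i * P $$ (x, i) + (\<Sum>j\<in>J. c j * P $$ (x, j)) = 0" using c(1) False Jfin by simp
      then have "P $$ (x, i) = - (\<Sum>j\<in>J. c j * P $$ (x, j)) / c i" using ci by (simp add: field_simps eq_neg_iff_add_eq_0)
      then show "P $$ (x, i) = (\<Sum>j\<in>J. - c j / c i * P $$ (x, j))"
        by (simp add: sum_divide_distrib sum_negf)
    qed
  qed
  then obtain a where a: "\<And>i x. i < n \<Longrightarrow> x < n \<Longrightarrow> P $$ (x, i) = (\<Sum>j\<in>J. a i j * P $$ (x, j))" by metis
  define r where "r = card J"
  obtain e where e: "bij_betw e {0..<r} J" using ex_bij_betw_nat_finite[OF Jfin] by (auto simp: r_def)
  have en: "e k < n" if "k < r" for k using bij_betwE[OF e] that Jn by auto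
  define D where "D = mat n r (\<lambda>(x, k). P $$ (x, e k))"
  define C where "C = mat r n (\<lambda>(k, i). a i (e k))"
  have C: "C \<in> carrier_mat r n" and D: "D \<in> carrier_mat n r" by (simp_all add: C_def D_def)
  have DC: "D * C = P"
  proof (rule square_mat_eqI[of _ n])
    fix x i assume x: "x < n" and i: "i < n"
    have "(D * C) $$ (x, i) = (\<Sum>k = 0..<r. a i (e k) * P $$ (x, e k))"
      unfolding mat_mult_index[OF D C x i] using x i by (intro sum.cong) (auto simp: C_def D_def)
    also have "\<dots> = (\<Sum>j\<in>J. a i j * P $$ (x, j))" by (rule sum.reindex_bij_betw[OF e])
    finally show "(D * C) $$ (x, i) = P $$ (x, i)" using a[OF i x] by simp
  qed (use C D P in auto)
  have PD: "P * D = D"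
  proof (rule eq_matI)
    fix x k assume "x < dim_row D" "k < dim_col D"
    then have x: "x < n" and k: "k < r" using D by auto
    have "(P * D) $$ (x, k) = (\<Sum>l = 0..<n. P $$ (x, l) * P $$ (l, e k))"
      unfolding mat_mult_index[OF P D x k] using k by (intro sum.cong) (auto simp: D_def)
    also have "\<dots> = (P * P) $$ (x, e k)" using mat_mult_index[OF P P x en[OF k]] by simp
    finally show "(P * D) $$ (x, k) = D $$ (x, k)" unfolding PP using x k by (simp add: D_def)
  qed (use P D in auto)
  have ker: "mat_kernel D = {0\<^sub>v r}"
  proof (rule equalityI; rule subsetI)
    fix v assume "v \<in> mat_kernel D"
    then have v: "v \<in> carrier_vec r" "D *\<^sub>v v = 0\<^sub>v n" using mat_kernelD[OF D] by auto
    define c where "c j = v $ (the_inv_into {0..<r} e j)" for j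
    have ce: "c (e k) = v $ k" if "k < r" for k
      using e that by (simp add: c_def the_inv_into_f_f bij_betw_def)
    have "(\<Sum>j\<in>J. c j * P $$ (x, j)) = 0" if x: "x < n" for x
    proof -
      have "(\<Sum>j\<in>J. c j * P $$ (x, j)) = (\<Sum>k = 0..<r. c (e k) * P $$ (x, e k))"
        by (rule sum.reindex_bij_betw[OF e, symmetric])
      also have "\<dots> = (D *\<^sub>v v) $ x"
        using x v(1) ce by (auto simp: scalar_prod_def D_def intro!: sum.cong)
      finally show ?thesis using v x by simp
    qed
    then have "\<forall>j\<in>J. c j = 0" using J unfolding indep_def by blast
    then have "v $ k = 0" if "k < r" for k using ce[OF that] e that by (auto simp: bij_betw_def)
    then show "v \<in> {0\<^sub>v r}" using v by (auto intro!: eq_vecI)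
  qed (use D in \<open>auto intro!: mat_kernelI\<close>)
  have "D * (C * D) = D * 1\<^sub>m r" using PD D C by (simp add: DC[symmetric])
  then have "C * D = 1\<^sub>m r" using kernel_trivial_cancel[OF D ker mult_carrier_mat[OF C D] one_carrier_mat] by blast
  with C D DC that show thesis by blast
qed

text \<open>The action on the image is \<open>C * act U g * D\<close>, with entries that are linear
  combinations of regular functions. This provides the existence on which the choices in
  \<open>sub_rep\<close> and \<open>quot_rep\<close> rest.\<close>

lemma exists_idempotent_rep:
  assumes P: "P \<in> carrier_mat (rdim U) (rdim U)" and PP: "P * P = P"
    and comm: "\<And>g. g \<in> SL4 \<Longrightarrow> P * act U g = act U g * P"
  obtains R C D where "C \<in> carrier_mat (rdim R) (rdim U)" "D \<in> carrier_mat (rdim U) (rdim R)"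
    "C * D = 1\<^sub>m (rdim R)" "D * C = P"
    "\<And>g. g \<in> SL4 \<Longrightarrow> C * act U g = act R g * C" "\<And>g. g \<in> SL4 \<Longrightarrow> act U g * D = D * act R g"
proof -
  let ?n = "rdim U"
  obtain r C D where C: "C \<in> carrier_mat r ?n" and D: "D \<in> carrier_mat ?n r"
    and CD: "C * D = 1\<^sub>m r" and DC: "D * C = P"
    by (rule idempotent_factorization[OF P PP])
  note [simp] = carrier_matD[OF C] carrier_matD[OF D] carrier_matD[OF P]
  define \<rho> where "\<rho> g = C * (act U g * D)" for g
  have l: "C * act U g = \<rho> g * C" if g: "g \<in> SL4" for g
  proof -
    have "\<rho> g * C = C * (act U g * P)" using g by (simp add: \<rho>_def DC[symmetric] mult_assoc_dim)
    also have "\<dots> = C * (P * act U g)" by (simp only: comm[OF g])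
    also have "\<dots> = C * D * (C * act U g)" using g by (simp add: DC[symmetric] mult_assoc_dim)
    finally show ?thesis using g by (simp add: CD)
  qed
  have r: "act U g * D = D * \<rho> g" if g: "g \<in> SL4" for g
  proof -
    have "D * \<rho> g = P * act U g * D" using g by (simp add: \<rho>_def DC[symmetric] mult_assoc_dim)
    also have "\<dots> = act U g * P * D" by (simp only: comm[OF g])
    also have "\<dots> = act U g * D * (C * D)" using g by (simp add: DC[symmetric] mult_assoc_dim)
    finally show ?thesis using g by (simp add: CD)
  qed
  have "is_rep r \<rho>"
    unfolding is_rep_def
  proof (intro conjI ballI allI impI)
    show "\<rho> g \<in> carrier_mat r r" if "g \<in> SL4" for g using that by (auto simp: \<rho>_def)
    show "\<rho> (1\<^sub>m 4) = 1\<^sub>m r" by (simp add: \<rho>_def act_one CD)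
    show "\<rho> (g * h) = \<rho> g * \<rho> h" if g: "g \<in> SL4" and h: "h \<in> SL4" for g h
    proof -
      have "\<rho> g * \<rho> h = (\<rho> g * C) * (act U h * D)" using g h by (simp add: \<rho>_def mult_assoc_dim)
      also have "\<dots> = \<rho> (g * h)" unfolding l[OF g, symmetric] using g h by (simp add: \<rho>_def act_mult mult_assoc_dim)
      finally show ?thesis ..
    qed
    show "regular (\<lambda>g. \<rho> g $$ (i, j))" if i: "i < r" and j: "j < r" for i j
    proof -
      have "\<rho> g $$ (i, j) = (\<Sum>k = 0..<?n. C $$ (i, k) * (\<Sum>l = 0..<?n. act U g $$ (k, l) * D $$ (l, j)))"
        if g: "g \<in> SL4" for g
      proof -
        have UD: "act U g * D \<in> carrier_mat ?n r" using g by auto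
        show ?thesis
          unfolding \<rho>_def mat_mult_index[OF C UD i j]
          by (intro sum.cong refl arg_cong2[where f = times])
            (use mat_mult_index[OF act_carrier[OF g] D _ j] in auto)
      qed
      then show ?thesis
        by (subst regular_cong) (auto intro!: regular_sum regular_mult regular_const act_regular)
    qed
  qed
  note R = Abs_rep_simps[OF this]
  show thesis
    by (rule that[of C "Abs_rep (r, \<rho>)" D]) (simp_all add: R C D CD DC l r)
qed

text \<open>The chosen quotient is known only through \<open>is_quotrep\<close>. After
  \<open>P\<close> has settled existence, the trace is computed for an arbitrary surjection
  \<open>C\<close> with kernel \<open>W\<close> and a section \<open>D\<close>: equal kernels give
  \<open>C * P = C\<close> and \<open>P * (D * C) = P\<close>, and the trace is cyclic.\<close>

lemma idempotent_quotrep: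
  assumes P: "P \<in> carrier_mat (rdim U) (rdim U)" and PP: "P * P = P"
    and comm: "\<And>g. g \<in> SL4 \<Longrightarrow> P * act U g = act U g * P"
    and W: "mat_kernel P = W"
  shows "covers U (quot_rep U W)"
    and "g \<in> SL4 \<Longrightarrow> mtrace (act (quot_rep U W) g) = mtrace (act U g * P)"
proof -
  let ?n = "rdim U" and ?R = "quot_rep U W" and ?r = "rdim (quot_rep U W)"
  note [simp] = carrier_matD[OF P]
  have "is_quotrep U W ?R"
    unfolding quot_rep_def
  proof (rule someI_ex)
    obtain R C D where C: "C \<in> carrier_mat (rdim R) ?n" and D: "D \<in> carrier_mat ?n (rdim R)"
      and CD: "C * D = 1\<^sub>m (rdim R)" and DC: "D * C = P"
      and Cg: "\<And>g. g \<in> SL4 \<Longrightarrow> C * act U g = act R g * C"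
    proof (rule exists_idempotent_rep[OF P PP comm], assumption, goal_cases)
      case (1 C R D)
      show ?case by (rule 1(1)[OF 1(2-6)])
    qed
    have 1: "C *\<^sub>v v = 0\<^sub>v (rdim R) \<longleftrightarrow> P *\<^sub>v v = 0\<^sub>v ?n" if v: "v \<in> carrier_vec ?n" for v
    proof -
      have "P *\<^sub>v v = D *\<^sub>v (C *\<^sub>v v)" unfolding DC[symmetric] by (rule assoc_mult_mat_vec[OF D C v])
      moreover have "C *\<^sub>v v = C *\<^sub>v (D *\<^sub>v (C *\<^sub>v v))"
        using C D v assoc_mult_mat_vec[OF C D, of "C *\<^sub>v v"] by (simp add: CD)
      ultimately show ?thesis using C D by (auto simp: mult_mat_vec_def intro!: eq_vecI) 
    qed
    have "mat_kernel C = W"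
      unfolding W[symmetric] using 1 C P by (auto simp: mat_kernel_def)
    moreover have "(\<lambda>x. C *\<^sub>v x) ` carrier_vec ?n = carrier_vec (rdim R)"
    proof (intro equalityI subsetI)
      fix y :: "complex vec" assume y: "y \<in> carrier_vec (rdim R)"
      have "C *\<^sub>v (D *\<^sub>v y) = y" using assoc_mult_mat_vec[OF C D y] y by (simp add: CD)
      then show "y \<in> (\<lambda>x. C *\<^sub>v x) ` carrier_vec ?n" using D y by (intro image_eqI[of _ _ "D *\<^sub>v y"]) auto
    qed (use C in auto)
    ultimately show "\<exists>R. is_quotrep U W R" unfolding is_quotrep_def using C Cg by blast
  qed
  then obtain C where C: "C \<in> carrier_mat ?r ?n" and ker: "mat_kernel C = W"
    and sur: "(\<lambda>x. C *\<^sub>v x) ` carrier_vec ?n = carrier_vec ?r"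
    and Cg: "\<And>g. g \<in> SL4 \<Longrightarrow> C * act U g = act ?R g * C"
    unfolding is_quotrep_def by blast
  obtain D where D: "D \<in> carrier_mat ?n ?r" and CD: "C * D = 1\<^sub>m ?r"
  proof (rule column_factorization[OF C one_carrier_mat[of ?r]])
    fix j assume "j < ?r"
    have "col (1\<^sub>m ?r) j \<in> (\<lambda>x. C *\<^sub>v x) ` carrier_vec ?n" unfolding sur using \<open>j < ?r\<close> by auto
    then show "\<exists>x\<in>carrier_vec ?n. C *\<^sub>v x = col (1\<^sub>m ?r) j" by auto
  qed
  show "covers U ?R" by (rule coversI[OF C D CD Cg])
  note [simp] = carrier_matD[OF C] carrier_matD[OF D]
  \<comment> \<open>When the kernel of \<open>B\<close> is contained in that of \<open>A\<close>,
    equality after \<open>B\<close> implies equality after \<open>A\<close>.\<close>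
  have same: "A * x = A * y"
    if A: "A \<in> carrier_mat m ?n" and x: "x \<in> carrier_mat ?n k" and y: "y \<in> carrier_mat ?n k"
      and B: "B \<in> carrier_mat l ?n" and eq: "B * x = B * y" and sub: "mat_kernel B \<subseteq> mat_kernel A"
    for A B x y m k l
  proof (rule mat_col_eqI)
    fix j assume "j < dim_col (A * y)"
    then have j: "j < k" using y by auto
    have c: "col x j \<in> carrier_vec ?n" "col y j \<in> carrier_vec ?n" using x y j by auto
    have "B *\<^sub>v (col x j - col y j) = col (B * x) j - col (B * y) j"
      by (simp add: mult_minus_distrib_mat_vec[OF B c] col_mult2[OF B x j] col_mult2[OF B y j])
    also have "\<dots> = 0\<^sub>v l" unfolding eq using B y j by (intro eq_vecI) auto
    finally have "col x j - col y j \<in> mat_kernel A"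
      using c B sub by (auto intro!: mat_kernelI[OF B])
    then have "A *\<^sub>v (col x j - col y j) = 0\<^sub>v m" using mat_kernelD[OF A] by auto
    then have "A *\<^sub>v col x j - A *\<^sub>v col y j = 0\<^sub>v m" by (simp add: mult_minus_distrib_mat_vec[OF A c])
    then have "(A *\<^sub>v col x j - A *\<^sub>v col y j) $ i = 0" if "i < m" for i using that by simp
    then have "A *\<^sub>v col x j = A *\<^sub>v col y j" using A c by (intro eq_vecI) auto
    then show "col (A * x) j = col (A * y) j" by (simp add: col_mult2[OF A x j] col_mult2[OF A y j])
  qed (use A x y in auto)
  have CP: "C * P = C"
    using same[OF C P one_carrier_mat P] PP ker W by simp
  have "P * (D * C) = P * 1\<^sub>m ?n"
  proof (rule same[OF P _ _ C])
    have "C * (D * C) = (C * D) * C" by (simp add: mult_assoc_dim)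
    then show "C * (D * C) = C * 1\<^sub>m ?n" by (simp add: CD)
  qed (use C D P ker W in auto)
  then have PDC: "P * (D * C) = P" by simp
  show "mtrace (act ?R g) = mtrace (act U g * P)" if g: "g \<in> SL4"
  proof -
    have "act ?R g = act ?R g * (C * D)" using g by (simp add: CD)
    also have "\<dots> = C * act U g * D" using g by (simp add: Cg mult_assoc_dim[symmetric])
    also have "\<dots> = (C * P) * act U g * D" by (simp add: CP)
    also have "\<dots> = C * (P * act U g) * D" using g by (simp add: mult_assoc_dim)
    also have "\<dots> = C * (act U g * P) * D" by (simp only: comm[OF g])
    also have "\<dots> = C * (act U g * (P * D))" using g by (simp add: mult_assoc_dim)
    finally have "mtrace (act ?R g) = mtrace (C * (act U g * (P * D)))" by simp
    also have "\<dots> = mtrace (act U g * (P * D) * C)" using g by (intro mtrace_comm_dim) auto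
    also have "act U g * (P * D) * C = act U g * P" using g PDC by (simp add: mult_assoc_dim)
    finally show ?thesis .
  qed
qed

text \<open>Dual to the quotient: equal images give \<open>B * C = P\<close> for some
  \<open>C\<close>, and \<open>P * B = B\<close>. Injectivity of \<open>B\<close> then yields
  \<open>C * B = 1\<close> and the equivariance of \<open>C\<close>, so a subrepresentation is
  covered as well.\<close>

lemma idempotent_subrep:
  assumes P: "P \<in> carrier_mat (rdim U) (rdim U)" and PP: "P * P = P"
    and comm: "\<And>g. g \<in> SL4 \<Longrightarrow> P * act U g = act U g * P"
    and W: "(\<lambda>x. P *\<^sub>v x) ` carrier_vec (rdim U) = W"
  shows "covers U (sub_rep U W)"
    and "g \<in> SL4 \<Longrightarrow> mtrace (act (sub_rep U W) g) = mtrace (act U g * P)"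
proof -
  let ?n = "rdim U" and ?R = "sub_rep U W" and ?r = "rdim (sub_rep U W)"
  note [simp] = carrier_matD[OF P]
  have "is_subrep U W ?R"
    unfolding sub_rep_def
  proof (rule someI_ex)
    obtain R C D where C: "C \<in> carrier_mat (rdim R) ?n" and D: "D \<in> carrier_mat ?n (rdim R)"
      and CD: "C * D = 1\<^sub>m (rdim R)" and DC: "D * C = P"
      and Dg: "\<And>g. g \<in> SL4 \<Longrightarrow> act U g * D = D * act R g"
    proof (rule exists_idempotent_rep[OF P PP comm], assumption, goal_cases)
      case (1 C R D)
      show ?case by (rule 1(1)[OF 1(2-5) 1(7)])
    qed
    have CDv: "C *\<^sub>v (D *\<^sub>v v) = v" if "v \<in> carrier_vec (rdim R)" for v
      using assoc_mult_mat_vec[OF C D that] that by (simp add: CD)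
    have DCv: "D *\<^sub>v (C *\<^sub>v v) = P *\<^sub>v v" if "v \<in> carrier_vec ?n" for v
      using assoc_mult_mat_vec[OF D C that] by (simp add: DC)
    have "mat_kernel D = {0\<^sub>v (rdim R)}"
    proof (intro equalityI subsetI)
      fix v assume "v \<in> mat_kernel D"
      then have v: "v \<in> carrier_vec (rdim R)" "D *\<^sub>v v = 0\<^sub>v ?n" using mat_kernelD[OF D] by auto
      then have "v = C *\<^sub>v 0\<^sub>v ?n" using CDv[OF v(1)] by simp
      then show "v \<in> {0\<^sub>v (rdim R)}" using C by auto
    qed (use D in \<open>auto intro!: mat_kernelI\<close>)
    moreover have "(\<lambda>x. D *\<^sub>v x) ` carrier_vec (rdim R) = W"
      unfolding W[symmetric]
    proof (intro equalityI subsetI)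
      fix y :: "complex vec" assume "y \<in> (\<lambda>x. D *\<^sub>v x) ` carrier_vec (rdim R)"
      then obtain x where x: "x \<in> carrier_vec (rdim R)" "y = D *\<^sub>v x" by auto
      then have "y = P *\<^sub>v (D *\<^sub>v x)" using DCv[of "D *\<^sub>v x"] CDv[OF x(1)] D by simp
      then show "y \<in> (\<lambda>x. P *\<^sub>v x) ` carrier_vec ?n" using D x by auto
    next
      fix y :: "complex vec" assume "y \<in> (\<lambda>x. P *\<^sub>v x) ` carrier_vec ?n"
      then obtain x where x: "x \<in> carrier_vec ?n" "y = P *\<^sub>v x" by auto
      then show "y \<in> (\<lambda>x. D *\<^sub>v x) ` carrier_vec (rdim R)" using DCv[OF x(1)] C
        by (intro image_eqI[of _ _ "C *\<^sub>v x"]) auto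
    qed
    ultimately show "\<exists>R. is_subrep U W R" unfolding is_subrep_def using D Dg by blast
  qed
  then obtain B where B: "B \<in> carrier_mat ?n ?r" and ker: "mat_kernel B = {0\<^sub>v ?r}"
    and im: "(\<lambda>x. B *\<^sub>v x) ` carrier_vec ?r = W"
    and Bg: "\<And>g. g \<in> SL4 \<Longrightarrow> act U g * B = B * act ?R g"
    unfolding is_subrep_def by blast
  obtain C where C: "C \<in> carrier_mat ?r ?n" and BC: "B * C = P"
  proof (rule column_factorization[OF B P])
    fix j assume j: "j < ?n"
    have "col P j = P *\<^sub>v col (1\<^sub>m ?n) j" using col_mult2[OF P one_carrier_mat j] by simp
    then have "col P j \<in> (\<lambda>x. P *\<^sub>v x) ` carrier_vec ?n" using j by (intro image_eqI) auto
    then have "col P j \<in> (\<lambda>x. B *\<^sub>v x) ` carrier_vec ?r" by (simp only: W im)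
    then show "\<exists>x\<in>carrier_vec ?r. B *\<^sub>v x = col P j" by (metis imageE)
  qed
  note [simp] = carrier_matD[OF B] carrier_matD[OF C]
  have PB: "P * B = B"
  proof (rule mat_col_eqI)
    fix j assume "j < dim_col B"
    then have j: "j < ?r" by simp
    have "col B j = B *\<^sub>v col (1\<^sub>m ?r) j" using col_mult2[OF B one_carrier_mat j] by simp
    then have "col B j \<in> (\<lambda>x. B *\<^sub>v x) ` carrier_vec ?r" using j by (intro image_eqI) auto
    then have "col B j \<in> (\<lambda>x. P *\<^sub>v x) ` carrier_vec ?n" by (simp only: W im)
    then obtain x where x: "x \<in> carrier_vec ?n" "col B j = P *\<^sub>v x" by (metis imageE)
    have "col (P * B) j = P *\<^sub>v (P *\<^sub>v x)" by (simp add: col_mult2[OF P B j] x(2))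
    then show "col (P * B) j = col B j" using assoc_mult_mat_vec[OF P P x(1)] by (simp add: PP x(2))
  qed auto
  have "B * (C * B) = B * 1\<^sub>m ?r" using PB by (simp add: BC[symmetric] mult_assoc_dim)
  then have CB: "C * B = 1\<^sub>m ?r"
    using kernel_trivial_cancel[OF B ker mult_carrier_mat[OF C B] one_carrier_mat] by blast
  have Cg: "C * act U g = act ?R g * C" if g: "g \<in> SL4" for g
  proof (rule kernel_trivial_cancel[OF B ker])
    have "B * (C * act U g) = P * act U g" using g by (simp add: BC[symmetric] mult_assoc_dim)
    also have "\<dots> = act U g * P" by (rule comm[OF g])
    also have "\<dots> = act U g * (B * C)" by (simp only: BC)
    also have "\<dots> = B * (act ?R g * C)" using g by (simp add: Bg mult_assoc_dim[symmetric])
    finally show "B * (C * act U g) = B * (act ?R g * C)" .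
  qed (use g C act_carrier[OF g, of ?R] act_carrier[OF g, of U] in auto)
  show "covers U ?R" by (rule coversI[OF C B CB Cg])
  show "mtrace (act ?R g) = mtrace (act U g * P)" if g: "g \<in> SL4"
  proof -
    have "act ?R g = C * (act U g * B)" using g CB by (simp add: Bg mult_assoc_dim[symmetric])
    then have "mtrace (act ?R g) = mtrace (act U g * B * C)" using g by (simp add: mtrace_comm_dim)
    then show ?thesis using g by (simp add: BC[symmetric] mult_assoc_dim)
  qed
qed

subsection \<open>Tensor powers of matrices\<close>

primrec tensor_mat :: "complex mat \<Rightarrow> nat \<Rightarrow> complex mat" where
  "tensor_mat A 0 = 1\<^sub>m 1"
| "tensor_mat A (Suc d) = kron_mat A (tensor_mat A d)"

lemma rdim_tensor_pow [simp]: "rdim (tensor_pow d U) = rdim U ^ d"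
  by (induction d) simp_all

lemma act_tensor_pow: "act (tensor_pow d U) g = tensor_mat (act U g) d"
  by (induction d) simp_all

lemma tensor_mat_carrier: "A \<in> carrier_mat n m \<Longrightarrow> tensor_mat A d \<in> carrier_mat (n ^ d) (m ^ d)"
  by (induction d) (auto intro: kron_mat_carrier)

lemma tensor_mat_one: "tensor_mat (1\<^sub>m n) d = 1\<^sub>m (n ^ d)"
  by (induction d) (simp_all add: kron_mat_one)

lemma tensor_mat_mult:
  assumes "A \<in> carrier_mat n n" "B \<in> carrier_mat n n"
  shows "tensor_mat (A * B) d = tensor_mat A d * tensor_mat B d"
proof (induction d)
  case (Suc d)
  then show ?case
    using kron_mat_mult[OF assms(1) tensor_mat_carrier[OF assms(1)] assms(2) tensor_mat_carrier[OF assms(2)]] by simp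
qed simp

lemma digit_less: "0 < n \<Longrightarrow> digit n i k < n"
  by (simp add: digit_def)

lemma digit_mod: assumes "k < d" shows "digit n (i mod n ^ d) k = digit n i k"
proof (cases "n = 0")
  case True
  then show ?thesis using assms by (simp add: digit_def power_0_left)
next
  case False
  have "n ^ d = n ^ k * n ^ (d - k)" using assms by (simp add: power_add[symmetric])
  then have "i mod n ^ d div n ^ k = i div n ^ k mod n ^ (d - k)"
    using False by (simp add: mod_mult2_eq)
  moreover have "n dvd n ^ (d - k)" using assms by (simp add: dvd_power)
  ultimately show ?thesis by (simp add: digit_def mod_mod_cancel)
qed

lemma digit_top: assumes "i < n ^ Suc d" shows "digit n i d = i div n ^ d"
proof -
  have "i div n ^ d < n" using assms by (simp add: less_mult_imp_div_less)
  then show ?thesis by (simp add: digit_def)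
qed

lemma tensor_mat_index:
  assumes A: "A \<in> carrier_mat n n" and "i < n ^ d" "j < n ^ d"
  shows "tensor_mat A d $$ (i, j) = (\<Prod>k<d. A $$ (digit n i k, digit n j k))"
  using assms(2,3)
proof (induction d arbitrary: i j)
  case (Suc d)
  have i: "i < n * n ^ d" and j: "j < n * n ^ d" using Suc.prems by auto
  have "tensor_mat A (Suc d) $$ (i, j) = A $$ (i div n ^ d, j div n ^ d) * tensor_mat A d $$ (i mod n ^ d, j mod n ^ d)"
    using kron_mat_index[OF A tensor_mat_carrier[OF A] i j] by simp
  also have "tensor_mat A d $$ (i mod n ^ d, j mod n ^ d) = (\<Prod>k<d. A $$ (digit n i k, digit n j k))"
    using Suc.IH[OF mod_less_mult[OF i] mod_less_mult[OF j]] by (simp add: digit_mod)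
  finally show ?case
    using digit_top[OF Suc.prems(1)] digit_top[OF Suc.prems(2)] by (simp add: mult.commute)
qed simp

lemma digit_eqI:
  assumes "i < n ^ d" "j < n ^ d" "\<And>k. k < d \<Longrightarrow> digit n i k = digit n j k"
  shows "i = j"
  using assms
proof (induction d arbitrary: i j)
  case (Suc d)
  have "i mod n ^ d = j mod n ^ d"
  proof (rule Suc.IH)
    show "i mod n ^ d < n ^ d" "j mod n ^ d < n ^ d"
      using mod_less_mult[of i n "n ^ d"] mod_less_mult[of j n "n ^ d"] Suc.prems by auto
    show "digit n (i mod n ^ d) k = digit n (j mod n ^ d) k" if "k < d" for k
      using Suc.prems(3)[of k] that by (simp add: digit_mod)
  qed
  moreover have "i div n ^ d = j div n ^ d"
    using Suc.prems(3)[of d] digit_top[OF Suc.prems(1)] digit_top[OF Suc.prems(2)] by simp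
  ultimately show ?case by (metis div_mult_mod_eq)
qed simp

section \<open>Place permutations and their traces\<close>

definition digits :: "nat \<Rightarrow> nat \<Rightarrow> nat \<Rightarrow> nat \<Rightarrow> nat" where
  "digits n d i = restrict (digit n i) {..<d}"

lemma digits_bij: "bij_betw (digits n d) {..<n ^ d} (PiE {..<d} (\<lambda>_. {..<n}))"
proof -
  have inj: "inj_on (digits n d) {..<n ^ d}"
  proof (rule inj_onI)
    fix i j assume ij: "i \<in> {..<n ^ d}" "j \<in> {..<n ^ d}" "digits n d i = digits n d j"
    have "digit n i k = digit n j k" if "k < d" for k
      using fun_cong[OF ij(3), of k] that by (simp add: digits_def)
    then show "i = j" using ij by (intro digit_eqI[of i n d j]) auto
  qed
  have "digits n d i \<in> PiE {..<d} (\<lambda>_. {..<n})" if "i < n ^ d" for i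
    using that digit_less[of n i] by (cases "n = 0") (auto simp: digits_def restrict_PiE_iff power_0_left)
  then have "digits n d ` {..<n ^ d} \<subseteq> PiE {..<d} (\<lambda>_. {..<n})" by auto
  moreover have "card (digits n d ` {..<n ^ d}) = card (PiE {..<d} (\<lambda>_. {..<n}))"
    by (simp add: card_image[OF inj] card_PiE)
  ultimately have "digits n d ` {..<n ^ d} = PiE {..<d} (\<lambda>_. {..<n})"
    by (intro card_subset_eq) (auto intro: finite_PiE)
  then show ?thesis using inj by (simp add: bij_betw_def)
qed

text \<open>The column that contains the single 1 in row \<open>i\<close> of
  \<open>place_perm n d q\<close>.\<close>

definition permuted_index :: "nat \<Rightarrow> nat \<Rightarrow> (nat \<Rightarrow> nat) \<Rightarrow> nat \<Rightarrow> nat" where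
  "permuted_index n d q i = (THE l. l < n ^ d \<and> (\<forall>k<d. digit n l k = digit n i (q k)))"

lemma permuted_index:
  assumes q: "q permutes {..<d}" and i: "i < n ^ d"
  shows "permuted_index n d q i < n ^ d" "\<And>k. k < d \<Longrightarrow> digit n (permuted_index n d q i) k = digit n i (q k)"
    "\<And>l. l < n ^ d \<Longrightarrow> (\<forall>k<d. digit n i (q k) = digit n l k) \<longleftrightarrow> l = permuted_index n d q i"
proof -
  have qd: "q k < d" if "k < d" for k using permutes_in_image[OF q] that by auto
  have "digits n d i \<in> PiE {..<d} (\<lambda>_. {..<n})" using bij_betwE[OF digits_bij] i by simp
  from PiE_mem[OF this] have "digit n i k < n" if "k < d" for k using that by (simp add: digits_def)
  then have "restrict (\<lambda>k. digit n i (q k)) {..<d} \<in> PiE {..<d} (\<lambda>_. {..<n})"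
    using qd by (simp add: restrict_PiE_iff)
  then have "restrict (\<lambda>k. digit n i (q k)) {..<d} \<in> digits n d ` {..<n ^ d}"
    by (simp only: bij_betw_imp_surj_on[OF digits_bij])
  then obtain l where l: "restrict (\<lambda>k. digit n i (q k)) {..<d} = digits n d l" "l \<in> {..<n ^ d}"
    by (rule imageE)
  then have l: "l < n ^ d" "digits n d l = restrict (\<lambda>k. digit n i (q k)) {..<d}" by simp_all
  have ld: "digit n l k = digit n i (q k)" if "k < d" for k
    using fun_cong[OF l(2), of k] that by (simp add: digits_def)
  have *: "permuted_index n d q i < n ^ d \<and> (\<forall>k<d. digit n (permuted_index n d q i) k = digit n i (q k))"
    unfolding permuted_index_def
  proof (rule theI'[OF ex1I[of _ l]])
    show "l < n ^ d \<and> (\<forall>k<d. digit n l k = digit n i (q k))" using l ld by simp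
    show "l' = l" if "l' < n ^ d \<and> (\<forall>k<d. digit n l' k = digit n i (q k))" for l'
      by (rule digit_eqI[of _ n d]) (use that l ld in simp_all)
  qed
  then show "permuted_index n d q i < n ^ d" "\<And>k. k < d \<Longrightarrow> digit n (permuted_index n d q i) k = digit n i (q k)"
    by auto
  show "(\<forall>k<d. digit n i (q k) = digit n l k) \<longleftrightarrow> l = permuted_index n d q i" if "l < n ^ d" for l
    using * that digit_eqI[of l n d "permuted_index n d q i"] by metis
qed

lemma place_perm_carrier [simp]: "place_perm n d q \<in> carrier_mat (n ^ d) (n ^ d)"
  by (simp add: place_perm_def)

lemma place_perm_dim [simp]:
  "dim_row (place_perm n d q) = n ^ d" "dim_col (place_perm n d q) = n ^ d"
  by (simp_all add: place_perm_def)

lemma place_perm_index: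
  assumes "q permutes {..<d}" "i < n ^ d" "j < n ^ d"
  shows "place_perm n d q $$ (i, j) = (if j = permuted_index n d q i then 1 else 0)"
  using assms permuted_index(3)[OF assms(1,2,3)] by (simp add: place_perm_def)

lemma place_perm_mult_index:
  assumes q: "q permutes {..<d}" and i: "i < n ^ d" and j: "j < m" and M: "M \<in> carrier_mat (n ^ d) m"
  shows "(place_perm n d q * M) $$ (i, j) = M $$ (permuted_index n d q i, j)"
proof -
  have "(place_perm n d q * M) $$ (i, j) = (\<Sum>l = 0..<n ^ d. if l = permuted_index n d q i then M $$ (l, j) else 0)"
    unfolding mat_mult_index[OF place_perm_carrier M i j]
    by (intro sum.cong) (auto simp: place_perm_index[OF q i])
  then show ?thesis using permuted_index(1)[OF q i] by simp
qed

text \<open>Row \<open>i\<close> of the left factor passes to the index with digits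
  \<open>digit n i (p k)\<close>; reading these at \<open>q k\<close> gives
  \<open>p \<circ> q\<close>. So \<open>place_perm\<close> is a homomorphism, with no reversal of
  the order.\<close>

lemma place_perm_mult:
  assumes p: "p permutes {..<d}" and q: "q permutes {..<d}"
  shows "place_perm n d p * place_perm n d q = place_perm n d (p \<circ> q)"
proof (rule eq_matI)
  fix i j assume "i < dim_row (place_perm n d (p \<circ> q))" "j < dim_col (place_perm n d (p \<circ> q))"
  then have i: "i < n ^ d" and j: "j < n ^ d" by auto
  have qd: "q k < d" if "k < d" for k using permutes_in_image[OF q] that by auto
  have "(place_perm n d p * place_perm n d q) $$ (i, j) = place_perm n d q $$ (permuted_index n d p i, j)"
    by (rule place_perm_mult_index[OF p i j place_perm_carrier])
  then show "(place_perm n d p * place_perm n d q) $$ (i, j) = place_perm n d (p \<circ> q) $$ (i, j)"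
    using i j permuted_index(1,2)[OF p i] qd by (simp add: place_perm_def)
qed auto

lemma place_perm_tensor_index:
  assumes A: "A \<in> carrier_mat n n" and q: "q permutes {..<d}" and i: "i < n ^ d" and j: "j < n ^ d"
  shows "(place_perm n d q * tensor_mat A d) $$ (i, j) = (\<Prod>k<d. A $$ (digit n i (q k), digit n j k))"
  unfolding place_perm_mult_index[OF q i j tensor_mat_carrier[OF A]]
    tensor_mat_index[OF A permuted_index(1)[OF q i] j]
  by (intro prod.cong) (simp_all add: permuted_index(2)[OF q i])

text \<open>Both entries are the same product over the tensor factors, reindexed by
  \<open>q\<close>: the easy half of Schur-Weyl duality.\<close>

lemma place_perm_tensor_commute:
  assumes A: "A \<in> carrier_mat n n" and q: "q permutes {..<d}"
  shows "tensor_mat A d * place_perm n d q = place_perm n d q * tensor_mat A d"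
proof (rule eq_matI)
  note T = tensor_mat_carrier[OF A, of d]
  let ?q' = "Hilbert_Choice.inv q"
  have q': "?q' permutes {..<d}" by (rule permutes_inv[OF q])
  fix i j assume "i < dim_row (place_perm n d q * tensor_mat A d)" "j < dim_col (place_perm n d q * tensor_mat A d)"
  then have i: "i < n ^ d" and j: "j < n ^ d" using T by auto
  have iff: "l = permuted_index n d ?q' j \<longleftrightarrow> j = permuted_index n d q l" if l: "l < n ^ d" for l
  proof -
    have "(\<forall>k<d. digit n j (?q' k) = digit n l k) \<longleftrightarrow> (\<forall>k<d. digit n l (q k) = digit n j k)"
      using permutes_in_image[OF q] permutes_in_image[OF q'] permutes_inverses[OF q]
      by (metis lessThan_iff)
    then show ?thesis using permuted_index(3)[OF q' j l] permuted_index(3)[OF q l j] by simp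
  qed
  have "(tensor_mat A d * place_perm n d q) $$ (i, j) =
      (\<Sum>l = 0..<n ^ d. if l = permuted_index n d ?q' j then tensor_mat A d $$ (i, l) else 0)"
    unfolding mat_mult_index[OF T place_perm_carrier i j]
    by (intro sum.cong) (auto simp: place_perm_index[OF q _ j] iff)
  also have "\<dots> = (\<Prod>k<d. A $$ (digit n i k, digit n j (?q' k)))"
    using permuted_index(1,2)[OF q' j] by (simp add: tensor_mat_index[OF A i])
  also have "\<dots> = (\<Prod>k<d. A $$ (digit n i (q k), digit n j (?q' (q k))))"
    by (rule prod.permute[OF q, unfolded o_def])
  also have "\<dots> = (place_perm n d q * tensor_mat A d) $$ (i, j)"
    unfolding place_perm_tensor_index[OF A q i j] using permutes_inverses[OF q] by simp
  finally show "(tensor_mat A d * place_perm n d q) $$ (i, j) = (place_perm n d q * tensor_mat A d) $$ (i, j)" .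
qed (use tensor_mat_carrier[OF A, of d] in auto)

lemma mtrace_place_perm_tensor:
  assumes A: "A \<in> carrier_mat n n" and q: "q permutes {..<d}"
  shows "mtrace (place_perm n d q * tensor_mat A d) = (\<Sum>f\<in>PiE {..<d} (\<lambda>_. {..<n}). \<Prod>k<d. A $$ (f (q k), f k))"
proof -
  have "mtrace (place_perm n d q * tensor_mat A d) = (\<Sum>i<n ^ d. \<Prod>k<d. A $$ (digit n i (q k), digit n i k))"
    using tensor_mat_carrier[OF A, of d] by (simp add: mtrace_def place_perm_tensor_index[OF A q] del: index_mult_mat(1))
  also have "\<dots> = (\<Sum>i<n ^ d. \<Prod>k<d. A $$ (digits n d i (q k), digits n d i k))"
    using permutes_in_image[OF q] by (intro sum.cong prod.cong) (auto simp: digits_def)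
  also have "\<dots> = (\<Sum>f\<in>PiE {..<d} (\<lambda>_. {..<n}). \<Prod>k<d. A $$ (f (q k), f k))"
    by (rule sum.reindex_bij_betw[OF digits_bij, of "\<lambda>f. \<Prod>k<d. A $$ (f (q k), f k)"])
  finally show ?thesis .
qed

text \<open>For upper triangular \<open>A\<close> a term is nonzero only if \<open>f \<circ> q \<le> f\<close> pointwise, and then
  \<open>f \<circ> q = f\<close>, because both have the same sum.\<close>

lemma mtrace_triangular:
  assumes A: "A \<in> carrier_mat n n" and ut: "upper_triangular A" and q: "q permutes {..<d}"
  shows "mtrace (place_perm n d q * tensor_mat A d) = fixsum (\<lambda>i. A $$ (i, i)) n {..<d} q (\<lambda>_. Suc 0)"
proof -
  let ?F = "PiE {..<d} (\<lambda>_. {..<n})"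
  have qd: "q k < d" if "k < d" for k using permutes_in_image[OF q] that by auto
  have 0: "(\<Prod>k<d. A $$ (f (q k), f k)) = (if \<forall>k\<in>{..<d}. f (q k) = f k then \<Prod>k<d. A $$ (f k, f k) ^ Suc 0 else 0)"
    if f: "f \<in> ?F" for f
  proof (cases "\<forall>k<d. f (q k) \<le> f k")
    case True
    have "(\<Sum>k<d. f (q k)) = (\<Sum>k<d. f k)" using sum.permute[OF q, of f] by (simp add: o_def)
    then have "\<forall>k\<in>{..<d}. f (q k) = f k"
      using True sum_mono_inv[of "\<lambda>k. f (q k)" "{..<d}" f] by (metis finite_lessThan lessThan_iff)
    then show ?thesis by (auto intro!: prod.cong)
  next
    case False
    then obtain k where k: "k < d" "f k < f (q k)" by (auto simp: not_le)
    have "f (q k) < n" using f qd[OF k(1)] by (auto simp: PiE_def)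
    then have "A $$ (f (q k), f k) = 0" using ut k A by (auto simp: upper_triangular_def)
    then show ?thesis using k by (auto intro!: prod_zero)
  qed
  have "mtrace (place_perm n d q * tensor_mat A d) = (\<Sum>f\<in>?F. if \<forall>k\<in>{..<d}. f (q k) = f k then \<Prod>k<d. A $$ (f k, f k) ^ Suc 0 else 0)"
    unfolding mtrace_place_perm_tensor[OF A q] by (intro sum.cong refl 0)
  also have "\<dots> = fixsum (\<lambda>i. A $$ (i, i)) n {..<d} q (\<lambda>_. Suc 0)"
    unfolding fixsum_def by (intro sum.inter_filter[symmetric] finite_PiE) auto
  finally show ?thesis .
qed

lemma matpow_triangular:
  assumes A: "A \<in> carrier_mat n n" and ut: "upper_triangular A"
  shows "i < n \<Longrightarrow> j \<le> i \<Longrightarrow> matpow n A k $$ (i, j) = (if i = j then A $$ (i, i) ^ k else 0)"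
proof (induction k arbitrary: i j)
  case (Suc k)
  have A0: "A $$ (i, l) = 0" if "l < i" for l using ut A Suc.prems that by (auto simp: upper_triangular_def)
  have "matpow n A (Suc k) $$ (i, j) = (\<Sum>l = 0..<n. A $$ (i, l) * matpow n A k $$ (l, j))"
    using mat_mult_index[OF A matpow_carrier[OF A], of i j] Suc.prems by simp
  also have "\<dots> = (\<Sum>l = 0..<n. if l = i then A $$ (i, i) * matpow n A k $$ (i, j) else 0)"
  proof (rule sum.cong[OF refl])
    fix l assume l: "l \<in> {0..<n}"
    consider "l < i" | "l = i" | "i < l" by linarith
    then show "A $$ (i, l) * matpow n A k $$ (l, j) = (if l = i then A $$ (i, i) * matpow n A k $$ (i, j) else 0)"
      using A0[of l] Suc.IH[of l j] l Suc.prems by cases auto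
  qed
  finally show ?case using Suc by simp
qed auto

text \<open>\<open>A\<close> is similar to a triangular \<open>B\<close>, and tensor powers of the
  similarity matrix commute with place permutations, so \<open>y\<close> can be the diagonal of
  \<open>B\<close>. One \<open>y\<close> serves all degrees \<open>d\<close>, all matrix powers and
  the determinant.\<close>

lemma eigenvalues:
  assumes A: "A \<in> carrier_mat n n"
  obtains y where "\<And>d q. q permutes {..<d} \<Longrightarrow>
      mtrace (place_perm n d q * tensor_mat A d) = fixsum y n {..<d} q (\<lambda>_. Suc 0)"
    "\<And>k. mtrace (matpow n A k) = psum y n k" "det A = (\<Prod>i<n. y i)"
proof -
  obtain es where "char_poly A = (\<Prod>a\<leftarrow>es. [:- a, 1:])" using char_poly_factorized[OF A] by blast
  from schur_decomposition_exists[OF A this] obtain B where B: "B \<in> carrier_mat n n"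
    and ut: "upper_triangular B" and sim: "similar_mat A B" by blast
  from sim obtain P Q where "similar_mat_wit A B P Q" unfolding similar_mat_def by blast
  from similar_mat_witD2[OF A this] have P: "P \<in> carrier_mat n n" and Q: "Q \<in> carrier_mat n n"
    and PQ: "P * Q = 1\<^sub>m n" and QP: "Q * P = 1\<^sub>m n" and APQ: "A = P * B * Q" by auto
  note [simp] = carrier_matD[OF P] carrier_matD[OF Q] carrier_matD[OF B] carrier_matD[OF A]
  define y where "y i = B $$ (i, i)" for i
  show thesis
  proof (rule that[of y])
    fix d :: nat and q assume q: "q permutes {..<d}"
    let ?T = "\<lambda>M. tensor_mat M d" and ?\<pi> = "place_perm n d q"
    note T = tensor_mat_carrier[of _ n n d]
    note [simp] = carrier_matD[OF T[OF P]] carrier_matD[OF T[OF Q]] carrier_matD[OF T[OF B]]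
    have "?T A = ?T P * (?T B * ?T Q)"
      unfolding APQ by (simp add: tensor_mat_mult[of _ n] P Q B mult_carrier_mat[of _ n n _ n] mult_assoc_dim)
    then have "?\<pi> * ?T A = ?T P * (?\<pi> * ?T B * ?T Q)"
      using place_perm_tensor_commute[OF P q] by (simp add: mult_assoc_dim[symmetric])
    then have "mtrace (?\<pi> * ?T A) = mtrace (?\<pi> * ?T B * ?T Q * ?T P)"
      by (simp add: mtrace_comm_dim)
    also have "?\<pi> * ?T B * ?T Q * ?T P = ?\<pi> * ?T B * ?T (Q * P)"
      by (simp add: tensor_mat_mult[OF Q P] mult_assoc_dim)
    also have "\<dots> = ?\<pi> * ?T B" unfolding QP tensor_mat_one by simp
    finally show "mtrace (?\<pi> * ?T A) = fixsum y n {..<d} q (\<lambda>_. Suc 0)"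
      unfolding mtrace_triangular[OF B ut q] y_def .
  next
    fix k
    note [simp] = carrier_matD[OF matpow_carrier[OF B]] carrier_matD[OF matpow_carrier[OF A]]
    have "matpow n A k = P * (matpow n B k * Q)"
    proof (induction k)
      case (Suc k)
      have "matpow n A (Suc k) = P * (B * ((Q * P) * (matpow n B k * Q)))"
        using Suc.IH by (simp add: APQ mult_assoc_dim)
      then show ?case by (simp add: QP mult_assoc_dim)
    qed (simp add: PQ)
    then have "mtrace (matpow n A k) = mtrace (P * (matpow n B k * Q))" by simp
    also have "\<dots> = mtrace (matpow n B k * Q * P)" by (rule mtrace_comm_dim) simp_all
    also have "matpow n B k * Q * P = matpow n B k * (Q * P)" by (simp add: mult_assoc_dim)
    finally have "mtrace (matpow n A k) = mtrace (matpow n B k * (Q * P))" .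
    then show "mtrace (matpow n A k) = psum y n k"
      using matpow_triangular[OF B ut] by (simp add: QP mtrace_def psum_def y_def)
  next
    have "det A = prod_list (diag_mat B)" using det_similar[OF sim] det_upper_triangular[OF ut B] by simp
    also have "\<dots> = (\<Prod>i<n. y i)"
      by (simp add: diag_mat_def y_def prod.distinct_set_conv_list[symmetric] atLeast0LessThan)
    finally show "det A = (\<Prod>i<n. y i)" .
  qed
qed

subsection \<open>Complete symmetric functions in terms of power sums\<close>

text \<open>Newton's recursion m h_m = p_1 h_(m-1) + ... + p_m h_0, taken as a definition for an
  arbitrary sequence \<open>p\<close>, so that it also applies to the power sums of the symmetric
  square.\<close>

fun newton_h :: "(nat \<Rightarrow> complex) \<Rightarrow> nat \<Rightarrow> complex" where
  "newton_h p 0 = 1"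
| "newton_h p (Suc m) = (\<Sum>i\<le>m. p (Suc i) * newton_h p (m - i)) / of_nat (Suc m)"

definition permsum :: "(nat \<Rightarrow> complex) \<Rightarrow> nat \<Rightarrow> nat set \<Rightarrow> (nat \<Rightarrow> nat) \<Rightarrow> complex" where
  "permsum y n S w = (\<Sum>q\<in>colour_group S (\<lambda>_. 0). fixsum y n S q w)"

lemma permsum_cong: "(\<And>k. k \<in> S \<Longrightarrow> w k = w' k) \<Longrightarrow> permsum y n S w = permsum y n S w'"
  unfolding permsum_def fixsum_def by (intro sum.cong prod.cong refl) auto

lemma permsum_insert:
  assumes S: "finite S" "a \<notin> S"
  shows "permsum y n (insert a S) w = psum y n (w a) * permsum y n S w + (\<Sum>b\<in>S. permsum y n S (w(b := w b + w a)))"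
proof -
  have "permsum y n (insert a S) w = (\<Sum>b\<in>insert a S. \<Sum>q\<in>colour_group S (\<lambda>_. 0).
      fixsum y n (insert a S) (transpose a b \<circ> q) w)"
    unfolding permsum_def colour_group_sum_insert[OF S(2)] by (intro sum.cong) auto
  also have "\<dots> = (\<Sum>b\<in>insert a S. if b = a then psum y n (w a) * permsum y n S w else permsum y n S (w(b := w b + w a)))"
    unfolding permsum_def sum_distrib_left
    by (intro sum.cong refl) (auto intro!: sum.cong simp: fixsum_insert[OF S] colour_group_def)
  also have "\<dots> = psum y n (w a) * permsum y n S w + (\<Sum>b\<in>S. permsum y n S (w(b := w b + w a)))"
    using S by (auto intro!: sum.cong)
  finally show ?thesis .
qed

text \<open>In the second clause the marked point \<open>a\<close> has weight \<open>j\<close>. If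
  its cycle has \<open>i\<close> further points, they can be arranged in m!/(m-i)! ways, the cycle
  contributes p_(j+i), and the rest contributes (m-i)! h_(m-i). The induction contracts one point at
  a time, raising \<open>j\<close> by 1; with \<open>j = 1\<close> Newton's recursion gives the
  first clause for m + 1.\<close>

lemma permsum_newton:
  "(\<forall>S. finite S \<longrightarrow> card S = m \<longrightarrow> permsum y n S (\<lambda>_. Suc 0) = fact m * newton_h (psum y n) m) \<and>
   (\<forall>S a j. finite S \<longrightarrow> card S = m \<longrightarrow> a \<notin> S \<longrightarrow>
     permsum y n (insert a S) ((\<lambda>_. Suc 0)(a := j)) = fact m * (\<Sum>i\<le>m. psum y n (j + i) * newton_h (psum y n) (m - i)))"
proof (induction m)
  case 0
  have "colour_group {} (\<lambda>_. 0) = {id}" by (auto simp: colour_group_def)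
  then have e: "permsum y n {} w = 1" for w by (simp add: permsum_def fixsum_def)
  show ?case by (auto simp: permsum_insert e)
next
  case (Suc m)
  let ?h = "newton_h (psum y n)"
  have one: "permsum y n S (\<lambda>_. Suc 0) = fact (Suc m) * ?h (Suc m)" if S: "finite S" "card S = Suc m" for S
  proof -
    obtain a S' where S': "S = insert a S'" "a \<notin> S'" "card S' = m" "finite S'"
      using S by (metis card_Suc_eq finite_insert)
    have 1: "(\<lambda>_. Suc 0)(a := Suc 0) = (\<lambda>_. Suc 0)" by auto
    have "permsum y n S (\<lambda>_. Suc 0) = fact m * (\<Sum>i\<le>m. psum y n (Suc 0 + i) * ?h (m - i))"
      using Suc.IH[THEN conjunct2, rule_format, OF S'(4,3,2), of "Suc 0"] 1
      by (simp only: S'(1)[symmetric])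
    also have "(\<Sum>i\<le>m. psum y n (Suc 0 + i) * ?h (m - i)) = of_nat (Suc m) * ?h (Suc m)"
      by (simp del: of_nat_Suc)
    finally show ?thesis by (simp add: mult_ac del: newton_h.simps)
  qed
  have "permsum y n (insert a S) ((\<lambda>_. Suc 0)(a := j)) = fact (Suc m) * (\<Sum>i\<le>Suc m. psum y n (j + i) * ?h (Suc m - i))"
    if S: "finite S" "card S = Suc m" "a \<notin> S" for S a j
  proof -
    have "permsum y n (insert a S) ((\<lambda>_. Suc 0)(a := j)) = psum y n j * permsum y n S (\<lambda>_. Suc 0) +
        (\<Sum>b\<in>S. permsum y n S ((\<lambda>_. Suc 0)(b := Suc j)))"
      unfolding permsum_insert[OF S(1,3)] using S(3)
      by (intro arg_cong2[where f = plus] arg_cong2[where f = times] sum.cong permsum_cong) auto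
    also have "(\<Sum>b\<in>S. permsum y n S ((\<lambda>_. Suc 0)(b := Suc j))) =
        (\<Sum>b\<in>S. fact m * (\<Sum>i\<le>m. psum y n (Suc j + i) * ?h (m - i)))"
    proof (rule sum.cong[OF refl])
      fix b assume b: "b \<in> S"
      then have "card (S - {b}) = m" using S by simp
      from Suc.IH[THEN conjunct2, rule_format, OF finite_Diff[OF S(1)] this, of b "Suc j"] b
      show "permsum y n S ((\<lambda>_. Suc 0)(b := Suc j)) = fact m * (\<Sum>i\<le>m. psum y n (Suc j + i) * ?h (m - i))"
        by (simp add: insert_absorb del: newton_h.simps)
    qed
    also have "\<dots> = fact (Suc m) * (\<Sum>i\<le>m. psum y n (j + Suc i) * ?h (Suc m - Suc i))"
      using S(2) by (simp del: newton_h.simps)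
    finally show ?thesis
      unfolding one[OF S(1,2)] sum.atMost_Suc_shift
      by (simp add: distrib_left mult.left_commute del: newton_h.simps fun_upd_apply)
  qed
  then show ?case using one by blast
qed

subsection \<open>Combinations of place permutations\<close>

lemma colour_group_permutes: "p \<in> colour_group S c \<Longrightarrow> p permutes S"
  by (simp add: colour_group_def)

lemma colour_group_comp:
  assumes "p \<in> colour_group S c" "q \<in> colour_group S c"
  shows "p \<circ> q \<in> colour_group S c"
proof -
  have "q k \<in> S" if "k \<in> S" for k
    using permutes_in_image[OF colour_group_permutes[OF assms(2)]] that by simp
  then show ?thesis
    using assms permutes_compose[of q S p] by (simp add: colour_group_def)
qed

lemma colour_group_inv:
  assumes "p \<in> colour_group S c"
  shows "Hilbert_Choice.inv p \<in> colour_group S c"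
proof -
  note p = colour_group_permutes[OF assms]
  have "c (Hilbert_Choice.inv p k) = c k" if "k \<in> S" for k
  proof -
    have "Hilbert_Choice.inv p k \<in> S" using permutes_in_image[OF permutes_inv[OF p]] that by simp
    then have "c (p (Hilbert_Choice.inv p k)) = c (Hilbert_Choice.inv p k)"
      using assms by (simp add: colour_group_def)
    then show ?thesis by (simp add: permutes_inverses[OF p])
  qed
  then show ?thesis using permutes_inv[OF p] by (simp add: colour_group_def)
qed

lemma permutes_inv_comp:
  assumes "p permutes S"
  shows "Hilbert_Choice.inv p \<circ> (p \<circ> q) = q" "p \<circ> (Hilbert_Choice.inv p \<circ> q) = q"
    "q \<circ> p \<circ> Hilbert_Choice.inv p = q" "q \<circ> Hilbert_Choice.inv p \<circ> p = q"
  using permutes_inverses[OF assms] by (simp_all add: fun_eq_iff)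

lemma sum_colour_group_left:
  assumes t: "t \<in> colour_group S c"
  shows "(\<Sum>q\<in>colour_group S c. F (t \<circ> q)) = (\<Sum>q\<in>colour_group S c. F q)"
  by (rule sum.reindex_bij_witness[where i = "\<lambda>q. Hilbert_Choice.inv t \<circ> q" and j = "\<lambda>q. t \<circ> q"])
    (simp_all only: permutes_inv_comp[OF colour_group_permutes[OF t]] colour_group_comp t colour_group_inv)

lemma sum_colour_group_right:
  assumes t: "t \<in> colour_group S c"
  shows "(\<Sum>q\<in>colour_group S c. F (q \<circ> t)) = (\<Sum>q\<in>colour_group S c. F q)"
  by (rule sum.reindex_bij_witness[where i = "\<lambda>q. q \<circ> Hilbert_Choice.inv t" and j = "\<lambda>q. q \<circ> t"])
    (simp_all only: permutes_inv_comp[OF colour_group_permutes[OF t]] colour_group_comp t colour_group_inv)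

lemma sum_colour_group_inv:
  "(\<Sum>q\<in>colour_group S c. F (Hilbert_Choice.inv q)) = (\<Sum>q\<in>colour_group S c. F q)"
  by (rule sum.reindex_bij_witness[where i = Hilbert_Choice.inv and j = Hilbert_Choice.inv])
    (auto simp: colour_group_inv permutes_inv_inv[OF colour_group_permutes])

lemma one_smult_mat [simp]: "(1 :: complex) \<cdot>\<^sub>m A = A"
  by (rule eq_matI) auto

text \<open>The element of the group algebra with coefficients \<open>x\<close> on \<open>A\<close>,
  acting on the \<open>d\<close>-th tensor power.\<close>

definition perm_sum :: "nat \<Rightarrow> nat \<Rightarrow> (nat \<Rightarrow> nat) set \<Rightarrow> ((nat \<Rightarrow> nat) \<Rightarrow> complex) \<Rightarrow> complex mat" where
  "perm_sum n d A x = mat (n ^ d) (n ^ d) (\<lambda>ij. \<Sum>q\<in>A. x q * place_perm n d q $$ ij)"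

lemma perm_sum_carrier [simp]: "perm_sum n d A x \<in> carrier_mat (n ^ d) (n ^ d)"
  by (simp add: perm_sum_def)

lemma perm_sum_dim [simp]: "dim_row (perm_sum n d A x) = n ^ d" "dim_col (perm_sum n d A x) = n ^ d"
  by (simp_all add: perm_sum_def)

lemma perm_sum_index: "i < n ^ d \<Longrightarrow> j < n ^ d \<Longrightarrow>
    perm_sum n d A x $$ (i, j) = (\<Sum>q\<in>A. x q * place_perm n d q $$ (i, j))"
  by (simp add: perm_sum_def)

lemma mult_perm_sum_index:
  assumes M: "M \<in> carrier_mat m (n ^ d)" and i: "i < m" and j: "j < n ^ d"
  shows "(M * perm_sum n d A x) $$ (i, j) = (\<Sum>q\<in>A. x q * (M * place_perm n d q) $$ (i, j))"
proof -
  have "(M * perm_sum n d A x) $$ (i, j) = (\<Sum>k = 0..<n ^ d. \<Sum>q\<in>A. x q * (M $$ (i, k) * place_perm n d q $$ (k, j)))"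
    unfolding mat_mult_index[OF M perm_sum_carrier i j]
    using j by (intro sum.cong refl) (simp add: perm_sum_index sum_distrib_left mult_ac)
  also have "\<dots> = (\<Sum>q\<in>A. \<Sum>k = 0..<n ^ d. x q * (M $$ (i, k) * place_perm n d q $$ (k, j)))"
    by (rule sum.swap)
  also have "\<dots> = (\<Sum>q\<in>A. x q * (M * place_perm n d q) $$ (i, j))"
    unfolding mat_mult_index[OF M place_perm_carrier i j] by (simp only: sum_distrib_left)
  finally show ?thesis .
qed

lemma mult_perm_sum_mult_index:
  assumes M: "M \<in> carrier_mat m (n ^ d)" and N: "N \<in> carrier_mat (n ^ d) m'" and i: "i < m" and j: "j < m'"
  shows "(M * perm_sum n d A x * N) $$ (i, j) = (\<Sum>q\<in>A. x q * (M * place_perm n d q * N) $$ (i, j))"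
proof -
  have c: "M * perm_sum n d A x \<in> carrier_mat m (n ^ d)" "\<And>q. M * place_perm n d q \<in> carrier_mat m (n ^ d)"
    using M by auto
  have "(M * perm_sum n d A x * N) $$ (i, j) = (\<Sum>k = 0..<n ^ d. \<Sum>q\<in>A. x q * ((M * place_perm n d q) $$ (i, k) * N $$ (k, j)))"
    unfolding mat_mult_index[OF c(1) N i j]
    using i by (intro sum.cong refl) (simp add: mult_perm_sum_index[OF M i] sum_distrib_left sum_distrib_right mult_ac del: index_mult_mat(1))
  also have "\<dots> = (\<Sum>q\<in>A. \<Sum>k = 0..<n ^ d. x q * ((M * place_perm n d q) $$ (i, k) * N $$ (k, j)))"
    by (rule sum.swap)
  also have "\<dots> = (\<Sum>q\<in>A. x q * (M * place_perm n d q * N) $$ (i, j))"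
    unfolding mat_mult_index[OF c(2) N i j] by (simp only: sum_distrib_left)
  finally show ?thesis .
qed

lemma perm_sum_mult_index:
  assumes N: "N \<in> carrier_mat (n ^ d) m'" and i: "i < n ^ d" and j: "j < m'"
  shows "(perm_sum n d A x * N) $$ (i, j) = (\<Sum>q\<in>A. x q * (place_perm n d q * N) $$ (i, j))"
  using mult_perm_sum_mult_index[OF one_carrier_mat N i j, of A x] by simp

lemma tensor_perm_sum_commute:
  assumes T: "T \<in> carrier_mat n n" and A: "\<And>q. q \<in> A \<Longrightarrow> q permutes {..<d}"
  shows "tensor_mat T d * perm_sum n d A x = perm_sum n d A x * tensor_mat T d"
proof (rule square_mat_eqI[of _ "n ^ d"])
  note Tc = tensor_mat_carrier[OF T, of d]
  show "tensor_mat T d * perm_sum n d A x \<in> carrier_mat (n ^ d) (n ^ d)"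
    "perm_sum n d A x * tensor_mat T d \<in> carrier_mat (n ^ d) (n ^ d)"
    using Tc by auto
  fix i j assume "i < n ^ d" "j < n ^ d"
  then show "(tensor_mat T d * perm_sum n d A x) $$ (i, j) = (perm_sum n d A x * tensor_mat T d) $$ (i, j)"
    by (simp add: mult_perm_sum_index[OF Tc] perm_sum_mult_index[OF Tc] place_perm_tensor_commute[OF T A]
        del: index_mult_mat(1))
qed

lemma mtrace_mult_perm_sum:
  assumes M: "M \<in> carrier_mat (n ^ d) (n ^ d)"
  shows "mtrace (M * perm_sum n d A x) = (\<Sum>q\<in>A. x q * mtrace (M * place_perm n d q))"
proof -
  have "mtrace (M * perm_sum n d A x) = (\<Sum>i<n ^ d. \<Sum>q\<in>A. x q * (M * place_perm n d q) $$ (i, i))"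
    using M by (simp add: mtrace_def mult_perm_sum_index[OF M] del: index_mult_mat(1))
  also have "\<dots> = (\<Sum>q\<in>A. \<Sum>i<n ^ d. x q * (M * place_perm n d q) $$ (i, i))" by (rule sum.swap)
  also have "\<dots> = (\<Sum>q\<in>A. x q * mtrace (M * place_perm n d q))"
    using M by (simp add: mtrace_def sum_distrib_left del: index_mult_mat(1))
  finally show ?thesis .
qed

text \<open>Reindexing the sum by \<open>t\<close>. The factor \<open>z\<close> is 1 for row sums;
  in the version for right multiplication it is also the sign of \<open>t\<close>, which is its own
  inverse.\<close>

lemma place_perm_absorb_left:
  assumes t: "t \<in> colour_group {..<d} c" and x: "\<And>q. q \<in> colour_group {..<d} c \<Longrightarrow> x (t \<circ> q) = z * x q"
  shows "z \<cdot>\<^sub>m (place_perm n d t * perm_sum n d (colour_group {..<d} c) x) = perm_sum n d (colour_group {..<d} c) x"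
proof (rule square_mat_eqI[of _ "n ^ d"])
  let ?G = "colour_group {..<d} c"
  note tp = colour_group_permutes[OF t]
  fix i j assume i: "i < n ^ d" and j: "j < n ^ d"
  have "z * (place_perm n d t * perm_sum n d ?G x) $$ (i, j) = z * (\<Sum>q\<in>?G. x q * place_perm n d (t \<circ> q) $$ (i, j))"
    using place_perm_mult[OF tp colour_group_permutes, of _ c]
    by (simp add: mult_perm_sum_index[OF place_perm_carrier i j] cong: sum.cong del: index_mult_mat(1))
  also have "\<dots> = (\<Sum>q\<in>?G. x (t \<circ> q) * place_perm n d (t \<circ> q) $$ (i, j))"
    by (simp add: x sum_distrib_left mult.assoc)
  also have "\<dots> = (\<Sum>q\<in>?G. x q * place_perm n d q $$ (i, j))" by (rule sum_colour_group_left[OF t])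
  finally show "(z \<cdot>\<^sub>m (place_perm n d t * perm_sum n d ?G x)) $$ (i, j) = perm_sum n d ?G x $$ (i, j)"
    using i j by (simp add: perm_sum_index del: index_mult_mat(1))
qed auto

lemma place_perm_absorb_right:
  assumes t: "t \<in> colour_group {..<d} c" and x: "\<And>q. q \<in> colour_group {..<d} c \<Longrightarrow> x (q \<circ> t) = z * x q"
  shows "z \<cdot>\<^sub>m (perm_sum n d (colour_group {..<d} c) x * place_perm n d t) = perm_sum n d (colour_group {..<d} c) x"
proof (rule square_mat_eqI[of _ "n ^ d"])
  let ?G = "colour_group {..<d} c"
  note tp = colour_group_permutes[OF t]
  fix i j assume i: "i < n ^ d" and j: "j < n ^ d"
  have "z * (perm_sum n d ?G x * place_perm n d t) $$ (i, j) = z * (\<Sum>q\<in>?G. x q * place_perm n d (q \<circ> t) $$ (i, j))"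
    using place_perm_mult[OF colour_group_permutes tp, of _ c]
    by (simp add: perm_sum_mult_index[OF place_perm_carrier i j] cong: sum.cong del: index_mult_mat(1))
  also have "\<dots> = (\<Sum>q\<in>?G. x (q \<circ> t) * place_perm n d (q \<circ> t) $$ (i, j))"
    by (simp add: x sum_distrib_left mult.assoc)
  also have "\<dots> = (\<Sum>q\<in>?G. x q * place_perm n d q $$ (i, j))" by (rule sum_colour_group_right[OF t])
  finally show "(z \<cdot>\<^sub>m (perm_sum n d ?G x * place_perm n d t)) $$ (i, j) = perm_sum n d ?G x $$ (i, j)"
    using i j by (simp add: perm_sum_index del: index_mult_mat(1))
qed auto

subsection \<open>Symmetric powers\<close>

lemma colour_group_trivial: "colour_group S (\<lambda>_. 0) = {q. q permutes S}"
  by (simp add: colour_group_def)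

definition symmetrizer :: "nat \<Rightarrow> nat \<Rightarrow> complex mat" where
  "symmetrizer n d = perm_sum n d (colour_group {..<d} (\<lambda>_. 0)) (\<lambda>_. 1 / fact d)"

lemma symmetrizer_carrier [simp]: "symmetrizer n d \<in> carrier_mat (n ^ d) (n ^ d)"
  by (simp add: symmetrizer_def)

lemma symmetrizer_dim [simp]: "dim_row (symmetrizer n d) = n ^ d" "dim_col (symmetrizer n d) = n ^ d"
  by (simp_all add: symmetrizer_def)

lemma symmetrizer_place_perm:
  assumes "q permutes {..<d}"
  shows "place_perm n d q * symmetrizer n d = symmetrizer n d" "symmetrizer n d * place_perm n d q = symmetrizer n d"
  using place_perm_absorb_left[of q d "\<lambda>_. 0" "\<lambda>_. 1 / fact d" 1 n]
    place_perm_absorb_right[of q d "\<lambda>_. 0" "\<lambda>_. 1 / fact d" 1 n] assms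
  by (simp_all add: symmetrizer_def colour_group_trivial)

lemma symmetrizer_idem: "symmetrizer n d * symmetrizer n d = symmetrizer n d"
proof (rule square_mat_eqI[of _ "n ^ d"])
  fix i j assume i: "i < n ^ d" and j: "j < n ^ d"
  have "(symmetrizer n d * symmetrizer n d) $$ (i, j) = (\<Sum>q\<in>{q. q permutes {..<d}}. 1 / fact d * (place_perm n d q * symmetrizer n d) $$ (i, j))"
    using perm_sum_mult_index[OF symmetrizer_carrier i j, of "colour_group {..<d} (\<lambda>_. 0)" "\<lambda>_. 1 / fact d",
        folded symmetrizer_def]
    by (simp only: colour_group_trivial)
  also have "\<dots> = symmetrizer n d $$ (i, j)"
    by (simp add: symmetrizer_place_perm card_permutations[of _ d] del: index_mult_mat(1))
  finally show "(symmetrizer n d * symmetrizer n d) $$ (i, j) = symmetrizer n d $$ (i, j)" .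
qed auto

text \<open>A vector v killed by the symmetrizer is the average of the differences v - q v over all
  permutations q, hence lies in the span of the relations. Conversely the symmetrizer absorbs q and
  kills each difference.\<close>

lemma kernel_symmetrizer: "mat_kernel (symmetrizer n d) = sym_relations n d"
proof -
  let ?N = "n ^ d" and ?S = "symmetrizer n d"
  let ?G = "{v - place_perm n d q *\<^sub>v v | v q. v \<in> carrier_vec (n ^ d) \<and> q permutes {..<d}}"
  interpret V: vec_space "TYPE(complex)" ?N .
  interpret K: kernel ?N ?N ?S by unfold_locales simp
  have G: "?G \<subseteq> carrier_vec ?N"
    using mult_mat_vec_carrier[OF place_perm_carrier] by (auto intro!: minus_carrier_vec)
  have "?G \<subseteq> mat_kernel ?S"
  proof
    fix w assume "w \<in> ?G"
    then obtain v q where w: "w = v - place_perm n d q *\<^sub>v v" "v \<in> carrier_vec ?N" "q permutes {..<d}" by blast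
    have Pv: "place_perm n d q *\<^sub>v v \<in> carrier_vec ?N" by (simp add: mult_mat_vec_carrier[OF place_perm_carrier w(2)])
    have "?S *\<^sub>v w = ?S *\<^sub>v v - ?S *\<^sub>v (place_perm n d q *\<^sub>v v)"
      unfolding w(1) by (rule mult_minus_distrib_mat_vec[OF symmetrizer_carrier w(2) Pv])
    also have "?S *\<^sub>v (place_perm n d q *\<^sub>v v) = ?S *\<^sub>v v"
      using assoc_mult_mat_vec[OF symmetrizer_carrier place_perm_carrier[of n d q] w(2)] by (simp add: symmetrizer_place_perm(2)[OF w(3)])
    finally show "w \<in> mat_kernel ?S"
      using w Pv by (intro mat_kernelI[OF symmetrizer_carrier]) auto
  qed
  moreover have "submodule class_ring (mat_kernel ?S) V.V"
    by unfold_locales (use mult_add_distrib_mat_vec[OF symmetrizer_carrier] mult_mat_vec[OF symmetrizer_carrier]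
      mat_kernel[OF symmetrizer_carrier] in \<open>auto simp: class_ring_simps\<close>)
  ultimately have 1: "V.span ?G \<subseteq> mat_kernel ?S" by (rule V.span_is_subset)
  have 2: "v \<in> V.span ?G" if v: "v \<in> mat_kernel ?S" for v
  proof -
    from v have vc: "v \<in> carrier_vec ?N" and Sv: "?S *\<^sub>v v = 0\<^sub>v ?N" using mat_kernelD[OF symmetrizer_carrier] by auto
    \<comment> \<open>The sum of the differences is built up over finite sets of permutations and
      described by its coordinates.\<close>
    have "\<exists>u\<in>V.span ?G. \<forall>i<?N. u $ i = (\<Sum>q\<in>A. (v - place_perm n d q *\<^sub>v v) $ i)"
      if "finite A" "A \<subseteq> {q. q permutes {..<d}}" for A
      using that
    proof (induction A rule: finite_induct)
      case empty
      have "0\<^sub>v ?N \<in> V.span ?G" using V.span_zero by simp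
      then show ?case by (intro bexI[of _ "0\<^sub>v ?N"]) auto
    next
      case (insert q A)
      then obtain u where u: "u \<in> V.span ?G" "\<forall>i<?N. u $ i = (\<Sum>q\<in>A. (v - place_perm n d q *\<^sub>v v) $ i)" by auto
      have uc: "u \<in> carrier_vec ?N" using V.span_closed[OF _ u(1)] G by simp
      have "v - place_perm n d q *\<^sub>v v \<in> ?G" using vc insert.prems by auto
      then have w: "v - place_perm n d q *\<^sub>v v \<in> V.span ?G" using V.in_own_span[of ?G] G by auto
      have "(v - place_perm n d q *\<^sub>v v) + u \<in> V.span ?G" using V.span_add1[OF _ w u(1)] G by simp
      then show ?case using u(2) uc insert.hyps
        by (intro bexI[of _ "(v - place_perm n d q *\<^sub>v v) + u"]) (auto simp del: index_mult_mat_vec)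
    qed
    from this[of "{q. q permutes {..<d}}"] obtain u where u: "u \<in> V.span ?G"
      "\<And>i. i < ?N \<Longrightarrow> u $ i = (\<Sum>q | q permutes {..<d}. (v - place_perm n d q *\<^sub>v v) $ i)"
      using finite_permutations[of "{..<d}"] by blast
    have uc: "u \<in> carrier_vec ?N" using V.span_closed[OF _ u(1)] G by simp
    have "v = (1 / fact d) \<cdot>\<^sub>v u"
    proof (rule eq_vecI)
      fix i assume "i < dim_vec ((1 / fact d) \<cdot>\<^sub>v u)"
      then have i: "i < ?N" using uc by auto
      have "(?S *\<^sub>v v) $ i = (\<Sum>k = 0..<?N. (\<Sum>q | q permutes {..<d}. 1 / fact d * place_perm n d q $$ (i, k)) * v $ k)"
        using i vc by (auto simp: scalar_prod_def symmetrizer_def perm_sum_index colour_group_trivial intro!: sum.cong)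
      also have "\<dots> = (\<Sum>q | q permutes {..<d}. 1 / fact d * (place_perm n d q *\<^sub>v v) $ i)"
        unfolding sum_distrib_right
        by (subst sum.swap) (use i vc in \<open>auto simp: scalar_prod_def sum_distrib_left mult_ac intro!: sum.cong\<close>)
      finally have "(\<Sum>q | q permutes {..<d}. 1 / fact d * (place_perm n d q *\<^sub>v v) $ i) = 0" using Sv i by simp
      then have 0: "(\<Sum>q | q permutes {..<d}. (place_perm n d q *\<^sub>v v) $ i) = 0"
        unfolding sum_distrib_left[symmetric] by simp
      have "u $ i = (\<Sum>q | q permutes {..<d}. v $ i - (place_perm n d q *\<^sub>v v) $ i)"
        unfolding u(2)[OF i] using i vc by (intro sum.cong refl) (simp del: index_mult_mat_vec)
      also have "\<dots> = fact d * v $ i"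
        unfolding sum_subtractf 0 by (simp add: card_permutations[of _ d])
      finally show "v $ i = ((1 / fact d) \<cdot>\<^sub>v u) $ i" using i uc by simp
    qed (use uc vc in auto)
    then show ?thesis by (rule ssubst) (rule V.smult_in_span[OF G u(1)])
  qed
  show ?thesis unfolding sym_relations_def using 1 2 by auto
qed

text \<open>The trace on the quotient is the average of the traces of all permutations against the
  action, that is, the cycle index of the symmetric group at the power sums;
  \<open>permsum_newton\<close> evaluates it.\<close>

lemma sym_power_char:
  assumes m: "m \<ge> 0" and g: "g \<in> SL4"
    and y: "\<And>d q. q permutes {..<d} \<Longrightarrow>
      mtrace (place_perm (rdim U) d q * tensor_mat (act U g) d) = fixsum y (rdim U) {..<d} q (\<lambda>_. Suc 0)"
  shows "mtrace (act (sym_power m U) g) = newton_h (psum y (rdim U)) (nat m)"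
proof -
  let ?d = "nat m" and ?n = "rdim U"
  let ?T = "tensor_mat (act U g) ?d"
  have T: "?T \<in> carrier_mat (?n ^ ?d) (?n ^ ?d)" by (rule tensor_mat_carrier[OF act_carrier[OF g]])
  have comm: "symmetrizer ?n ?d * act (tensor_pow ?d U) h = act (tensor_pow ?d U) h * symmetrizer ?n ?d"
    if "h \<in> SL4" for h
    unfolding act_tensor_pow symmetrizer_def
    by (rule tensor_perm_sum_commute[OF act_carrier[OF that], symmetric]) (simp add: colour_group_permutes)
  have "mtrace (act (sym_power m U) g) = mtrace (?T * symmetrizer ?n ?d)"
    using m idempotent_quotrep(2)[of "symmetrizer ?n ?d" "tensor_pow ?d U", OF _ symmetrizer_idem comm kernel_symmetrizer g]
    by (simp add: sym_power_def act_tensor_pow)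
  also have "\<dots> = (\<Sum>q\<in>colour_group {..<?d} (\<lambda>_. 0). 1 / fact ?d * mtrace (?T * place_perm ?n ?d q))"
    unfolding symmetrizer_def by (rule mtrace_mult_perm_sum[OF T])
  also have "\<dots> = 1 / fact ?d * permsum y ?n {..<?d} (\<lambda>_. Suc 0)"
    unfolding permsum_def sum_distrib_left
    by (intro sum.cong refl)
      (simp add: y colour_group_permutes place_perm_tensor_commute[OF act_carrier[OF g] colour_group_permutes, of _ ?d "\<lambda>_. 0"])
  also have "\<dots> = newton_h (psum y ?n) ?d"
    using permsum_newton[of ?d y ?n] by (simp del: newton_h.simps)
  finally show ?thesis .
qed

lemma semisimple_sym_power:
  assumes "semisimple U"
  shows "semisimple (sym_power m U)"
proof (cases "m < 0")
  case True
  then show ?thesis by (simp add: sym_power_def star_rep_semisimple)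
next
  case False
  let ?d = "nat m" and ?n = "rdim U"
  have comm: "symmetrizer ?n ?d * act (tensor_pow ?d U) h = act (tensor_pow ?d U) h * symmetrizer ?n ?d"
    if "h \<in> SL4" for h
    unfolding act_tensor_pow symmetrizer_def
    by (rule tensor_perm_sum_commute[OF act_carrier[OF that], symmetric]) (simp add: colour_group_permutes)
  have "covers (tensor_pow ?d U) (sym_power m U)"
    using False idempotent_quotrep(1)[of "symmetrizer ?n ?d" "tensor_pow ?d U", OF _ symmetrizer_idem comm kernel_symmetrizer]
    by (simp add: sym_power_def)
  then show ?thesis using semisimple_covers[OF semisimple_tensor_pow[OF assms]] by blast
qed

subsection \<open>Young symmetrizers\<close>

lemma smult_mult_dim:
  fixes A B :: "complex mat"
  assumes "dim_col A = dim_row B"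
  shows "(k \<cdot>\<^sub>m A) * B = k \<cdot>\<^sub>m (A * B)" "A * (k \<cdot>\<^sub>m B) = k \<cdot>\<^sub>m (A * B)"
  using mult_smult_assoc_mat[of A "dim_row A" "dim_row B" B "dim_col B" k]
    mult_smult_distrib[of A "dim_row A" "dim_row B" B "dim_col B" k] carrier_matI[of A] carrier_matI[of B] assms
  by blast+

lemma smult_smult_mat: "a \<cdot>\<^sub>m (b \<cdot>\<^sub>m A) = (a * b) \<cdot>\<^sub>m A" for a b :: complex
  by (rule eq_matI) auto

text \<open>Entry \<open>k\<close> lies in row \<open>r k\<close> and column \<open>c k\<close>. The
  two maps stand in for the partition and are directly the colourings of the two Young
  subgroups.\<close>

locale tableau =
  fixes d :: nat and r c :: "nat \<Rightarrow> nat"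
  assumes cells_inj: "k < d \<Longrightarrow> l < d \<Longrightarrow> r k = r l \<Longrightarrow> c k = c l \<Longrightarrow> k = l"
    and rows_justified: "k < d \<Longrightarrow> j < c k \<Longrightarrow> \<exists>l<d. r l = r k \<and> c l = j"
begin

abbreviation "row_perms \<equiv> colour_group {..<d} r"
abbreviation "col_perms \<equiv> colour_group {..<d} c"

lemma card_row_le:
  assumes k: "k < d"
  shows "c k < card {l. l < d \<and> r l = r k}"
proof -
  have "{..c k} \<subseteq> c ` {l. l < d \<and> r l = r k}"
    using rows_justified[OF k] k by (force simp: le_less)
  then have "card {..c k} \<le> card (c ` {l. l < d \<and> r l = r k})" by (intro card_mono) auto
  also have "\<dots> \<le> card {l. l < d \<and> r l = r k}" by (intro card_image_le) auto
  finally show ?thesis by simp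
qed

text \<open>The columns of a row are distinct and, by \<open>card_row_le\<close>, below its length,
  so they are exactly the initial ones.\<close>

lemma row_filled:
  assumes "j < card {l. l < d \<and> r l = i}"
  shows "\<exists>l<d. r l = i \<and> c l = j"
proof -
  let ?R = "{l. l < d \<and> r l = i}"
  have "c ` ?R = {..<card ?R}"
  proof (rule card_subset_eq)
    show "c ` ?R \<subseteq> {..<card ?R}" using card_row_le by auto
    have "inj_on c ?R" using cells_inj by (auto simp: inj_on_def)
    then show "card (c ` ?R) = card {..<card ?R}" by (simp add: card_image)
  qed simp
  then have "j \<in> c ` ?R" using assms by simp
  then show ?thesis by auto
qed

text \<open>Counting the entries that \<open>t\<close> sends to columns left of \<open>j\<close> row by row shows that, if \<open>t\<close>
  never sends two entries of a row to the same column, then each row is sent to the columns it occupies.\<close>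

lemma columns_in_shape:
  assumes t: "t permutes {..<d}"
    and dist: "\<And>k l. k < d \<Longrightarrow> l < d \<Longrightarrow> r k = r l \<Longrightarrow> c (t k) = c (t l) \<Longrightarrow> k = l"
    and k: "k < d"
  shows "\<exists>l<d. r l = r k \<and> c l = c (t k)"
proof -
  have td: "t l < d \<longleftrightarrow> l < d" for l using permutes_in_image[OF t, of l] by simp
  define j where "j = card {l. l < d \<and> r l = r k}"
  define I where "I = r ` {..<d}"
  \<comment> \<open>Both counts are compared with the smaller of \<open>j\<close> and the length of
    row \<open>i\<close>: the left one is at most that, the right one equals it.\<close>
  have le: "card {l. l < d \<and> r l = i \<and> c (t l) < j} \<le> card {l. l < d \<and> r l = i \<and> c l < j}" for i
  proof (cases "j \<le> card {l. l < d \<and> r l = i}")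
    case True
    have "card {l. l < d \<and> r l = i \<and> c (t l) < j} = card ((\<lambda>l. c (t l)) ` {l. l < d \<and> r l = i \<and> c (t l) < j})"
      by (rule card_image[symmetric]) (use dist in \<open>auto simp: inj_on_def\<close>)
    also have "\<dots> \<le> card {..<j}" by (intro card_mono) auto
    also have "\<dots> \<le> card (c ` {l. l < d \<and> r l = i \<and> c l < j})"
    proof (intro card_mono subsetI)
      fix x assume "x \<in> {..<j}"
      then show "x \<in> c ` {l. l < d \<and> r l = i \<and> c l < j}" using row_filled[of x i] True by auto
    qed simp
    also have "\<dots> \<le> card {l. l < d \<and> r l = i \<and> c l < j}" by (intro card_image_le) auto
    finally show ?thesis .
  next
    case False
    have "{l. l < d \<and> r l = i \<and> c (t l) < j} \<subseteq> {l. l < d \<and> r l = i \<and> c l < j}"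
      using card_row_le False by fastforce
    then show ?thesis by (intro card_mono) auto
  qed
  have split: "card {l. l < d \<and> P l} = (\<Sum>i\<in>I. card {l. l < d \<and> r l = i \<and> P l})" for P
  proof -
    have "card (\<Union>i\<in>I. {l. l < d \<and> r l = i \<and> P l}) = (\<Sum>i\<in>I. card {l. l < d \<and> r l = i \<and> P l})"
      by (rule card_UN_disjoint) (auto simp: I_def)
    moreover have "(\<Union>i\<in>I. {l. l < d \<and> r l = i \<and> P l}) = {l. l < d \<and> P l}" by (auto simp: I_def)
    ultimately show ?thesis by simp
  qed
  have "card {l. l < d \<and> c (t l) < j} = card (t ` {l. l < d \<and> c (t l) < j})"
    by (rule card_image[symmetric]) (use permutes_inj[OF t] in \<open>auto simp: inj_on_def inj_def\<close>)
  also have "t ` {l. l < d \<and> c (t l) < j} = {l. l < d \<and> c l < j}"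
  proof (intro equalityI subsetI)
    fix l assume "l \<in> {l. l < d \<and> c l < j}"
    then show "l \<in> t ` {l. l < d \<and> c (t l) < j}"
      using td[of "Hilbert_Choice.inv t l"]
      by (intro image_eqI[of _ _ "Hilbert_Choice.inv t l"]) (simp_all add: permutes_inverses[OF t])
  qed (use td in auto)
  \<comment> \<open>The totals agree because \<open>t\<close> is a bijection, so the inequalities
    are equalities in every row. In the row of \<open>k\<close>, whose length is \<open>j\<close>,
    every entry is therefore sent left of \<open>j\<close>.\<close>
  finally have "(\<Sum>i\<in>I. card {l. l < d \<and> r l = i \<and> c (t l) < j}) = (\<Sum>i\<in>I. card {l. l < d \<and> r l = i \<and> c l < j})"
    by (simp only: split[of "\<lambda>l. c (t l) < j"] split[of "\<lambda>l. c l < j"])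
  then have "card {l. l < d \<and> r l = r k \<and> c (t l) < j} = card {l. l < d \<and> r l = r k \<and> c l < j}"
    by (rule sum_mono_inv) (use le k in \<open>auto simp: I_def\<close>)
  also have "{l. l < d \<and> r l = r k \<and> c l < j} = {l. l < d \<and> r l = r k}"
  proof -
    have "c l < j" if "l < d" "r l = r k" for l using card_row_le[OF that(1)] that(2) by (simp add: j_def)
    then show ?thesis by auto
  qed
  finally have "{l. l < d \<and> r l = r k \<and> c (t l) < j} = {l. l < d \<and> r l = r k}"
    by (intro card_subset_eq) auto
  then have "c (t k) < j" using k by blast
  then show ?thesis using row_filled[of "c (t k)" "r k"] by (simp add: j_def)
qed

text \<open>Sending each entry to the cell of its own row in the column that \<open>t\<close>
  assigns to it defines a row permutation \<open>p\<close>, and t p^(-1) preserves columns. So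
  \<open>t\<close> is a column permutation \<open>q\<close> after a row permutation; the conclusion
  expresses this by saying that t^(-1) q preserves rows.\<close>

lemma exists_column_permutation:
  assumes t: "t permutes {..<d}"
    and dist: "\<And>k l. k < d \<Longrightarrow> l < d \<Longrightarrow> r k = r l \<Longrightarrow> c (t k) = c (t l) \<Longrightarrow> k = l"
  shows "\<exists>q\<in>col_perms. \<forall>k<d. r (Hilbert_Choice.inv t (q k)) = r k"
proof -
  have "\<exists>l<d. r l = r k \<and> c l = c (t k)" if "k < d" for k
    by (rule columns_in_shape[OF t _ that]) (rule dist)
  then obtain p0 where p0: "\<And>k. k < d \<Longrightarrow> p0 k < d"
    "\<And>k. k < d \<Longrightarrow> r (p0 k) = r k" "\<And>k. k < d \<Longrightarrow> c (p0 k) = c (t k)" by metis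
  define p where "p k = (if k < d then p0 k else k)" for k
  have "inj_on p {..<d}"
    using p0 dist by (auto simp: inj_on_def p_def) metis
  moreover have "p ` {..<d} \<subseteq> {..<d}" using p0 by (auto simp: p_def)
  ultimately have "bij_betw p {..<d} {..<d}" by (simp add: bij_betw_def endo_inj_surj)
  then have p: "p permutes {..<d}" by (rule bij_imp_permutes) (simp add: p_def)
  let ?ip = "Hilbert_Choice.inv p"
  note ip = permutes_inv[OF p]
  have ipd: "?ip k < d" if "k < d" for k using permutes_in_image[OF ip] that by simp
  have rp: "r (?ip k) = r k" if "k < d" for k
    using p0(2)[OF ipd[OF that]] ipd[OF that] permutes_inverses(1)[OF p, of k] by (simp add: p_def)
  have cp: "c (t (?ip k)) = c k" if "k < d" for k
    using p0(3)[OF ipd[OF that]] ipd[OF that] permutes_inverses(1)[OF p, of k] by (simp add: p_def)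
  have "t \<circ> ?ip \<in> col_perms"
    using permutes_compose[OF ip t] cp by (simp add: colour_group_def)
  moreover have "\<forall>k<d. r (Hilbert_Choice.inv t ((t \<circ> ?ip) k)) = r k"
    using rp permutes_inverses(2)[OF t] by simp
  ultimately show ?thesis by blast
qed

text \<open>For a permutation \<open>t\<close>, the sign of \<open>q\<close> if \<open>t\<close> is
  a column permutation \<open>q\<close> after a row permutation, and 0 if it has no such
  factorization. At most one \<open>q\<close> occurs, so a sum expresses this without a
  choice.\<close>

definition column_sign_sum :: "(nat \<Rightarrow> nat) \<Rightarrow> int" where
  "column_sign_sum t = (\<Sum>q\<in>col_perms. if \<forall>k<d. r (Hilbert_Choice.inv t (q k)) = r k then sign q else 0)"

context
  fixes n :: nat
begin

abbreviation "row_sum \<equiv> perm_sum n d row_perms (\<lambda>_. 1)"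
abbreviation "col_sum \<equiv> perm_sum n d col_perms (\<lambda>q. of_int (sign q))"

lemma place_perm_row_sum: "p \<in> row_perms \<Longrightarrow> place_perm n d p * row_sum = row_sum"
  using place_perm_absorb_left[of p d r "\<lambda>_. 1" 1 n] by simp

lemma col_sum_place_perm:
  assumes q: "q \<in> col_perms"
  shows "col_sum * place_perm n d q = of_int (sign q) \<cdot>\<^sub>m col_sum"
proof -
  have "complex_of_int (sign (q' \<circ> q)) = of_int (sign q) * of_int (sign q')" if "q' \<in> col_perms" for q'
    using permutes_imp_permutation[OF _ colour_group_permutes[OF q]] permutes_imp_permutation[OF _ colour_group_permutes[OF that]]
    by (simp add: sign_compose)
  from place_perm_absorb_right[of q d c "\<lambda>q. of_int (sign q)" "of_int (sign q)" n, OF q this]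
  have "of_int (sign q) \<cdot>\<^sub>m (col_sum * place_perm n d q) = col_sum" by simp
  then have "of_int (sign q) \<cdot>\<^sub>m (of_int (sign q) \<cdot>\<^sub>m (col_sum * place_perm n d q)) = of_int (sign q) \<cdot>\<^sub>m col_sum"
    by simp
  then show ?thesis by (simp add: smult_smult_mat of_int_mult[symmetric] del: of_int_mult)
qed

text \<open>Von Neumann's lemma. If \<open>t = q \<circ> p\<close>, both factors are absorbed.
  Otherwise two entries of one row go to the same column; their transposition \<open>s\<close> and
  the transposition \<open>u\<close> of the images satisfy \<open>t \<circ> s = u \<circ> t\<close>.
  The row sum absorbs \<open>s\<close>, the column sum absorbs \<open>u\<close> with sign -1, so the
  product is its own negative.\<close>

lemma sandwich:
  assumes t: "t permutes {..<d}"
  shows "col_sum * place_perm n d t * row_sum = of_int (column_sign_sum t) \<cdot>\<^sub>m (col_sum * row_sum)"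
proof (cases "\<exists>q\<in>col_perms. \<forall>k<d. r (Hilbert_Choice.inv t (q k)) = r k")
  case True
  then obtain q where q: "q \<in> col_perms" "\<And>k. k < d \<Longrightarrow> r (Hilbert_Choice.inv t (q k)) = r k" by blast
  note qp = colour_group_permutes[OF q(1)]
  define p where "p = Hilbert_Choice.inv q \<circ> t"
  have p: "p permutes {..<d}" unfolding p_def by (intro permutes_compose t permutes_inv[OF qp])
  have pd: "p k < d" if "k < d" for k using permutes_in_image[OF p] that by simp
  have "r (p k) = r k" if "k < d" for k
    using q(2)[OF pd[OF that]] by (simp add: p_def permutes_inverses[OF qp] permutes_inverses[OF t])
  then have pr: "p \<in> row_perms" using p by (simp add: colour_group_def)
  have t_eq: "t = q \<circ> p" using permutes_inv_comp(2)[OF qp] by (simp add: p_def)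
  \<comment> \<open>For two such column permutations, q^(-1) q' preserves rows and columns, hence
    fixes every cell.\<close>
  have unique: "q' = q" if q': "q' \<in> col_perms" "\<forall>k<d. r (Hilbert_Choice.inv t (q' k)) = r k" for q'
  proof -
    define s where "s = Hilbert_Choice.inv q \<circ> q'"
    have s: "s \<in> col_perms" unfolding s_def by (intro colour_group_comp colour_group_inv q q')
    have sd: "s k < d" if "k < d" for k using permutes_in_image[OF colour_group_permutes[OF s]] that by simp
    have "s k = k" if k: "k < d" for k
    proof (rule cells_inj[OF sd[OF k] k])
      show "r (s k) = r k"
        using q(2)[OF sd[OF k]] q'(2) k by (simp add: s_def permutes_inverses[OF qp])
      show "c (s k) = c k" using s k by (simp add: colour_group_def)
    qed
    then have "s = id"
    proof (intro ext)
      fix k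
      show "s k = id k"
        using \<open>\<And>k. k < d \<Longrightarrow> s k = k\<close>[of k] permutes_not_in[OF colour_group_permutes[OF s], of k] by (cases "k < d") simp_all
    qed
    moreover have "q' = q \<circ> s" using permutes_inv_comp(2)[OF qp] by (simp add: s_def)
    ultimately show ?thesis by simp
  qed
  have "column_sign_sum t = (\<Sum>q'\<in>col_perms. if q' = q then sign q else 0)"
    unfolding column_sign_sum_def
  proof (intro sum.cong refl)
    fix q' assume q': "q' \<in> col_perms"
    have "(\<forall>k<d. r (Hilbert_Choice.inv t (q' k)) = r k) \<longleftrightarrow> q' = q"
      using unique[OF q'] q(2) by blast
    then show "(if \<forall>k<d. r (Hilbert_Choice.inv t (q' k)) = r k then sign q' else 0) = (if q' = q then sign q else 0)"
      by simp
  qed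
  then have eps: "column_sign_sum t = sign q" using q(1) finite_colour_group[of "{..<d}" c] by simp
  have "col_sum * place_perm n d t * row_sum = (col_sum * place_perm n d q) * (place_perm n d p * row_sum)"
    unfolding t_eq place_perm_mult[OF qp p, symmetric] by (simp add: mult_assoc_dim)
  then show ?thesis
    by (simp add: eps place_perm_row_sum[OF pr] col_sum_place_perm[OF q(1)] smult_mult_dim)
next
  case False
  then have eps: "column_sign_sum t = 0" unfolding column_sign_sum_def by (intro sum.neutral) auto
  from False exists_column_permutation[OF t] obtain k l where kl: "k < d" "l < d" "k \<noteq> l" "r k = r l" "c (t k) = c (t l)"
    by metis
  define s where "s = transpose k l"
  define u where "u = transpose (t k) (t l)"
  have td: "t k < d" "t l < d" "t k \<noteq> t l"
    using permutes_in_image[OF t] kl permutes_inj[OF t] by (auto simp: inj_def)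
  have s: "s \<in> row_perms" and u: "u \<in> col_perms"
    using kl td by (auto simp: s_def u_def colour_group_def permutes_swap_id transpose_def)
  have st: "t \<circ> s = u \<circ> t"
    using permutes_inj[OF t] by (auto simp: s_def u_def fun_eq_iff transpose_def inj_def)
  have su: "sign u = - 1" using td by (simp add: u_def sign_swap_id)
  let ?M = "col_sum * place_perm n d t * row_sum"
  have "?M = col_sum * place_perm n d t * (place_perm n d s * row_sum)" by (simp add: place_perm_row_sum[OF s])
  also have "\<dots> = col_sum * (place_perm n d t * place_perm n d s) * row_sum" by (simp add: mult_assoc_dim)
  also have "place_perm n d t * place_perm n d s = place_perm n d u * place_perm n d t"
    using place_perm_mult[OF t colour_group_permutes[OF s]] place_perm_mult[OF colour_group_permutes[OF u] t] st by simp
  also have "col_sum * (place_perm n d u * place_perm n d t) * row_sum = (col_sum * place_perm n d u) * (place_perm n d t * row_sum)"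
    by (simp add: mult_assoc_dim)
  also have "\<dots> = - 1 \<cdot>\<^sub>m (col_sum * (place_perm n d t * row_sum))"
    unfolding col_sum_place_perm[OF u] su by (simp add: smult_mult_dim)
  also have "col_sum * (place_perm n d t * row_sum) = ?M" by (simp add: mult_assoc_dim)
  finally have M: "?M = - 1 \<cdot>\<^sub>m ?M" .
  have "?M $$ (i, j) = 0" if "i < n ^ d" "j < n ^ d" for i j
  proof -
    have "?M $$ (i, j) = - 1 * ?M $$ (i, j)"
      using arg_cong[OF M, of "\<lambda>A. A $$ (i, j)"] that by (simp del: index_mult_mat(1))
    then show ?thesis by simp
  qed
  then show ?thesis by (intro square_mat_eqI[of _ "n ^ d"]) (auto simp: eps simp del: index_mult_mat(1))
qed

definition scalar :: complex where
  "scalar = of_int (\<Sum>q\<in>col_perms. \<Sum>p\<in>row_perms. sign q * column_sign_sum (p \<circ> q))"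

text \<open>The inner \<open>row_sum * col_sum\<close> expands into permutations
  \<open>p \<circ> q\<close>, each sandwiched between \<open>col_sum\<close> and
  \<open>row_sum\<close>.\<close>

lemma young_square: "(col_sum * row_sum) * (col_sum * row_sum) = scalar \<cdot>\<^sub>m (col_sum * row_sum)"
proof (rule square_mat_eqI[of _ "n ^ d"])
  fix i j assume i: "i < n ^ d" and j: "j < n ^ d"
  have c1: "col_sum * row_sum \<in> carrier_mat (n ^ d) (n ^ d)" by (rule mult_carrier_mat[of _ _ "n ^ d"]) simp_all
  have c2: "place_perm n d q * row_sum \<in> carrier_mat (n ^ d) (n ^ d)" for q by (rule mult_carrier_mat[of _ _ "n ^ d"]) simp_all
  have 1: "(col_sum * row_sum * place_perm n d q * row_sum) $$ (i, j)
      = (\<Sum>p\<in>row_perms. of_int (column_sign_sum (p \<circ> q)) * (col_sum * row_sum) $$ (i, j))" if q: "q \<in> col_perms" for q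
  proof -
    have "col_sum * row_sum * place_perm n d q * row_sum = col_sum * row_sum * (place_perm n d q * row_sum)"
      by (simp add: mult_assoc_dim)
    then have "(col_sum * row_sum * place_perm n d q * row_sum) $$ (i, j)
        = (\<Sum>p\<in>row_perms. 1 * (col_sum * place_perm n d p * (place_perm n d q * row_sum)) $$ (i, j))"
      by (simp only: mult_perm_sum_mult_index[OF perm_sum_carrier c2 i j])
    also have "\<dots> = (\<Sum>p\<in>row_perms. of_int (column_sign_sum (p \<circ> q)) * (col_sum * row_sum) $$ (i, j))"
    proof (rule sum.cong[OF refl])
      fix p assume p: "p \<in> row_perms"
      have "col_sum * place_perm n d p * (place_perm n d q * row_sum) = col_sum * (place_perm n d p * place_perm n d q) * row_sum"
        by (simp add: mult_assoc_dim)
      also have "\<dots> = of_int (column_sign_sum (p \<circ> q)) \<cdot>\<^sub>m (col_sum * row_sum)"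
        unfolding place_perm_mult[OF colour_group_permutes[OF p] colour_group_permutes[OF q]]
        by (rule sandwich) (intro permutes_compose colour_group_permutes[OF p] colour_group_permutes[OF q])
      finally show "1 * (col_sum * place_perm n d p * (place_perm n d q * row_sum)) $$ (i, j) =
          of_int (column_sign_sum (p \<circ> q)) * (col_sum * row_sum) $$ (i, j)"
        using i j by (simp del: index_mult_mat(1))
    qed
    finally show ?thesis .
  qed
  have "(col_sum * row_sum) * (col_sum * row_sum) = (col_sum * row_sum) * col_sum * row_sum"
    by (simp add: mult_assoc_dim)
  then have "((col_sum * row_sum) * (col_sum * row_sum)) $$ (i, j)
      = (\<Sum>q\<in>col_perms. of_int (sign q) * (col_sum * row_sum * place_perm n d q * row_sum) $$ (i, j))"
    by (simp only: mult_perm_sum_mult_index[OF c1 perm_sum_carrier i j])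
  also have "\<dots> = scalar * (col_sum * row_sum) $$ (i, j)"
    by (simp add: 1 scalar_def sum_distrib_left sum_distrib_right mult.assoc del: index_mult_mat(1))
  finally show "((col_sum * row_sum) * (col_sum * row_sum)) $$ (i, j) = (scalar \<cdot>\<^sub>m (col_sum * row_sum)) $$ (i, j)"
    using i j by (simp del: index_mult_mat(1))
qed auto

lemma mtrace_young:
  assumes A: "A \<in> carrier_mat n n"
    and y: "\<And>q. q permutes {..<d} \<Longrightarrow>
      mtrace (place_perm n d q * tensor_mat A d) = fixsum y n {..<d} q (\<lambda>_. Suc 0)"
  shows "mtrace (tensor_mat A d * (col_sum * row_sum)) =
    (\<Sum>q\<in>col_perms. \<Sum>p\<in>row_perms. of_int (sign q) * fixsum y n {..<d} (q \<circ> p) (\<lambda>_. Suc 0))"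
proof -
  let ?T = "tensor_mat A d"
  note T = tensor_mat_carrier[OF A, of d]
  note [simp] = carrier_matD[OF T]
  have 1: "mtrace (row_sum * ?T * place_perm n d q) = (\<Sum>p\<in>row_perms. fixsum y n {..<d} (q \<circ> p) (\<lambda>_. Suc 0))"
    if q: "q \<in> col_perms" for q
  proof -
    note qp = colour_group_permutes[OF q]
    have "row_sum * ?T * place_perm n d q = row_sum * (?T * place_perm n d q)" by (simp add: mult_assoc_dim)
    then have "mtrace (row_sum * ?T * place_perm n d q) = mtrace (?T * place_perm n d q * row_sum)"
      by (simp only: mtrace_comm_dim[of row_sum "?T * place_perm n d q"] perm_sum_dim index_mult_mat place_perm_dim carrier_matD[OF T])
    also have "\<dots> = (\<Sum>p\<in>row_perms. 1 * mtrace (?T * place_perm n d q * place_perm n d p))"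
      by (rule mtrace_mult_perm_sum) (rule mult_carrier_mat[OF T place_perm_carrier])
    also have "\<dots> = (\<Sum>p\<in>row_perms. fixsum y n {..<d} (q \<circ> p) (\<lambda>_. Suc 0))"
    proof (rule sum.cong[OF refl])
      fix p assume p: "p \<in> row_perms"
      have qp': "q \<circ> p permutes {..<d}" by (intro permutes_compose colour_group_permutes[OF p] qp)
      have "?T * place_perm n d q * place_perm n d p = ?T * place_perm n d (q \<circ> p)"
        by (simp add: mult_assoc_dim place_perm_mult[OF qp colour_group_permutes[OF p]])
      then show "1 * mtrace (?T * place_perm n d q * place_perm n d p) = fixsum y n {..<d} (q \<circ> p) (\<lambda>_. Suc 0)"
        by (simp add: place_perm_tensor_commute[OF A qp'] y[OF qp'])
    qed
    finally show ?thesis .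
  qed
  have "mtrace (?T * (col_sum * row_sum)) = mtrace (?T * col_sum * row_sum)" by (simp add: mult_assoc_dim)
  also have "\<dots> = mtrace (row_sum * (?T * col_sum))" by (rule mtrace_comm_dim) simp_all
  also have "\<dots> = mtrace (row_sum * ?T * col_sum)" by (simp add: mult_assoc_dim)
  also have "\<dots> = (\<Sum>q\<in>col_perms. of_int (sign q) * mtrace (row_sum * ?T * place_perm n d q))"
    by (rule mtrace_mult_perm_sum) (rule mult_carrier_mat[OF perm_sum_carrier T])
  also have "\<dots> = (\<Sum>q\<in>col_perms. \<Sum>p\<in>row_perms. of_int (sign q) * fixsum y n {..<d} (q \<circ> p) (\<lambda>_. Suc 0))"
    by (intro sum.cong refl) (simp add: 1 sum_distrib_left)
  finally show ?thesis .
qed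

end

text \<open>Replacing \<open>q\<close> and \<open>p\<close> by their inverses turns the inverse of
  \<open>p \<circ> q\<close> in the column sign sum into \<open>q \<circ> p\<close>, the form that
  the program evaluates.\<close>

lemma scalar_code:
  assumes "length rs = d" "\<And>k. k < d \<Longrightarrow> rs ! k = r k" "\<And>k. k < d \<Longrightarrow> cs ! k = c k"
  shows "scalar = of_int (young_scalar rs cs)"
proof -
  have rp: "row_perms = colour_group {..<d} (\<lambda>k. rs ! k)" and cp: "col_perms = colour_group {..<d} (\<lambda>k. cs ! k)"
    using assms permutes_in_image[of _ "{..<d}"] by (auto simp: colour_group_def)
  define G where "G q p = sign q * (\<Sum>q'\<in>col_perms. if \<forall>k<d. r (q (p (q' k))) = r k then sign q' else 0)"
    for q p :: "nat \<Rightarrow> nat"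
  have e: "sign q * column_sign_sum (p \<circ> q) = G (Hilbert_Choice.inv q) (Hilbert_Choice.inv p)"
    if "q \<in> col_perms" "p \<in> row_perms" for p q
    using permutes_imp_permutation[OF _ colour_group_permutes[OF that(1)]]
    by (simp add: G_def column_sign_sum_def sign_inverse
      o_inv_distrib[OF permutes_bij[OF colour_group_permutes[OF that(2)]] permutes_bij[OF colour_group_permutes[OF that(1)]]])
  have "(\<Sum>q\<in>col_perms. \<Sum>p\<in>row_perms. sign q * column_sign_sum (p \<circ> q))
      = (\<Sum>q\<in>col_perms. \<Sum>p\<in>row_perms. G (Hilbert_Choice.inv q) (Hilbert_Choice.inv p))"
    by (intro sum.cong refl e)
  also have "\<dots> = (\<Sum>q\<in>col_perms. \<Sum>p\<in>row_perms. G q p)"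
    unfolding sum_colour_group_inv by (rule sum_colour_group_inv)
  also have "\<dots> = young_scalar rs cs"
    unfolding young_scalar_code[OF assms(1), of cs, symmetric] G_def rp[symmetric] cp[symmetric]
  proof (intro sum.cong refl arg_cong2[where f = times])
    fix q p q' assume q: "q \<in> col_perms" "p \<in> row_perms" "q' \<in> col_perms"
    have "q (p (q' k)) < d" if "k < d" for k
      using that q[THEN colour_group_permutes, THEN permutes_in_image] by simp
    then show "(if \<forall>k<d. r (q (p (q' k))) = r k then sign q' else 0) = (if \<forall>k<d. rs ! q (p (q' k)) = rs ! k then sign q' else 0)"
      using assms(2) by auto
  qed
  finally show ?thesis by (simp add: scalar_def)
qed

end

text \<open>Division by \<kappa> turns the Young symmetrizer into an idempotent with the same image
  that commutes with the action, so \<open>idempotent_subrep\<close> applies.\<close>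

lemma schur_functor_char:
  assumes rs: "rs = map fst (cells \<mu>)" and cs: "cs = map snd (cells \<mu>)" and len: "length rs = sum_list \<mu>"
    and tab: "tableau (sum_list \<mu>) (\<lambda>k. rs ! k) (\<lambda>k. cs ! k)"
    and kappa: "young_scalar rs cs = \<kappa>" "\<kappa> \<noteq> 0"
  shows "covers (tensor_pow (sum_list \<mu>) U) (schur_functor \<mu> U)"
    and "g \<in> SL4 \<Longrightarrow> (\<And>d q. q permutes {..<d} \<Longrightarrow>
      mtrace (place_perm (rdim U) d q * tensor_mat (act U g) d) = fixsum y (rdim U) {..<d} q (\<lambda>_. Suc 0)) \<Longrightarrow>
      mtrace (act (schur_functor \<mu> U) g) = tally_value (psum y (rdim U)) (cycle_tally rs cs) / of_int \<kappa>"
proof -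
  let ?d = "sum_list \<mu>" and ?n = "rdim U"
  interpret tableau ?d "\<lambda>k. rs ! k" "\<lambda>k. cs ! k" by (rule tab)
  have lenc: "length (cells \<mu>) = ?d" using len rs by simp
  have rg: "row_group \<mu> = row_perms" and cg: "col_group \<mu> = col_perms"
    using permutes_in_image[of _ "{..<?d}"] lenc by (auto simp: row_group_def col_group_def colour_group_def rs cs)
  let ?c = "col_sum ?n * row_sum ?n"
  have young: "young_symmetrizer ?n \<mu> = ?c"
    by (simp add: young_symmetrizer_def Let_def rg cg perm_sum_def)
  have sc: "scalar = of_int \<kappa>" using scalar_code[OF len, of cs] kappa(1) by simp
  have cc: "?c \<in> carrier_mat (?n ^ ?d) (?n ^ ?d)" by (rule mult_carrier_mat[OF perm_sum_carrier perm_sum_carrier])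
  note cd = carrier_matD[OF cc]
  define P where "P = (1 / of_int \<kappa> :: complex) \<cdot>\<^sub>m ?c"
  have Pc: "P \<in> carrier_mat (?n ^ ?d) (?n ^ ?d)" using cc by (simp add: P_def)
  have PP: "P * P = P"
  proof -
    have "P * P = (1 / of_int \<kappa>) \<cdot>\<^sub>m ((1 / of_int \<kappa>) \<cdot>\<^sub>m (?c * ?c))"
      unfolding P_def using cc by (simp add: smult_mult_dim)
    then show ?thesis using kappa(2) unfolding young_square sc by (simp add: P_def smult_smult_mat)
  qed
  have comm: "P * act (tensor_pow ?d U) h = act (tensor_pow ?d U) h * P" if h: "h \<in> SL4" for h
  proof -
    let ?T = "tensor_mat (act U h) ?d"
    have T: "?T \<in> carrier_mat (?n ^ ?d) (?n ^ ?d)" by (rule tensor_mat_carrier[OF act_carrier[OF h]])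
    note [simp] = carrier_matD[OF T]
    have "?T * ?c = (?T * col_sum ?n) * row_sum ?n" by (simp add: mult_assoc_dim)
    also have "?T * col_sum ?n = col_sum ?n * ?T"
      by (rule tensor_perm_sum_commute[OF act_carrier[OF h]]) (rule colour_group_permutes)
    also have "col_sum ?n * ?T * row_sum ?n = col_sum ?n * (?T * row_sum ?n)" by (simp add: mult_assoc_dim)
    also have "?T * row_sum ?n = row_sum ?n * ?T"
      by (rule tensor_perm_sum_commute[OF act_carrier[OF h]]) (rule colour_group_permutes)
    also have "col_sum ?n * (row_sum ?n * ?T) = ?c * ?T" by (simp add: mult_assoc_dim)
    finally show ?thesis
      unfolding act_tensor_pow P_def using T cc
      by (simp add: smult_mult_dim)
  qed
  have sm: "P *\<^sub>v x = (1 / of_int \<kappa>) \<cdot>\<^sub>v (?c *\<^sub>v x)" "?c *\<^sub>v (of_int \<kappa> \<cdot>\<^sub>v x) = of_int \<kappa> \<cdot>\<^sub>v (?c *\<^sub>v x)"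
    if "x \<in> carrier_vec (?n ^ ?d)" for x
    using cc that unfolding P_def
    by (auto intro!: eq_vecI simp: smult_scalar_prod_distrib[of _ "?n ^ ?d"] scalar_prod_smult_distrib[of _ "?n ^ ?d"])
  have im: "(\<lambda>x. P *\<^sub>v x) ` carrier_vec (?n ^ ?d) = (\<lambda>x. ?c *\<^sub>v x) ` carrier_vec (?n ^ ?d)"
  proof (intro equalityI subsetI)
    fix z assume "z \<in> (\<lambda>x. P *\<^sub>v x) ` carrier_vec (?n ^ ?d)"
    then obtain x where x: "x \<in> carrier_vec (?n ^ ?d)" "z = P *\<^sub>v x" by auto
    then have "z = ?c *\<^sub>v ((1 / of_int \<kappa>) \<cdot>\<^sub>v x)"
      using sm(1)[OF x(1)] mult_mat_vec[OF cc x(1), of "1 / of_int \<kappa>"] by simp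
    then show "z \<in> (\<lambda>x. ?c *\<^sub>v x) ` carrier_vec (?n ^ ?d)" using x(1) by auto
  next
    fix z assume "z \<in> (\<lambda>x. ?c *\<^sub>v x) ` carrier_vec (?n ^ ?d)"
    then obtain x where x: "x \<in> carrier_vec (?n ^ ?d)" "z = ?c *\<^sub>v x" by auto
    have "P *\<^sub>v (of_int \<kappa> \<cdot>\<^sub>v x) = z"
      using sm(1)[of "of_int \<kappa> \<cdot>\<^sub>v x"] sm(2)[OF x(1)] x kappa(2) by (simp add: smult_smult_assoc)
    then show "z \<in> (\<lambda>x. P *\<^sub>v x) ` carrier_vec (?n ^ ?d)" using x(1) by (metis image_eqI smult_carrier_vec)
  qed
  have Pc': "P \<in> carrier_mat (rdim (tensor_pow ?d U)) (rdim (tensor_pow ?d U))" using Pc by simp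
  have im': "(\<lambda>x. P *\<^sub>v x) ` carrier_vec (rdim (tensor_pow ?d U)) = (\<lambda>v. young_symmetrizer (rdim U) \<mu> *\<^sub>v v) ` carrier_vec (rdim U ^ sum_list \<mu>)"
    using im by (simp add: young)
  show "covers (tensor_pow ?d U) (schur_functor \<mu> U)"
    unfolding schur_functor_def by (rule idempotent_subrep(1)[OF Pc' PP comm im'])
  show "mtrace (act (schur_functor \<mu> U) g) = tally_value (psum y ?n) (cycle_tally rs cs) / of_int \<kappa>"
    if g: "g \<in> SL4" and y: "\<And>d q. q permutes {..<d} \<Longrightarrow>
      mtrace (place_perm ?n d q * tensor_mat (act U g) d) = fixsum y ?n {..<d} q (\<lambda>_. Suc 0)"
  proof -
    let ?T = "tensor_mat (act U g) ?d"
    have T: "?T \<in> carrier_mat (?n ^ ?d) (?n ^ ?d)" by (rule tensor_mat_carrier[OF act_carrier[OF g]])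
    have "mtrace (act (schur_functor \<mu> U) g) = mtrace (?T * P)"
      unfolding schur_functor_def act_tensor_pow[symmetric] by (rule idempotent_subrep(2)[OF Pc' PP comm im' g])
    also have "?T * P = (1 / of_int \<kappa>) \<cdot>\<^sub>m (?T * ?c)"
      unfolding P_def by (rule mult_smult_distrib[OF T cc])
    also have "mtrace \<dots> = 1 / of_int \<kappa> * mtrace (?T * ?c)"
      by (rule mtrace_smult[OF mult_carrier_mat[OF T cc]])
    also have "mtrace (?T * ?c) = (\<Sum>q\<in>col_perms. \<Sum>p\<in>row_perms.
        of_int (sign q) * fixsum y ?n {..<?d} (q \<circ> p) (\<lambda>_. Suc 0))"
      by (rule mtrace_young[OF act_carrier[OF g]]) (rule y)
    also have "\<dots> = tally_value (psum y ?n) (cycle_tally rs cs)" by (rule sum_fixsum_code[OF len])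
    finally show ?thesis by simp
  qed
qed

subsection \<open>Characters\<close>

definition char :: "rep \<Rightarrow> complex mat \<Rightarrow> complex" where
  "char U g = mtrace (act U g)"

lemma char_simps:
  assumes g: "g \<in> SL4"
  shows "char (rep_sum U W) g = char U g + char W g" "char (rep_tensor U W) g = char U g * char W g"
    "char zero_rep g = 0"
proof -
  let ?n = "rdim U" and ?m = "rdim W"
  have "char (rep_sum U W) g = (\<Sum>i<?n + ?m. if i < ?n then act U g $$ (i, i) else act W g $$ (i - ?n, i - ?n))"
    using g rep_sum_index[OF g, of _ U W]
    by (auto simp: char_def mtrace_def intro!: sum.cong)
  also have "\<dots> = (\<Sum>i<?n. act U g $$ (i, i)) + (\<Sum>i<?m. act W g $$ (i, i))"
  proof -
    define f where "f i = (if i < ?n then act U g $$ (i, i) else act W g $$ (i - ?n, i - ?n))" for i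
    have split: "{..<?n + ?m} = {..<?n} \<union> {?n..<?n + ?m}" by auto
    have "(\<Sum>i<?n + ?m. f i) = (\<Sum>i<?n. f i) + (\<Sum>i = ?n..<?n + ?m. f i)"
      unfolding split by (rule sum.union_disjoint) auto
    also have "(\<Sum>i<?n. f i) = (\<Sum>i<?n. act U g $$ (i, i))" by (simp add: f_def)
    also have "(\<Sum>i = ?n..<?n + ?m. f i) = (\<Sum>i = ?n..<?n + ?m. act W g $$ (i - ?n, i - ?n))"
      by (simp add: f_def)
    also have "(\<Sum>i = ?n..<?n + ?m. act W g $$ (i - ?n, i - ?n)) = (\<Sum>i<?m. act W g $$ (i, i))"
      using sum.shift_bounds_nat_ivl[of "\<lambda>i. act W g $$ (i - ?n, i - ?n)" 0 ?n ?m]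
      by (simp add: add.commute atLeast0LessThan)
    finally show ?thesis unfolding f_def .
  qed
  finally show "char (rep_sum U W) g = char U g + char W g" using g by (simp add: char_def mtrace_def)
  have "char (rep_tensor U W) g = (\<Sum>k = 0..<?n * ?m. act U g $$ (k div ?m, k div ?m) * act W g $$ (k mod ?m, k mod ?m))"
    using g rep_tensor_index[OF g, of _ U W] by (simp add: char_def mtrace_def atLeast0LessThan)
  also have "\<dots> = (\<Sum>i = 0..<?n. \<Sum>j = 0..<?m. act U g $$ (i, i) * act W g $$ (j, j))"
    by (rule sum_div_mod)
  finally show "char (rep_tensor U W) g = char U g * char W g"
    using g by (simp add: char_def mtrace_def sum_product atLeast0LessThan)
  show "char zero_rep g = 0" by (simp add: char_def mtrace_def)
qed

lemma matpow_SL4: "g \<in> SL4 \<Longrightarrow> matpow 4 g k \<in> SL4"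
  by (induction k) (auto intro: one_in_SL4 SL4_mult)

lemma act_matpow: "g \<in> SL4 \<Longrightarrow> act U (matpow 4 g k) = matpow (rdim U) (act U g) k"
  by (induction k) (simp_all add: act_one act_mult matpow_SL4)

lemma matpow_add:
  assumes "A \<in> carrier_mat n n"
  shows "matpow n A (k + l) = matpow n A k * matpow n A l"
proof (induction k)
  case 0
  show ?case using matpow_carrier[OF assms, of l] by simp
next
  case (Suc k)
  then show ?case
    using assoc_mult_mat[OF assms matpow_carrier[OF assms] matpow_carrier[OF assms], of k l] by simp
qed

lemma matpow_mult: "A \<in> carrier_mat n n \<Longrightarrow> matpow n (matpow n A k) l = matpow n A (k * l)"
  by (induction l) (simp_all add: matpow_add)

text \<open>Extension by 0 to negative indices, matching the convention in
  \<open>sym_power\<close>.\<close>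

definition complete_h :: "(nat \<Rightarrow> complex) \<Rightarrow> int \<Rightarrow> complex" where
  "complete_h p k = (if k < 0 then 0 else newton_h p (nat k))"

lemma std_eigenvalues:
  assumes g: "g \<in> SL4"
  obtains x where "\<And>d q. q permutes {..<d} \<Longrightarrow>
      mtrace (place_perm (rdim std_rep) d q * tensor_mat (act std_rep g) d) = fixsum x (rdim std_rep) {..<d} q (\<lambda>_. Suc 0)"
    "\<And>k. mtrace (matpow 4 g k) = psum x 4 k" "(\<Prod>i<4. x i) = 1"
proof -
  have "g \<in> carrier_mat 4 4" "det g = 1" using g by (auto simp: SL4_def)
  then show thesis using eigenvalues[OF \<open>g \<in> carrier_mat 4 4\<close>] that by (simp) metis
qed

text \<open>The character of a symmetric power at \<open>g\<close> depends only on the characters of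
  \<open>U\<close> at the powers of \<open>g\<close>. For \<open>U = sym_power 2 std_rep\<close>
  this gives the plethysm without determining the eigenvalues of \<open>act U g\<close>.\<close>

lemma char_sym_power:
  assumes g: "g \<in> SL4" and p: "\<And>k. p k = char U (matpow 4 g k)"
  shows "char (sym_power m U) g = complete_h p m"
proof (cases "m < 0")
  case True
  then show ?thesis by (simp add: sym_power_def complete_h_def char_simps(3)[OF g])
next
  case False
  obtain y where y: "\<And>d q. q permutes {..<d} \<Longrightarrow>
      mtrace (place_perm (rdim U) d q * tensor_mat (act U g) d) = fixsum y (rdim U) {..<d} q (\<lambda>_. Suc 0)"
    "\<And>k. mtrace (matpow (rdim U) (act U g) k) = psum y (rdim U) k"
    using eigenvalues[OF act_carrier[OF g, of U]] by metis
  have "p = psum y (rdim U)" by (rule ext) (simp add: p char_def act_matpow[OF g] y(2))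
  then show ?thesis
    using False sym_power_char[of m g U y, OF _ g y(1)] by (simp add: char_def complete_h_def)
qed

lemma char_sym_square:
  assumes g: "g \<in> SL4" and x: "\<And>k. mtrace (matpow 4 g k) = psum x 4 k"
  shows "char (sym_power 2 std_rep) (matpow 4 g k) = ((psum x 4 k)\<^sup>2 + psum x 4 (2 * k)) / 2"
proof -
  have "g \<in> carrier_mat 4 4" using g by (simp add: SL4_def)
  then have "char (sym_power 2 std_rep) (matpow 4 g k) = complete_h (\<lambda>j. psum x 4 (k * j)) 2"
    by (intro char_sym_power matpow_SL4 g) (simp add: char_def matpow_mult x)
  also have "\<dots> = ((psum x 4 k)\<^sup>2 + psum x 4 (2 * k)) / 2"
    by (simp add: complete_h_def numeral_2_eq_2 power2_eq_square field_simps)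
  finally show ?thesis .
qed

subsection \<open>Generating functions\<close>

text \<open>With H the series of \<open>newton_h\<close>, D the product, and P the series of the
  p_(k+1), Newton's recursion reads H' = P H, and D' = - P D follows factor by factor. So H D has
  derivative 0 and constant term 1.\<close>

lemma newton_h_fps:
  fixes ys :: "complex list"
  assumes p: "\<And>k. p k = (\<Sum>y\<leftarrow>ys. y ^ k)"
  shows "Abs_fps (newton_h p) * (\<Prod>y\<leftarrow>ys. 1 - fps_const y * fps_X) = 1"
proof -
  let ?H = "Abs_fps (newton_h p)" and ?D = "\<lambda>ys :: complex list. \<Prod>y\<leftarrow>ys. 1 - fps_const y * fps_X"
  let ?P = "\<lambda>ys :: complex list. Abs_fps (\<lambda>k. \<Sum>y\<leftarrow>ys. y ^ Suc k)"
  have dH: "fps_deriv ?H = ?P ys * ?H"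
  proof (rule fps_ext)
    fix m
    have "fps_nth (fps_deriv ?H) m = of_nat (Suc m) * newton_h p (Suc m)"
      by (simp only: fps_deriv_nth fps_nth_Abs_fps Suc_eq_plus1)
    also have "\<dots> = (\<Sum>i\<le>m. p (Suc i) * newton_h p (m - i))"
      by (simp only: newton_h.simps(2)) (simp del: of_nat_Suc newton_h.simps)
    finally show "fps_nth (fps_deriv ?H) m = fps_nth (?P ys * ?H) m"
      by (simp only: fps_mult_nth fps_nth_Abs_fps p atLeast0AtMost)
  qed
  have dD: "fps_deriv (?D zs) = - (?P zs * ?D zs)" for zs
  proof (induction zs)
    case Nil
    have "?P [] = 0" by (rule fps_ext) simp
    then show ?case by simp
  next
    case (Cons z zs)
    let ?S = "Abs_fps (\<lambda>k. z ^ Suc k)" and ?L = "1 - fps_const z * fps_X"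
    have 1: "?P (z # zs) = ?S + ?P zs" by (rule fps_ext) (simp only: fps_add_nth fps_nth_Abs_fps list.map sum_list.Cons)
    have 2: "?S * ?L = fps_const z"
    proof (rule fps_ext)
      fix k
      have "fps_nth (?S * ?L) k = fps_nth ?S k - z * fps_nth (?S * fps_X) k"
        by (simp only: right_diff_distrib mult_1_right fps_sub_nth mult.left_commute[of _ "fps_const z"] fps_mult_left_const_nth)
      also have "\<dots> = fps_nth (fps_const z) k"
        by (cases k) simp_all
      finally show "fps_nth (?S * ?L) k = fps_nth (fps_const z) k" .
    qed
    have ring: "L * (- (P * D)) + (- (S * L)) * D = - ((S + P) * (L * D))" for L P D S :: "complex fps"
      by Groebner_Basis.algebra
    have "fps_deriv ?L = - fps_const z" by simp
    then have "fps_deriv (?L * ?D zs) = ?L * (- (?P zs * ?D zs)) + (- (?S * ?L)) * ?D zs"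
      unfolding fps_deriv_mult Cons.IH 2 by (simp only:)
    then show ?case unfolding ring 1 by simp
  qed
  have "fps_deriv (?H * ?D ys) = ?H * (- (?P ys * ?D ys)) + (?P ys * ?H) * ?D ys"
    unfolding fps_deriv_mult dH dD ..
  also have "\<dots> = 0" by Groebner_Basis.algebra
  finally have "fps_deriv (?H * ?D ys) = 0" .
  then obtain c where c: "?H * ?D ys = fps_const c" by (metis fps_deriv_eq_0_iff)
  have "fps_nth (?D zs) 0 = 1" for zs by (induction zs) simp_all
  then have "fps_nth (?H * ?D ys) 0 = 1" by simp
  then show ?thesis using c by simp
qed

text \<open>The coefficients are, up to sign, characters of the exterior powers of the second
  exterior power; they are palindromic because complementary pairs such as \<open>a*b\<close> and
  \<open>c*d\<close> have product 1.\<close>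

lemma product_of_pairs:
  fixes a b c d z :: "'a::idom"
  assumes "a * b * c * d = 1"
  defines "e1 \<equiv> a + b + c + d" and "e2 \<equiv> a*b + a*c + a*d + b*c + b*d + c*d"
    and "e3 \<equiv> a*b*c + a*b*d + a*c*d + b*c*d"
  shows "(1 - a*b*z) * (1 - a*c*z) * (1 - a*d*z) * (1 - b*c*z) * (1 - b*d*z) * (1 - c*d*z) =
    1 - e2 * z + (e1 * e3 - 1) * z^2 - (e3^2 + e1^2 - 2 * e2) * z^3 + (e1 * e3 - 1) * z^4 - e2 * z^5 + z^6"
  unfolding e1_def e2_def e3_def using assms(1) by Groebner_Basis.algebra

text \<open>The long factor is the product of the 1 + x z over the four values x, expanded with e_4
  = 1.\<close>

lemma product_of_signs:
  fixes a b c d z :: "'a::idom"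
  assumes "a * b * c * d = 1"
  shows "(1 - a*z) * (1 - b*z) * (1 - c*z) * (1 - d*z) *
    (1 + (a + b + c + d) * z + (a*b + a*c + a*d + b*c + b*d + c*d) * z^2 +
      (a*b*c + a*b*d + a*c*d + b*c*d) * z^3 + z^4) =
    (1 - a^2*z^2) * (1 - b^2*z^2) * (1 - c^2*z^2) * (1 - d^2*z^2)"
  using assms by Groebner_Basis.algebra

lemma product_of_squares:
  fixes a b c d z :: "'a::idom"
  shows "(1 - a*z) * (1 - b*z) * (1 - c*z) * (1 - d*z) =
    1 - (a + b + c + d) * z + (a*b + a*c + a*d + b*c + b*d + c*d) * z^2 -
      (a*b*c + a*b*d + a*c*d + b*c*d) * z^3 + a*b*c*d * z^4"
  by Groebner_Basis.algebra

text \<open>The polynomials in \<open>e1\<close>, \<open>e2\<close>, \<open>e3\<close> are dual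
  Jacobi-Trudi determinants with e_4 = 1: up to \<open>z^4\<close>, in order of appearance on the
  right, the Schur functions of (2,2), (3,2,1), (3,3,2) and (3,1).\<close>

lemma veronese_numerator:
  fixes e1 e2 e3 z :: "'a::idom"
  shows "(1 + e2 * z + z^2) *
     (1 - e2 * z + (e1 * e3 - 1) * z^2 - (e3^2 + e1^2 - 2 * e2) * z^3 + (e1 * e3 - 1) * z^4 - e2 * z^5 + z^6) =
    1 - (e2^2 - e1*e3) * z^2 + (e1*e2*e3 - e3^2 - e1^2) * z^3
      - ((e2*e3^2 - e1*e3 - e2^2 + 1) + (e1^2*e2 - e2^2 - e1*e3 + 1)) * z^4
      + (e1*e2*e3 - e3^2 - e1^2) * z^5 - (e2^2 - e1*e3) * z^6 + z^8"
  by Groebner_Basis.algebra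

lemma veronese_series:
  fixes a b c d :: complex and t :: int
  assumes one: "a * b * c * d = 1" and p: "\<And>k. p k = a ^ k + b ^ k + c ^ k + d ^ k" and t: "t \<ge> 0"
  defines "q \<equiv> \<lambda>k. ((p k)\<^sup>2 + p (2 * k)) / 2"
    and "e1 \<equiv> a + b + c + d" and "e2 \<equiv> a*b + a*c + a*d + b*c + b*d + c*d"
    and "e3 \<equiv> a*b*c + a*b*d + a*c*d + b*c*d"
  shows "complete_h p (2 * t) = complete_h q t - (e2^2 - e1*e3) * complete_h q (t - 2)
      + (e1*e2*e3 - e3^2 - e1^2) * complete_h q (t - 3)
      - ((e2*e3^2 - e1*e3 - e2^2 + 1) + (e1^2*e2 - e2^2 - e1*e3 + 1)) * complete_h q (t - 4)
      + (e1*e2*e3 - e3^2 - e1^2) * complete_h q (t - 5)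
      - (e2^2 - e1*e3) * complete_h q (t - 6) + complete_h q (t - 8)"
proof -
  let ?C = "fps_const :: complex \<Rightarrow> complex fps" and ?X = "fps_X :: complex fps"
  define A B C D where "A = ?C a" and "B = ?C b" and "C = ?C c" and "D = ?C d"
  have ABCD: "A * B * C * D = 1" using one by (simp add: A_def B_def C_def D_def)
  define E1 E2 E3 where "E1 = A + B + C + D" and "E2 = A*B + A*C + A*D + B*C + B*D + C*D"
    and "E3 = A*B*C + A*B*D + A*C*D + B*C*D"
  have E: "E1 = ?C e1" "E2 = ?C e2" "E3 = ?C e3"
    by (simp_all add: E1_def E2_def E3_def e1_def e2_def e3_def A_def B_def C_def D_def)
  define H where "H = Abs_fps (newton_h p)"
  define G where "G = Abs_fps (newton_h q)"
  define F where "F = Abs_fps (\<lambda>t. newton_h p (2 * t))"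
  have H: "H * ((1 - A*?X) * (1 - B*?X) * (1 - C*?X) * (1 - D*?X)) = 1"
    using newton_h_fps[of p "[a, b, c, d]"] p
    by (simp add: H_def A_def B_def C_def D_def mult.assoc add.assoc)
  \<comment> \<open>The ten values are the eigenvalues on the symmetric square: four squares and six
    products of distinct pairs.\<close>
  have q: "q k = (\<Sum>y\<leftarrow>[a*a, b*b, c*c, d*d, a*b, a*c, a*d, b*c, b*d, c*d]. y ^ k)" for k
  proof -
    have "p (2 * k) = (a ^ k)\<^sup>2 + (b ^ k)\<^sup>2 + (c ^ k)\<^sup>2 + (d ^ k)\<^sup>2"
      by (simp add: p power_mult[symmetric] mult.commute)
    then show ?thesis
      by (simp add: q_def p power_mult_distrib power2_eq_square field_simps)
  qed
  define P where "P = (1 - A^2*?X) * (1 - B^2*?X) * (1 - C^2*?X) * (1 - D^2*?X)"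
  define Q where "Q = (1 - A*B*?X) * (1 - A*C*?X) * (1 - A*D*?X) * (1 - B*C*?X) * (1 - B*D*?X) * (1 - C*D*?X)"
  have GPQ: "G * (P * Q) = 1"
    using newton_h_fps[of q "[a*a, b*b, c*c, d*d, a*b, a*c, a*d, b*c, b*d, c*d]", OF q]
    by (simp add: G_def P_def Q_def A_def B_def C_def D_def mult.assoc power2_eq_square)
  define c1 c2 c3 where "c1 = a^2 + b^2 + c^2 + d^2"
    and "c2 = a^2*b^2 + a^2*c^2 + a^2*d^2 + b^2*c^2 + b^2*d^2 + c^2*d^2"
    and "c3 = a^2*b^2*c^2 + a^2*b^2*d^2 + a^2*c^2*d^2 + b^2*c^2*d^2"
  have "a^2 * b^2 * c^2 * d^2 = (a*b*c*d)^2" by (simp add: power_mult_distrib)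
  then have c4: "a^2 * b^2 * c^2 * d^2 = 1" by (simp add: one)
  have sq: "(1 - A^2*z) * (1 - B^2*z) * (1 - C^2*z) * (1 - D^2*z) = 1 - ?C c1 * z + ?C c2 * z^2 - ?C c3 * z^3 + z^4" for z
  proof -
    have "(1 - A^2*z) * (1 - B^2*z) * (1 - C^2*z) * (1 - D^2*z) =
      1 - ?C c1 * z + ?C c2 * z^2 - ?C c3 * z^3 + ?C (a^2*b^2*c^2*d^2) * z^4"
      unfolding product_of_squares[of "A^2" z "B^2" "C^2" "D^2"]
      by (simp only: A_def B_def C_def D_def c1_def c2_def c3_def fps_const_add fps_const_mult fps_const_power)
    then show ?thesis by (simp add: c4)
  qed
  define M where "M = 1 + ?C e1 * ?X + ?C e2 * ?X^2 + ?C e3 * ?X^3 + ?X^4"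
  have HM: "H * (1 - ?C c1 * ?X^2 + ?C c2 * ?X^4 - ?C c3 * ?X^6 + ?X^8) = M"
  proof -
    have "1 - ?C c1 * ?X^2 + ?C c2 * ?X^4 - ?C c3 * ?X^6 + ?X^8 =
        (1 - A^2*?X^2) * (1 - B^2*?X^2) * (1 - C^2*?X^2) * (1 - D^2*?X^2)"
      unfolding sq by (simp add: power_mult[symmetric])
    also have "\<dots> = (1 - A*?X) * (1 - B*?X) * (1 - C*?X) * (1 - D*?X) * M"
      unfolding product_of_signs[OF ABCD, symmetric] M_def E[symmetric] E1_def E2_def E3_def ..
    finally show ?thesis using H by (simp add: mult.assoc[symmetric])
  qed
  have shift: "fps_nth (f * ?X ^ k) n = (if n < k then 0 else fps_nth f (n - k))" for f k n
    by (rule fps_X_power_mult_right_nth)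
  have lin: "fps_nth (f * (?C x * g)) n = x * fps_nth (f * g) n" for f g x n
    by (simp add: mult.left_commute[of f])
  note expand = distrib_left right_diff_distrib fps_add_nth fps_sub_nth lin mult_1_right
  \<comment> \<open>\<open>P\<close> with its variable squared has only even powers, so coefficient
    \<open>2 * n\<close> of its product with \<open>H\<close> involves only even coefficients of
    \<open>H\<close>, which are those of \<open>F\<close>. By \<open>HM\<close> that product is
    \<open>M\<close>, with even part 1 + e_2 z^2 + z^4.\<close>
  have FP: "F * P = 1 + E2 * ?X + ?X^2"
  proof (rule fps_ext)
    fix n
    have "fps_nth (F * P) n = fps_nth F n - c1 * fps_nth (F * ?X^1) n + c2 * fps_nth (F * ?X^2) n - c3 * fps_nth (F * ?X^3) n + fps_nth (F * ?X^4) n"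
      unfolding P_def sq by (simp only: expand power_one_right)
    also have "\<dots> = fps_nth H (2 * n) - c1 * fps_nth (H * ?X^2) (2 * n) + c2 * fps_nth (H * ?X^4) (2 * n)
        - c3 * fps_nth (H * ?X^6) (2 * n) + fps_nth (H * ?X^8) (2 * n)"
    proof -
      have "fps_nth (F * ?X^k) n = fps_nth (H * ?X^(2 * k)) (2 * n)" for k
        unfolding shift by (simp add: F_def H_def diff_mult_distrib2)
      from this[of 1] this[of 2] this[of 3] this[of 4]
      show ?thesis by (simp add: F_def H_def)
    qed
    also have "\<dots> = fps_nth (H * (1 - ?C c1 * ?X^2 + ?C c2 * ?X^4 - ?C c3 * ?X^6 + ?X^8)) (2 * n)"
      by (simp only: expand)
    also have "\<dots> = fps_nth (1 + E2 * ?X + ?X^2) n"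
      unfolding HM M_def E by (auto simp: fps_X_power_iff)
    finally show "fps_nth (F * P) n = fps_nth (1 + E2 * ?X + ?X^2) n" .
  qed
  define s22 s321 s31 s332 where "s22 = e2^2 - e1*e3" and "s321 = e1*e2*e3 - e3^2 - e1^2"
    and "s31 = e1^2*e2 - e2^2 - e1*e3 + 1" and "s332 = e2*e3^2 - e1*e3 - e2^2 + 1"
  \<comment> \<open>\<open>G\<close> is the inverse of \<open>P * Q\<close>, so \<open>F\<close> is
    the numerator \<open>F * P\<close>, times \<open>Q\<close>, times \<open>G\<close>.\<close>
  have "F = (F * P) * (Q * G)" using GPQ by (metis mult.assoc mult.commute mult.right_neutral)
  also have "\<dots> = (1 + E2 * ?X + ?X^2) * Q * G" by (simp only: FP mult.assoc)
  also have "(1 + E2 * ?X + ?X^2) * Q = 1 - (E2^2 - E1*E3) * ?X^2 + (E1*E2*E3 - E3^2 - E1^2) * ?X^3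
      - ((E2*E3^2 - E1*E3 - E2^2 + 1) + (E1^2*E2 - E2^2 - E1*E3 + 1)) * ?X^4
      + (E1*E2*E3 - E3^2 - E1^2) * ?X^5 - (E2^2 - E1*E3) * ?X^6 + ?X^8"
    unfolding Q_def product_of_pairs[OF ABCD] E1_def[symmetric] E2_def[symmetric] E3_def[symmetric]
    by (rule veronese_numerator)
  also have "\<dots> = 1 - ?C s22 * ?X^2 + ?C s321 * ?X^3 - ?C (s332 + s31) * ?X^4 + ?C s321 * ?X^5 - ?C s22 * ?X^6 + ?X^8"
    unfolding E s22_def s321_def s31_def s332_def
    by (simp only: fps_const_add[symmetric] fps_const_mult[symmetric] fps_const_power[symmetric] fps_const_sub[symmetric] fps_const_1_eq_1)
  finally have F: "F = (1 - ?C s22 * ?X^2 + ?C s321 * ?X^3 - ?C (s332 + s31) * ?X^4 + ?C s321 * ?X^5 - ?C s22 * ?X^6 + ?X^8) * G" .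
  obtain n where n: "t = int n" using t nonneg_int_cases by blast
  have cq: "complete_h q (t - int k) = fps_nth (G * ?X ^ k) n" for k
    unfolding shift by (auto simp: n complete_h_def G_def nat_diff_distrib simp flip: of_nat_diff)
  have "complete_h p (2 * t) = fps_nth F n"
    by (simp add: complete_h_def n F_def nat_mult_distrib)
  also have "\<dots> = fps_nth G n - s22 * fps_nth (G * ?X^2) n + s321 * fps_nth (G * ?X^3) n - (s332 + s31) * fps_nth (G * ?X^4) n
      + s321 * fps_nth (G * ?X^5) n - s22 * fps_nth (G * ?X^6) n + fps_nth (G * ?X^8) n"
    unfolding F mult.commute[of _ G] by (simp only: expand)
  also have "fps_nth G n = complete_h q t" using cq[of 0] by simp
  finally show ?thesis
    using cq[of 2] cq[of 3] cq[of 4] cq[of 5] cq[of 6] cq[of 8]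
    by (simp add: s22_def s321_def s31_def s332_def)
qed

subsection \<open>The four Schur functors\<close>

lemma tableau_code:
  assumes "\<forall>k<d. \<forall>l<d. rs ! k = rs ! l \<longrightarrow> cs ! k = cs ! l \<longrightarrow> k = l"
    "\<forall>k<d. \<forall>j<cs ! k. \<exists>l<d. rs ! l = rs ! k \<and> cs ! l = j"
  shows "tableau d (\<lambda>k. rs ! k) (\<lambda>k. cs ! k)"
  using assms by unfold_locales blast+

text \<open>The lists give row and column of each cell, row by row. Like the next three values, 12
  is the product of the hook lengths, here 3 * 2 * 2 * 1.\<close>

lemma young_scalar_22: "young_scalar [0,0,1,1] [0,1,0,1] = 12"
  by code_simp

lemma young_scalar_31: "young_scalar [0,0,0,1] [0,1,2,0] = 8"
  by code_simp

lemma young_scalar_321: "young_scalar [0,0,0,1,1,2] [0,1,2,0,1,0] = 45"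
  by code_simp

lemma young_scalar_332: "young_scalar [0,0,0,1,1,1,2,2] [0,1,2,0,1,2,0,1] = 960"
  by code_simp

text \<open>Each coefficient is the hook product times the value of the irreducible character of the
  symmetric group, divided by the order of the centralizer. Entries with coefficient 0 are types
  whose terms cancelled.\<close>

lemma cycle_tally_22: "cycle_tally [0,0,1,1] [0,1,0,1] =
  [(1, [1,1,1,1]), (0, [1,1,2]), (3, [2,2]), (- 4, [1,3]), (0, [4])]"
  by code_simp

lemma cycle_tally_31: "cycle_tally [0,0,0,1] [0,1,2,0] =
  [(1, [1,1,1,1]), (2, [1,1,2]), (0, [1,3]), (- 1, [2,2]), (- 2, [4])]"
  by code_simp

lemma cycle_tally_321: "cycle_tally [0,0,0,1,1,2] [0,1,2,0,1,0] =
  [(1, [1,1,1,1,1,1]), (0, [1,1,1,1,2]), (0, [1,1,2,2]), (- 5, [1,1,1,3]), (0, [1,2,3]),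
   (- 5, [3,3]), (0, [2,2,2]), (0, [1,1,4]), (0, [2,4]), (9, [1,5]), (0, [6])]"
  by code_simp

lemma cycle_tally_332: "cycle_tally [0,0,0,1,1,1,2,2] [0,1,2,0,1,2,0,1] =
  [(1, [1,1,1,1,1,1,1,1]), (0, [1,1,1,1,1,1,2]), (10, [1,1,1,1,2,2]), (- 16, [1,1,1,1,1,3]),
   (0, [1,1,1,2,3]), (0, [1,1,2,2,2]), (80, [1,2,2,3]), (0, [1,1,3,3]), (0, [2,3,3]),
   (0, [1,1,1,1,4]), (64, [1,1,1,5]), (- 120, [1,1,2,4]), (0, [1,2,5]), (0, [1,3,4]),
   (- 64, [3,5]), (0, [1,1,6]), (0, [1,7]), (- 15, [2,2,2,2]), (0, [2,2,4]), (0, [2,6]),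
   (60, [4,4]), (0, [8])]"
  by code_simp

lemma schur_functor_semisimple:
  assumes "rs = map fst (cells \<mu>)" "cs = map snd (cells \<mu>)" "length rs = sum_list \<mu>"
    "tableau (sum_list \<mu>) (\<lambda>k. rs ! k) (\<lambda>k. cs ! k)" "young_scalar rs cs = \<kappa>" "\<kappa> \<noteq> 0"
  shows "semisimple (schur_functor \<mu> std_rep)"
  using semisimple_covers[OF semisimple_tensor_pow[OF star_rep_semisimple[OF star_rep_simps(2)]]
      schur_functor_char(1)[OF assms]] .

lemma tableau_22: "tableau (sum_list [2,2]) (\<lambda>k. [0,0,1,1] ! k) (\<lambda>k. [0,1,0,1] ! k)"
  and tableau_31: "tableau (sum_list [3,1]) (\<lambda>k. [0,0,0,1] ! k) (\<lambda>k. [0,1,2,0] ! k)"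
  and tableau_321: "tableau (sum_list [3,2,1]) (\<lambda>k. [0,0,0,1,1,2] ! k) (\<lambda>k. [0,1,2,0,1,0] ! k)"
  and tableau_332: "tableau (sum_list [3,3,2]) (\<lambda>k. [0,0,0,1,1,1,2,2] ! k) (\<lambda>k. [0,1,2,0,1,2,0,1] ! k)"
  by (rule tableau_code; code_simp)+

lemma cells_22: "[0,0,1,1] = map fst (cells [2,2])" "[0,1,0,1] = map snd (cells [2,2])"
  and cells_31: "[0,0,0,1] = map fst (cells [3,1])" "[0,1,2,0] = map snd (cells [3,1])"
  and cells_321: "[0,0,0,1,1,2] = map fst (cells [3,2,1])" "[0,1,2,0,1,0] = map snd (cells [3,2,1])"
  and cells_332: "[0,0,0,1,1,1,2,2] = map fst (cells [3,3,2])" "[0,1,2,0,1,2,0,1] = map snd (cells [3,3,2])"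
  by code_simp+

lemma schur_semisimple:
  "semisimple (schur_functor [2,2] std_rep)" "semisimple (schur_functor [3,1] std_rep)"
  "semisimple (schur_functor [3,2,1] std_rep)" "semisimple (schur_functor [3,3,2] std_rep)"
  using schur_functor_semisimple[OF cells_22 _ tableau_22 young_scalar_22]
    schur_functor_semisimple[OF cells_31 _ tableau_31 young_scalar_31]
    schur_functor_semisimple[OF cells_321 _ tableau_321 young_scalar_321]
    schur_functor_semisimple[OF cells_332 _ tableau_332 young_scalar_332]
  by simp_all

lemma schur_tally:
  assumes "g \<in> SL4" "\<And>d q. q permutes {..<d} \<Longrightarrow>
      mtrace (place_perm (rdim std_rep) d q * tensor_mat (act std_rep g) d) = fixsum x (rdim std_rep) {..<d} q (\<lambda>_. Suc 0)"
  shows "char (schur_functor [2,2] std_rep) g = tally_value (psum x 4) (cycle_tally [0,0,1,1] [0,1,0,1]) / 12"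
    "char (schur_functor [3,1] std_rep) g = tally_value (psum x 4) (cycle_tally [0,0,0,1] [0,1,2,0]) / 8"
    "char (schur_functor [3,2,1] std_rep) g = tally_value (psum x 4) (cycle_tally [0,0,0,1,1,2] [0,1,2,0,1,0]) / 45"
    "char (schur_functor [3,3,2] std_rep) g = tally_value (psum x 4) (cycle_tally [0,0,0,1,1,1,2,2] [0,1,2,0,1,2,0,1]) / 960"
  using schur_functor_char(2)[OF cells_22 _ tableau_22 young_scalar_22 _ assms]
    schur_functor_char(2)[OF cells_31 _ tableau_31 young_scalar_31 _ assms]
    schur_functor_char(2)[OF cells_321 _ tableau_321 young_scalar_321 _ assms]
    schur_functor_char(2)[OF cells_332 _ tableau_332 young_scalar_332 _ assms]
  unfolding char_def by simp_all

text \<open>Newton's identities with e_4 = 1, the source of the constant 4 and of the final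
  \<open>p 1\<close>. Power sums up to 5 suffice: the largest hook length of the four partitions is
  5, so cycle types with a longer cycle have coefficient 0 in the tallies.\<close>

lemma power_sums:
  fixes a b c d :: complex
  assumes one: "a * b * c * d = 1" and p: "\<And>k. p k = a ^ k + b ^ k + c ^ k + d ^ k"
  defines "e1 \<equiv> a + b + c + d" and "e2 \<equiv> a*b + a*c + a*d + b*c + b*d + c*d"
    and "e3 \<equiv> a*b*c + a*b*d + a*c*d + b*c*d"
  shows "p 1 = e1" "p 2 = e1^2 - 2 * e2" "p 3 = e1^3 - 3 * e1 * e2 + 3 * e3"
    "p 4 = e1 * p 3 - e2 * p 2 + e3 * p 1 - 4" "p 5 = e1 * p 4 - e2 * p 3 + e3 * p 2 - p 1"
proof -
  show "p 1 = e1" by (simp add: p e1_def)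
  show "p 2 = e1^2 - 2 * e2" unfolding p e1_def e2_def by Groebner_Basis.algebra
  show "p 3 = e1^3 - 3 * e1 * e2 + 3 * e3" unfolding p e1_def e2_def e3_def by Groebner_Basis.algebra
  show "p 4 = e1 * p 3 - e2 * p 2 + e3 * p 1 - 4"
    unfolding p e1_def e2_def e3_def using one by Groebner_Basis.algebra
  show "p 5 = e1 * p 4 - e2 * p 3 + e3 * p 2 - p 1"
    unfolding p e1_def e2_def e3_def using one by Groebner_Basis.algebra
qed

text \<open>The right sides are the polynomials found in \<open>veronese_numerator\<close>; this is
  where the coefficients of the series become characters of Schur functors.\<close>

lemma schur_values:
  fixes e1 e2 e3 :: complex
  assumes p: "p 1 = e1" "p 2 = e1^2 - 2 * e2" "p 3 = e1^3 - 3 * e1 * e2 + 3 * e3"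
    "p 4 = e1 * p 3 - e2 * p 2 + e3 * p 1 - 4" "p 5 = e1 * p 4 - e2 * p 3 + e3 * p 2 - p 1"
  shows "tally_value p (cycle_tally [0,0,1,1] [0,1,0,1]) / 12 = e2^2 - e1*e3"
    "tally_value p (cycle_tally [0,0,0,1] [0,1,2,0]) / 8 = e1^2*e2 - e2^2 - e1*e3 + 1"
    "tally_value p (cycle_tally [0,0,0,1,1,2] [0,1,2,0,1,0]) / 45 = e1*e2*e3 - e3^2 - e1^2"
    "tally_value p (cycle_tally [0,0,0,1,1,1,2,2] [0,1,2,0,1,2,0,1]) / 960 = e2*e3^2 - e1*e3 - e2^2 + 1"
proof -
  have p4: "p 4 = e1^4 - 4*e1^2*e2 + 2*e2^2 + 4*e1*e3 - 4"
    unfolding p(4) p(1-3) by Groebner_Basis.algebra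
  have p5: "p 5 = e1^5 - 5*e1^3*e2 + 5*e1*e2^2 + 5*e1^2*e3 - 5*e2*e3 - 5*e1"
    unfolding p(5) p4 p(1-3) by Groebner_Basis.algebra
  note q = p(1-3) p4 p5
  have "tally_value p (cycle_tally [0,0,1,1] [0,1,0,1]) = p 1^4 + 3 * p 2^2 - 4 * p 1 * p 3"
    unfolding cycle_tally_22 by (simp add: power2_eq_square power4_eq_xxxx)
  also have "\<dots> = 12 * (e2^2 - e1*e3)" unfolding q by Groebner_Basis.algebra
  finally show "tally_value p (cycle_tally [0,0,1,1] [0,1,0,1]) / 12 = e2^2 - e1*e3" by simp
  have "tally_value p (cycle_tally [0,0,0,1] [0,1,2,0]) = p 1^4 + 2 * p 1^2 * p 2 - p 2^2 - 2 * p 4"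
    unfolding cycle_tally_31 by (simp add: power2_eq_square power4_eq_xxxx)
  also have "\<dots> = 8 * (e1^2*e2 - e2^2 - e1*e3 + 1)" unfolding q by Groebner_Basis.algebra
  finally show "tally_value p (cycle_tally [0,0,0,1] [0,1,2,0]) / 8 = e1^2*e2 - e2^2 - e1*e3 + 1" by simp
  have "tally_value p (cycle_tally [0,0,0,1,1,2] [0,1,2,0,1,0]) =
      p 1^6 - 5 * p 1^3 * p 3 - 5 * p 3^2 + 9 * p 1 * p 5"
    unfolding cycle_tally_321 by (simp add: eval_nat_numeral)
  also have "\<dots> = 45 * (e1*e2*e3 - e3^2 - e1^2)" unfolding q by Groebner_Basis.algebra
  finally show "tally_value p (cycle_tally [0,0,0,1,1,2] [0,1,2,0,1,0]) / 45 = e1*e2*e3 - e3^2 - e1^2" by simp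
  have "tally_value p (cycle_tally [0,0,0,1,1,1,2,2] [0,1,2,0,1,2,0,1]) =
      p 1^8 + 10 * p 1^4 * p 2^2 - 16 * p 1^5 * p 3 + 80 * p 1 * p 2^2 * p 3 + 64 * p 1^3 * p 5
      - 120 * p 1^2 * p 2 * p 4 - 64 * p 3 * p 5 - 15 * p 2^4 + 60 * p 4^2"
    unfolding cycle_tally_332 by (simp add: power_numeral_reduce)
  also have "\<dots> = 960 * (e2*e3^2 - e1*e3 - e2^2 + 1)" unfolding q by Groebner_Basis.algebra
  finally show "tally_value p (cycle_tally [0,0,0,1,1,1,2,2] [0,1,2,0,1,2,0,1]) / 960 = e2*e3^2 - e1*e3 - e2^2 + 1" by simp
qed

subsection \<open>The identity in the representation ring\<close>

lemma rcls_iso: "rep_iso U W \<Longrightarrow> rcls U = rcls W"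
  by (simp only: rcls_def rep_class.abs_eq_iff[THEN iffD2])

lemma rcls_sum: "rcls (rep_sum U W) = rcls U + rcls W"
  by (simp add: rcls_def plus_rep_ring.abs_eq plus_rep_class.abs_eq)

lemma rcls_tensor: "rcls (rep_tensor U W) = rcls U * rcls W"
proof -
  have "a + 0 = a" "a * 0 = 0" for a :: rep_class by simp_all
  then show ?thesis by (simp add: rcls_def times_rep_ring.abs_eq times_rep_class.abs_eq)
qed

theorem mainTheorem8:
  fixes t :: int
  assumes "t \<ge> 2"
  shows "Sym_Sym t 2 = Sym (2 * t)
    + Schur [2, 2] * (Sym_Sym (t - 2) 2 + Sym_Sym (t - 6) 2)
    - Schur [3, 2, 1] * (Sym_Sym (t - 3) 2 + Sym_Sym (t - 5) 2)
    + (Schur [3, 3, 2] + Schur [3, 1]) * Sym_Sym (t - 4) 2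
    - Sym_Sym (t - 8) 2"
proof -
  define S where "S m = sym_power m (sym_power 2 std_rep)" for m
  \<comment> \<open>Terms with a minus sign are moved across, so that \<open>L\<close> and
    \<open>R\<close> are actual representations and the claim becomes an isomorphism between
    them.\<close>
  define L where "L = rep_sum (rep_sum (S t) (rep_tensor (schur_functor [3,2,1] std_rep) (rep_sum (S (t - 3)) (S (t - 5))))) (S (t - 8))"
  define R where "R = rep_sum (rep_sum (sym_power (2 * t) std_rep) (rep_tensor (schur_functor [2,2] std_rep) (rep_sum (S (t - 2)) (S (t - 6)))))
    (rep_tensor (rep_sum (schur_functor [3,3,2] std_rep) (schur_functor [3,1] std_rep)) (S (t - 4)))"
  have std: "semisimple std_rep" by (simp add: star_rep_semisimple)
  have ss: "semisimple L" "semisimple R"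
    unfolding L_def R_def S_def
    by (intro semisimple_sum semisimple_tensor semisimple_sym_power schur_semisimple std)+
  have "mtrace (act L g) = mtrace (act R g)" if g: "g \<in> SL4" for g
  proof -
    obtain x where x: "\<And>d q. q permutes {..<d} \<Longrightarrow>
        mtrace (place_perm (rdim std_rep) d q * tensor_mat (act std_rep g) d) = fixsum x (rdim std_rep) {..<d} q (\<lambda>_. Suc 0)"
      "\<And>k. mtrace (matpow 4 g k) = psum x 4 k" "(\<Prod>i<4. x i) = 1"
      using std_eigenvalues[OF g] by metis
    define p where "p = psum x 4"
    define q where "q = (\<lambda>k. ((p k)\<^sup>2 + p (2 * k)) / 2)"
    have one: "x 0 * x 1 * x 2 * x 3 = 1"
      using x(3) by (simp add: eval_nat_numeral)
    have p: "p k = x 0 ^ k + x 1 ^ k + x 2 ^ k + x 3 ^ k" for k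
      by (simp add: p_def psum_def eval_nat_numeral)
    have cS: "char (S m) g = complete_h q m" for m
      unfolding S_def by (rule char_sym_power[OF g]) (simp add: q_def p_def char_sym_square[OF g x(2)])
    have cStd: "char (sym_power m std_rep) g = complete_h p m" for m
      by (rule char_sym_power[OF g]) (simp add: p_def char_def x(2))
    define e1 where "e1 = x 0 + x 1 + x 2 + x 3"
    define e2 where "e2 = x 0 * x 1 + x 0 * x 2 + x 0 * x 3 + x 1 * x 2 + x 1 * x 3 + x 2 * x 3"
    define e3 where "e3 = x 0 * x 1 * x 2 + x 0 * x 1 * x 3 + x 0 * x 2 * x 3 + x 1 * x 2 * x 3"
    note elementary = schur_values[OF power_sums[OF one p], folded e1_def e2_def e3_def]
    note schur = schur_tally[OF g x(1), folded p_def, unfolded elementary]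
    have t: "t \<ge> 0" using assms by simp
    note series = veronese_series[OF one p t, folded e1_def e2_def e3_def q_def]
    have "char L g = complete_h q t + (e1*e2*e3 - e3^2 - e1^2) * (complete_h q (t - 3) + complete_h q (t - 5))
        + complete_h q (t - 8)"
      unfolding L_def by (simp only: char_simps[OF g] cS schur)
    also have "\<dots> = complete_h p (2 * t) + (e2^2 - e1*e3) * (complete_h q (t - 2) + complete_h q (t - 6))
        + ((e2*e3^2 - e1*e3 - e2^2 + 1) + (e1^2*e2 - e2^2 - e1*e3 + 1)) * complete_h q (t - 4)"
      unfolding series by Groebner_Basis.algebra
    also have "\<dots> = char R g"
      unfolding R_def by (simp only: char_simps[OF g] cS cStd schur)
    finally have "char L g = char R g" .
    then show ?thesis by (simp add: char_def)
  qed
  then have "rcls L = rcls R" by (intro rcls_iso semisimple_char_iso ss)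
  then have "rcls (S t) + Schur [3,2,1] * (rcls (S (t - 3)) + rcls (S (t - 5))) + rcls (S (t - 8)) =
      Sym (2 * t) + Schur [2,2] * (rcls (S (t - 2)) + rcls (S (t - 6))) + (Schur [3,3,2] + Schur [3,1]) * rcls (S (t - 4))"
    by (simp add: L_def R_def rcls_sum rcls_tensor)
  then show ?thesis unfolding S_def by (simp add: algebra_simps)
qed

end
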